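(* For any complex number $z$, the following identity of formal power series in $x$ holds: $$\left(\prod_{k \geq 1} \frac{(1-x^{2k})^{z+1}}{1-x^k}\right)^{2z-1}= \sum_{\lambda \in SC} \delta_\lambda \, x^{|\lambda|} \prod_{h \in \mathcal{H}(\lambda)}\left(1-\frac{2z}{h\, \varepsilon_h}\right),$$ where the sum ranges over all self-conjugate partitions $\lambda$.
   Context: A partition $\lambda=(\lambda_1,\ldots,\lambda_\ell)$ is a finite non-increasing sequence of positive integers (possibly empty); its weight is $|\lambda|=\sum_i\lambda_i$. Its Ferrers diagram (French convention: row $1$ at the bottom) is the set of boxes $(j,k)$ with $1\le j\le \ell$ (row index) and $1\le k\le \lambda_j$ (column index). The hook of a box $v$ consists of $v$, the boxes in the same row to its right, and the boxes in the same column above it (larger row index); the hook length $h_v$ is the number of boxes in the hook. $\mathcal{H}(\lambda)$ is the multi-set of hook lengths of all boxes of $\lambda$. The conjugate $\lambda^*$ is the reflection of the diagram in the principal diagonal $\{(i,i)\}$, and $\lambda$ is self-conjugate if $\lambda=\lambda^*$; $SC$ is the set of self-conjugate partitions (including the empty one). The Durfee length $D(\lambda)$ is the side length of the largest square contained in the Ferrers diagram, and $\delta_\lambda=(-1)^{D(\lambda)}$. For the hook length $h$ of a box $v=(j,k)$, $\varepsilon_h=-1$ if $v$ is strictly above the principal diagonal (i.e. $j>k$), and $\varepsilon_h=1$ otherwise; thus $\varepsilon_h$ depends on the box, and a product over $h\in\mathcal{H}(\lambda)$ means a product over all boxes of $\lambda$. Complex powers of a power series $F$ with constant term $1$ are $F^a=\exp(a\log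 F)$. *)

theory Defs
  imports
    "HOL-Analysis.Analysis"
    "HOL-Computational_Algebra.Formal_Power_Series"
begin

definition partitions :: "nat list set" where
  "partitions = {\<nu>. sorted_wrt (\<ge>) \<nu> \<and> (\<forall>p\<in>set \<nu>. p > 0)}"

text \<open>Boxes are pairs (row, column), both counted from 1.\<close>

definition ferrers :: "nat list \<Rightarrow> (nat \<times> nat) set" where
  "ferrers \<nu> = {(j, k). 1 \<le> j \<and> j \<le> length \<nu> \<and> 1 \<le> k \<and> k \<le> \<nu> ! (j - 1)}"

definition hook :: "nat list \<Rightarrow> nat \<times> nat \<Rightarrow> (nat \<times> nat) set" where
  "hook \<nu> v = {w \<in> ferrers \<nu>.
     (fst w = fst v \<and> snd w \<ge> snd v) \<or> (snd w = snd v \<and> fst w \<ge> fst v)}"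

definition hook_length :: "nat list \<Rightarrow> nat \<times> nat \<Rightarrow> nat" where
  "hook_length \<nu> v = card (hook \<nu> v)"

definition hook_sign :: "nat \<times> nat \<Rightarrow> int" where
  "hook_sign v = (if fst v > snd v then - 1 else 1)"

text \<open>
  A partition is determined by its diagram (lemma \<open>inj_on_ferrers\<close> below), so equality with the
  conjugate is expressed as invariance of the diagram under reflection in the principal diagonal.
\<close>

definition self_conjugate_partitions :: "nat list set" where
  "self_conjugate_partitions = {\<nu> \<in> partitions. prod.swap ` ferrers \<nu> = ferrers \<nu>}"

text \<open>The side length 0 is always admissible: it gives the empty square.\<close>

definition durfee :: "nat list \<Rightarrow> nat" where
  "durfee \<nu> = Max {d. \<exists>a b. {a<..a + d} \<times> {b<..b + d} \<subseteq> ferrers \<nu>}"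

text \<open>
  \<open>F\<^sup>a = exp (a log F)\<close>, meaningful for series with constant term 1. Here \<open>fps_ln 1\<close> is the series
  of \<open>log (1 + X)\<close>, whence the substitution of \<open>F - 1\<close>.
\<close>

definition fps_cpow :: "complex fps \<Rightarrow> complex \<Rightarrow> complex fps" where
  "fps_cpow F a = fps_exp 1 oo (fps_const a * (fps_ln 1 oo (F - 1)))"

lemma ferrers_row:
  assumes "1 \<le> j" "j \<le> length \<nu>"
  shows "{k. (j, k) \<in> ferrers \<nu>} = {1..\<nu> ! (j - 1)}"
  using assms by (auto simp: ferrers_def)

lemma ferrers_column_1:
  assumes "\<nu> \<in> partitions"
  shows "{j. (j, 1) \<in> ferrers \<nu>} = {1..length \<nu>}"
proof -
  have "\<nu> ! (j - 1) \<ge> 1" if "1 \<le> j" "j \<le> length \<nu>" for j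
  proof -
    have "\<nu> ! (j - 1) \<in> set \<nu>"
      using that by (intro nth_mem) auto
    thus ?thesis
      using assms by (auto simp: partitions_def Suc_le_eq)
  qed
  thus ?thesis
    by (auto simp: ferrers_def)
qed

lemma inj_on_ferrers: "inj_on ferrers partitions"
proof (rule inj_onI)
  fix \<nu> \<mu> assume part: "\<nu> \<in> partitions" "\<mu> \<in> partitions" and eq: "ferrers \<nu> = ferrers \<mu>"
  have "{1..length \<nu>} = {1..length \<mu>}"
    using ferrers_column_1[OF part(1)] ferrers_column_1[OF part(2)] eq by simp
  from arg_cong[OF this, of card] have len: "length \<nu> = length \<mu>"
    unfolding card_atLeastAtMost by linarith
  show "\<nu> = \<mu>"
  proof (rule nth_equalityI[OF len])
    fix i assume "i < length \<nu>"
    hence "{1..\<nu> ! i} = {1..\<mu> ! i}"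
      using ferrers_row[of "Suc i" \<nu>] ferrers_row[of "Suc i" \<mu>] eq len by auto
    from arg_cong[OF this, of card] show "\<nu> ! i = \<mu> ! i"
      unfolding card_atLeastAtMost by linarith
  qed
qed

end

theory Submission
  imports Defs "HOL-Complex_Analysis.Complex_Analysis" "Jordan_Normal_Form.Determinant"
begin

text \<open>
  On both sides the coefficient of a power of \<open>x\<close> is a polynomial in \<open>z\<close>, so it suffices to take
  for \<open>z\<close> a positive integer \<open>t\<close>. A self-conjugate partition is determined by the set \<open>A\<close> of the arm
  lengths of its diagonal boxes. For \<open>z = t\<close> its hook product vanishes unless the bead set
  \<open>A \<union> {- 1 - n | n \<notin> A}\<close> is closed under subtracting \<open>2 * t\<close>; such sets correspond to vectors
  \<open>n \<in> \<int>\<^sup>t\<close>. Moving one bead at a time shows that the weight is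
  \<open>\<Sum>i<t. 2 * t * n i\<^sup>2 + (2 * i + 1) * n i\<close> and that the signed hook product is, up to a constant,
  the Vandermonde product in the squares of \<open>v i = 2 * i + 1 + 4 * t * n i\<close>. The right-hand side
  has thus become a lattice sum of Macdonald's type.

  This lattice sum is a multiple of the determinant of the first even Taylor coefficients at \<open>z = 1\<close> of
  \<open>t\<close> theta functions. The space spanned by these functions contains the products
  \<open>K * a ^ (t - 1 - k) * b ^ k\<close> for three theta functions \<open>K\<close>, \<open>a\<close>, \<open>b\<close>, with the same
  transition matrix whether one takes Taylor coefficients or values. In the new basis the determinants are of
  Vandermonde type: that of the Taylor coefficients depends only on \<open>K\<close> and one two-by-two
  minor, while that of the values at the \<open>t\<close> roots of \<open>z ^ (2 * t) = -1\<close> in the upper half plane is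
  evaluated by an addition formula for theta functions. In the old basis the
  latter determinant is read off from the triple product. Eliminating the transition matrix gives
  the Wronskian as a quotient of Euler products.
\<close>

text \<open>Setting z = exp u and shifting exponents by 1/2 makes the theta functions even in u up
  to a harmless factor, so their Taylor coefficients are moments of even powers of v, and
  multilinear expansion of the determinant produces the Vandermonde products in the squares. The
  difficulty is to evaluate this lattice sum as a product. Two determinants sharing a transition
  matrix are compared, so that the unknown matrix cancels. The points with z ^ (2 * t) = -1 are
  chosen because there z ^ (2 * t * k) = (-1) ^ k: each class function becomes a theta constant
  times an expression free of x, and the remaining constants are fixed by constant terms. Only one
  point of each pair z, 1 / z is taken, since the two give proportional columns. The product over
  unordered pairs of points is evaluated by completing it to all ordered pairs, which yields only
  its square. The determinant identity is proved for real x between 0 and 1, where positivity keeps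
  a leading coefficient nonzero; the identity theorem carries it over to formal power
  series.\<close>

no_notation Infinite_Set_Sum.abs_summable_on (infix \<open>abs'_summable'_on\<close> 50)

subsection \<open>Rapidly decreasing families over the integers\<close>

text \<open>Absolute convergence of the Laurent series with coefficients \<open>c\<close> at every
  nonzero point. This is strong enough to allow polynomial weights and products of series.\<close>

definition rapid :: "(int \<Rightarrow> complex) \<Rightarrow> bool" where
  "rapid c \<longleftrightarrow> (\<forall>r>0. (\<lambda>n. norm (c n) * r powi n) summable_on UNIV)"

text \<open>A ratio test for steps of length \<open>d\<close>. Beyond the cut-off a partial sum is
  at most its first block plus half of a shorter partial sum, so by induction it stays below twice
  the first block.\<close>

lemma summable_halving:
  fixes f :: "nat \<Rightarrow> real"
  assumes pos: "\<And>n. f n \<ge> 0" and d: "d > 0" and half: "\<And>n. n \<ge> N \<Longrightarrow> f (n + d) \<le> f n / 2"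
  shows "summable f"
proof -
  define g where "g n = f (n + N)" for n
  have g: "g (n + d) \<le> g n / 2" for n
    using half[of "n + N"] by (simp add: g_def add.assoc add.commute[of N d])
  have gpos: "g n \<ge> 0" for n by (simp add: g_def pos)
  define S where "S = (\<Sum>n<d. g n)"
  have S: "S \<ge> 0" unfolding S_def by (intro sum_nonneg gpos)
  have bound: "(\<Sum>n<m. g n) \<le> 2 * S" for m
  proof (induction m rule: less_induct)
    case (less m)
    show ?case
    proof (cases "m \<le> d")
      case True
      have "(\<Sum>n<m. g n) \<le> S" unfolding S_def using True by (intro sum_mono2) (auto simp: gpos)
      with S show ?thesis by linarith
    next
      case False
      then obtain m' where m: "m = d + m'" using le_Suc_ex nat_le_linear by blast
      have "(\<Sum>n<m. g n) = S + (\<Sum>n<m'. g (n + d))"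
        using sum.atLeastLessThan_concat[of 0 d "d + m'" g] sum.shift_bounds_nat_ivl[of g 0 d m']
        by (simp add: S_def m lessThan_atLeast0 add.commute)
      also have "\<dots> \<le> S + (\<Sum>n<m'. g n / 2)" by (intro add_left_mono sum_mono g)
      also have "\<dots> = S + (\<Sum>n<m'. g n) / 2" by (simp add: sum_divide_distrib)
      also have "\<dots> \<le> 2 * S" using less.IH[of m'] d m by simp
      finally show ?thesis .
    qed
  qed
  have "summable g"
  proof (rule bounded_imp_summable[of _ "2 * S"])
    show "(\<Sum>n\<le>m. g n) \<le> 2 * S" for m
      using bound[of "Suc m"] by (simp only: lessThan_Suc_atMost)
  qed (rule gpos)
  thus ?thesis unfolding g_def by (simp add: summable_iff_shift)
qed

lemma quasi_summable_nat:
  fixes x :: complex and c :: "int \<Rightarrow> complex"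
  assumes x: "x \<noteq> 0" "norm x < 1" and d: "d > (0::nat)" and r: "r > 0"
    and c: "\<And>n. c (n + int d) = x powi (2 * n + e) * c n"
  shows "summable (\<lambda>n. norm (c (int n)) * r powi int n)"
proof -
  have "(\<lambda>n. norm x ^ n * (norm x powi e * r ^ d)) \<longlonglongrightarrow> 0 * (norm x powi e * r ^ d)"
    by (intro tendsto_mult tendsto_const LIMSEQ_power_zero) (use x in auto)
  hence "eventually (\<lambda>n. norm x ^ n * (norm x powi e * r ^ d) < 1/2) sequentially"
    by (intro order_tendstoD(2)) auto
  then obtain N where N: "norm x ^ n * (norm x powi e * r ^ d) < 1/2" if "n \<ge> N" for n
    by (auto simp: eventually_sequentially)
  show ?thesis
  proof (rule summable_halving[OF _ d])
    fix n assume n: "n \<ge> N"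
    have "norm (c (int (n + d))) * r powi int (n + d)
        = (norm x ^ (2*n) * (norm x powi e * r ^ d)) * (norm (c (int n)) * r powi int n)"
      using c[of "int n"] x r by (simp add: norm_mult norm_power norm_power_int power_int_add power_add power_int_mult power_mult algebra_simps)
    also have "\<dots> \<le> (1/2) * (norm (c (int n)) * r powi int n)"
      using N[of "2*n"] n r by (intro mult_right_mono) auto
    finally show "norm (c (int (n + d))) * r powi int (n + d) \<le> norm (c (int n)) * r powi int n / 2" by simp
  qed (use r in auto)
qed

text \<open>The recurrence forces Gaussian decay in both directions: the reflected sequence
  satisfies one of the same form with \<open>2 * d - e\<close> in place of \<open>e\<close>.\<close>

lemma quasi_rapid:
  fixes x :: complex and c :: "int \<Rightarrow> complex"
  assumes x: "x \<noteq> 0" "norm x < 1" and d: "d > (0::nat)"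
    and c: "\<And>n. c (n + int d) = x powi (2 * n + e) * c n"
  shows "rapid c"
  unfolding rapid_def
proof safe
  fix r :: real assume r: "r > 0"
  define f where "f n = norm (c n) * r powi n" for n
  have 1: "summable (\<lambda>n. f (int n))" unfolding f_def by (rule quasi_summable_nat[OF x d r c])
  have c': "c (- (n + int d)) = x powi (2 * n + (2 * int d - e)) * c (- n)" for n
    using c[of "- n - int d"] x
    by (simp add: power_int_add power_int_diff power_int_minus algebra_simps divide_simps)
  have 2: "summable (\<lambda>n. f (- int n))"
    using quasi_summable_nat[of x d "1/r" "\<lambda>n. c (- n)", OF x d _ c'] r
    by (simp add: f_def power_int_minus field_simps power_int_divide_distrib)
  have fpos: "f n \<ge> 0" for n using r by (simp add: f_def)
  have 3: "f summable_on range int"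
    by (subst summable_on_reindex) (use 1 fpos in \<open>auto intro!: summable_nonneg_imp_summable_on simp: o_def\<close>)
  have "inj (\<lambda>n. - int n)" by (auto intro: injI)
  hence 4: "f summable_on range (\<lambda>n. - int n)"
    by (subst summable_on_reindex) (use 2 fpos in \<open>auto intro!: summable_nonneg_imp_summable_on simp: o_def\<close>)
  have "(UNIV :: int set) = range int \<union> range (\<lambda>n. - int n)"
    by (auto simp: image_iff) (metis int_cases2)
  with summable_on_union[OF 3 4] show "(\<lambda>n. norm (c n) * r powi n) summable_on UNIV"
    by (simp add: f_def[abs_def])
qed

lemma rapid_powi:
  assumes "rapid c" "z \<noteq> 0"
  shows "(\<lambda>n. c n * z powi n) abs_summable_on UNIV"
  using assms unfolding rapid_def by (simp add: norm_mult norm_power_int)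

text \<open>Polynomial growth is absorbed by changing the radius: a power of |n| + |w| is bounded by
  an exponential, and exp |n| is at most \<open>R powi n + (1/R) powi n\<close>, so the series at
  the radii \<open>norm z * R\<close> and \<open>norm z / R\<close> dominate.\<close>

lemma rapid_shift_moment:
  assumes "rapid c" "z \<noteq> 0"
  shows "(\<lambda>n. c n * z powi n * (of_int n + w) ^ k) abs_summable_on UNIV"
proof -
  define R where "R = exp (1::real)"
  define C where "C = fact k * exp (norm w)"
  define g where "g n = C * (norm (c n) * (norm z * R) powi n) + C * (norm (c n) * (norm z / R) powi n)" for n
  have R: "R > 0" by (simp add: R_def)
  have "g summable_on UNIV"
    using assms R unfolding g_def[abs_def] rapid_def by (intro summable_on_add summable_on_cmult_right) auto
  moreover have "norm (c n * z powi n * (of_int n + w) ^ k) \<le> g n" for n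
  proof -
    have "norm (of_int n + w) ^ k \<le> (\<bar>of_int n\<bar> + norm w) ^ k"
      by (intro power_mono norm_triangle_le) auto
    also have "\<dots> \<le> fact k * exp (\<bar>of_int n\<bar> + norm w)"
    proof -
      have "(\<Sum>m\<in>{k}. (\<bar>of_int n\<bar> + norm w) ^ m /\<^sub>R fact m) \<le> exp (\<bar>of_int n\<bar> + norm w)"
        unfolding exp_def by (intro sum_le_suminf summable_exp_generic) auto
      thus ?thesis by (simp add: divide_simps mult.commute)
    qed
    also have "\<dots> = C * exp \<bar>of_int n\<bar>" by (simp add: C_def exp_add)
    also have "\<dots> \<le> C * (R powi n + (1/R) powi n)"
    proof -
      have "exp (real_of_int n) = R powi n" unfolding R_def by (simp add: exp_power_int)
      moreover have "exp (- real_of_int n) = (1/R) powi n"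
        using calculation by (simp add: exp_minus power_int_divide_distrib divide_inverse power_int_inverse)
      moreover have "exp \<bar>real_of_int n\<bar> \<le> exp (real_of_int n) + exp (- real_of_int n)"
        by (cases "n \<ge> 0") auto
      ultimately show ?thesis unfolding C_def by (intro mult_left_mono) auto
    qed
    finally have "norm (c n * z powi n * (of_int n + w) ^ k)
        \<le> norm (c n) * norm z powi n * (C * (R powi n + (1/R) powi n))"
      unfolding norm_mult norm_power norm_power_int by (intro mult_left_mono) auto
    also have "\<dots> = g n"
      by (simp add: g_def power_int_mult_distrib power_int_divide_distrib algebra_simps)
    finally show ?thesis .
  qed
  ultimately show ?thesis by (rule summable_on_comparison_test) auto
qed

lemma infsum_int_tannery:
  fixes a :: "nat \<Rightarrow> int \<Rightarrow> complex"
  assumes lim: "\<And>j. (\<lambda>N. a N j) \<longlonglongrightarrow> b j" and bd: "\<And>N j. norm (a N j) \<le> M j"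
    and M: "M summable_on UNIV"
  shows "(\<lambda>N. infsum (a N) UNIV) \<longlonglongrightarrow> infsum b UNIV"
proof -
  have Mpos: "M j \<ge> 0" for j using bd[of 0 j] norm_ge_zero order_trans by blast
  have reindex: "infsum f (UNIV::int set) = (\<Sum>n. f (int_decode n))"
    if "\<And>j. norm (f j) \<le> M j" for f :: "int \<Rightarrow> complex"
  proof -
    have "(\<lambda>j. norm (f j)) summable_on UNIV"
      by (rule summable_on_comparison_test[OF M]) (use that in auto)
    hence "f summable_on UNIV" by (rule abs_summable_summable)
    hence "(f has_sum infsum f UNIV) UNIV" by simp
    hence "((\<lambda>n. f (int_decode n)) has_sum infsum f UNIV) UNIV"
      by (subst has_sum_reindex_bij_betw[OF bij_int_decode]) auto
    thus ?thesis by (auto dest!: has_sum_imp_sums sums_unique)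
  qed
  have nb: "norm (b j) \<le> M j" for j
    by (rule tendsto_upperbound[OF tendsto_norm[OF lim[of j]]]) (use bd in auto)
  have "(\<lambda>n. M (int_decode n)) summable_on UNIV"
    by (subst summable_on_reindex_bij_betw[OF bij_int_decode]) (rule M)
  hence SM: "summable (\<lambda>n. M (int_decode n))" by (rule summable_on_imp_summable)
  have "((\<lambda>N. suminf (\<lambda>k. a N (int_decode k))) \<longlongrightarrow> suminf (\<lambda>k. b (int_decode k))) sequentially"
    by (rule tannerys_theorem[where M = "\<lambda>k. M (int_decode k)", THEN conjunct2, THEN conjunct2])
       (use lim bd SM in \<open>auto intro: always_eventually\<close>)
  thus ?thesis using reindex[OF bd] reindex[OF nb] by simp
qed

subsection \<open>The triple product\<close>

definition qpoch :: "complex \<Rightarrow> nat \<Rightarrow> complex" where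
  "qpoch q n = (\<Prod>k<n. 1 - q ^ Suc k)"

definition qbinom :: "complex \<Rightarrow> nat \<Rightarrow> nat \<Rightarrow> complex" where
  "qbinom q n m = (if m \<le> n then qpoch q n / (qpoch q m * qpoch q (n - m)) else 0)"

lemma qpoch_0 [simp]: "qpoch q 0 = 1"
  by (simp add: qpoch_def)

lemma qpoch_Suc: "qpoch q (Suc n) = qpoch q n * (1 - q ^ Suc n)"
  by (simp add: qpoch_def)

lemma one_minus_power_nonzero:
  fixes q :: complex
  assumes "norm q < 1"
  shows "1 - q ^ Suc k \<noteq> 0"
proof
  assume "1 - q ^ Suc k = 0"
  hence "norm q ^ Suc k = 1" by (metis norm_one norm_power right_minus_eq)
  moreover have "norm q ^ Suc k < 1" using assms by (simp only: power_less_one_iff[OF norm_ge_zero] zero_less_Suc)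
  ultimately show False by simp
qed

lemma qpoch_nonzero: "norm q < 1 \<Longrightarrow> qpoch q n \<noteq> 0"
  unfolding qpoch_def prod_zero_iff[OF finite_lessThan] using one_minus_power_nonzero by blast

lemma qbinom_Suc:
  assumes q: "norm q < 1" and m: "m \<le> n"
  shows "qbinom q (Suc n) (Suc m) = qbinom q n (Suc m) + q ^ (n - m) * qbinom q n m"
proof (cases "m = n")
  case True
  thus ?thesis using qpoch_nonzero[OF q] by (simp add: qbinom_def)
next
  case False
  then obtain k where n: "n = m + Suc k" using m less_iff_Suc_add by (metis add_Suc_right le_neq_implies_less)
  have nz: "qpoch q k \<noteq> 0" "qpoch q m \<noteq> 0" "1 - q ^ Suc k \<noteq> 0" "1 - q ^ Suc m \<noteq> 0"
    using qpoch_nonzero[OF q] one_minus_power_nonzero[OF q] by auto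
  have sub: "Suc n - Suc m = Suc k" "n - Suc m = k" "n - m = Suc k" by (auto simp: n)
  have key: "1 - q ^ Suc n = (1 - q ^ Suc k) + q ^ Suc k * (1 - q ^ Suc m)"
    by (simp add: n power_add algebra_simps)
  define A B where "A = 1 - q ^ Suc k" and "B = 1 - q ^ Suc m"
  have "qbinom q (Suc n) (Suc m) = qpoch q n * (A + q ^ Suc k * B) / ((qpoch q m * B) * (qpoch q k * A))"
    using m by (simp add: qbinom_def sub qpoch_Suc key A_def B_def del: power_Suc)
  also have "\<dots> = qpoch q n / ((qpoch q m * B) * qpoch q k) + q ^ Suc k * (qpoch q n / (qpoch q m * (qpoch q k * A)))"
    using nz unfolding A_def[symmetric] B_def[symmetric] by (simp add: field_simps)
  also have "\<dots> = qbinom q n (Suc m) + q ^ (n - m) * qbinom q n m"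
    using n by (simp add: qbinom_def sub qpoch_Suc A_def B_def del: power_Suc)
  finally show ?thesis .
qed

lemma q_binomial_theorem:
  assumes q: "norm q < 1"
  shows "(\<Prod>k<n. 1 + y * q ^ k) = (\<Sum>m\<le>n. qbinom q n m * q ^ (m choose 2) * y ^ m)"
proof (induction n)
  case 0
  show ?case by (simp add: qbinom_def numeral_2_eq_2)
next
  case (Suc n)
  define f where "f m = qbinom q n m * q ^ (m choose 2) * y ^ m" for m
  have c0: "(0::nat) choose 2 = 0" by (simp add: numeral_2_eq_2)
  have f0: "f 0 = 1" using qpoch_nonzero[OF q] by (simp add: f_def qbinom_def c0)
  have fn: "f (Suc n) = 0" by (simp add: f_def qbinom_def)
  have "(\<Sum>m\<le>Suc n. qbinom q (Suc n) m * q ^ (m choose 2) * y ^ m)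
      = 1 + (\<Sum>m\<le>n. qbinom q (Suc n) (Suc m) * q ^ (Suc m choose 2) * y ^ Suc m)"
    using qpoch_nonzero[OF q] by (subst sum.atMost_Suc_shift) (simp add: qbinom_def c0)
  also have "(\<Sum>m\<le>n. qbinom q (Suc n) (Suc m) * q ^ (Suc m choose 2) * y ^ Suc m)
      = (\<Sum>m\<le>n. f (Suc m) + y * q ^ n * f m)"
  proof (rule sum.cong, goal_cases)
    case (2 m)
    hence m: "m \<le> n" by simp
    have ch: "Suc m choose 2 = m + (m choose 2)" by (simp add: numeral_2_eq_2)
    have "q ^ (n - m) * q ^ m = q ^ n" using m by (simp flip: power_add)
    thus ?case
      unfolding qbinom_Suc[OF q m] f_def
      by (simp add: algebra_simps ch power_add)
  qed auto
  also have "\<dots> = (\<Sum>m\<le>n. f (Suc m)) + y * q ^ n * (\<Sum>m\<le>n. f m)"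
    by (simp add: sum.distrib sum_distrib_left)
  also have "1 + ((\<Sum>m\<le>n. f (Suc m)) + y * q ^ n * (\<Sum>m\<le>n. f m)) = (1 + y * q ^ n) * (\<Sum>m\<le>n. f m)"
  proof -
    have "(\<Sum>m\<le>Suc n. f m) = 1 + (\<Sum>m\<le>n. f (Suc m))" by (subst sum.atMost_Suc_shift) (simp add: f0)
    thus ?thesis by (simp add: fn algebra_simps)
  qed
  finally show ?case using Suc by (simp add: f_def algebra_simps)
qed

definition triangular :: "int \<Rightarrow> int" where "triangular j = j * (j + 1) div 2"

lemma two_triangular: "2 * triangular j = j * (j + 1)"
  by (simp add: triangular_def)

text \<open>The q-binomial theorem with \<open>2 * N\<close> factors, centred: \<open>y\<close>
  makes the exponents of q run from 1 - N to N. The factors with exponent - k become 1 + q^k / z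
  once z * q^(-k) is pulled out.\<close>

lemma finite_triple_product:
  assumes q: "norm q < 1" "q \<noteq> 0" and z: "z \<noteq> 0"
  shows "(\<Prod>k<N. 1 + z * q ^ Suc k) * (\<Prod>k<N. 1 + q ^ k / z)
    = (\<Sum>j\<in>{- int N..int N}. qbinom q (2 * N) (nat (int N + j)) * q powi triangular j * z powi j)"
proof -
  define y where "y = z * q powi (1 - int N)"
  have ch: "2 * int (n choose 2) = int n * (int n - 1)" for n
    by (induction n) (auto simp: numeral_2_eq_2 algebra_simps)
  have "(\<Prod>k<2*N. 1 + y * q ^ k) = (\<Prod>k<N. 1 + y * q ^ k) * (\<Prod>k<N. 1 + y * q ^ (N + k))"
    by (simp add: mult_2 lessThan_atLeast0 prod.atLeastLessThan_concat[of 0 N "N + N", symmetric]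
        prod.shift_bounds_nat_ivl[of _ 0 N N, simplified] add.commute)
  also have "(\<Prod>k<N. 1 + y * q ^ (N + k)) = (\<Prod>k<N. 1 + z * q ^ Suc k)"
  proof (rule prod.cong, goal_cases)
    case (2 k)
    have "q powi (1 - int N) * q ^ (N + k) = q powi (1 - int N + int (N + k))"
      by (subst power_int_add) (use q in \<open>auto simp del: of_nat_add\<close>)
    also have "1 - int N + int (N + k) = int (Suc k)" by simp
    finally show ?case by (simp add: y_def mult.assoc del: of_nat_Suc power_Suc)
  qed auto
  also have "(\<Prod>k<N. 1 + y * q ^ k) = (\<Prod>k<N. 1 + y * q ^ (N - Suc k))"
    by (rule prod.nat_diff_reindex[symmetric])
  also have "\<dots> = (\<Prod>k<N. z * q powi (- int k) * (1 + q ^ k / z))"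
  proof (rule prod.cong, goal_cases)
    case (2 k)
    have "q powi (1 - int N) * q ^ (N - Suc k) = q powi (1 - int N + int (N - Suc k))"
      using q by (subst power_int_add) auto
    also have "1 - int N + int (N - Suc k) = - int k" using 2 by simp
    finally show ?case using q z by (simp add: y_def mult.assoc power_int_minus field_simps)
  qed auto
  also have "\<dots> = z ^ N * q powi (- int (N choose 2)) * (\<Prod>k<N. 1 + q ^ k / z)"
  proof -
    have "(\<Prod>k<N. z * q powi (- int k)) = z ^ N * q powi (- int (N choose 2))"
      by (induction N) (use q in \<open>auto simp: numeral_2_eq_2 power_int_diff power_int_minus field_simps power_add\<close>)
    thus ?thesis by (simp add: prod.distrib)
  qed
  finally have L: "(\<Prod>k<N. 1 + z * q ^ Suc k) * (\<Prod>k<N. 1 + q ^ k / z)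
    = (\<Prod>k<2*N. 1 + y * q ^ k) / (z ^ N * q powi (- int (N choose 2)))"
    using q z by simp
  also have "\<dots> = (\<Sum>m\<le>2*N. qbinom q (2*N) m * q ^ (m choose 2) * y ^ m / (z ^ N * q powi (- int (N choose 2))))"
    by (simp add: q_binomial_theorem[OF q(1)] sum_divide_distrib)
  also have "\<dots> = (\<Sum>j\<in>{- int N..int N}. qbinom q (2 * N) (nat (int N + j)) * q powi triangular j * z powi j)"
  proof (rule sum.reindex_bij_witness[of _ "\<lambda>j. nat (int N + j)" "\<lambda>m. int m - int N"], goal_cases)
    case (5 m)
    define j where "j = int m - int N"
    have e: "int (m choose 2) + (1 - int N) * int m + int (N choose 2) = triangular j"
    proof -
      have "2 * (int (m choose 2) + (1 - int N) * int m + int (N choose 2)) = 2 * triangular j"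
        unfolding two_triangular distrib_left mult.assoc[symmetric] ch by (simp add: j_def algebra_simps)
      thus ?thesis by simp
    qed
    have pm: "(q powi (1 - int N)) ^ m = q powi ((1 - int N) * int m)" by (simp only: power_int_mult power_int_of_nat)
    have "q ^ (m choose 2) * y ^ m / (z ^ N * q powi (- int (N choose 2)))
        = (q powi int (m choose 2) * q powi ((1 - int N) * int m) * q powi int (N choose 2)) * (z powi int m / z powi int N)"
      using q z unfolding y_def power_mult_distrib pm by (simp add: power_int_minus divide_inverse mult_ac)
    also have "\<dots> = q powi triangular j * z powi j"
      using q z unfolding e[symmetric] by (simp add: power_int_add power_int_diff j_def)
    finally show ?case using 5 by (simp add: j_def mult.assoc flip: times_divide_eq_right)
  qed auto
  finally show ?thesis .
qed

lemma qpoch_tendsto: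
  assumes q: "norm q < 1"
  obtains L where "qpoch q \<longlonglongrightarrow> L" "L \<noteq> 0"
proof -
  define f where "f k = 1 - q ^ Suc k" for k
  have "summable (\<lambda>k. norm q ^ Suc k)" using q by (simp add: summable_geometric_iff)
  hence "summable (\<lambda>k. norm (f k - 1))" by (simp add: f_def norm_power norm_mult)
  hence "convergent_prod f" by (intro abs_convergent_prod_imp_convergent_prod summable_imp_abs_convergent_prod)
  hence "(\<lambda>n. \<Prod>i\<le>n. f i) \<longlonglongrightarrow> prodinf f" "prodinf f \<noteq> 0"
    using one_minus_power_nonzero[OF q] convergent_prod_LIMSEQ[of f] prodinf_nonzero[of f]
    unfolding f_def by blast+
  moreover have "(\<lambda>n. \<Prod>i\<le>n. f i) = (\<lambda>n. qpoch q (Suc n))" by (auto simp: qpoch_def f_def lessThan_Suc_atMost)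
  ultimately show ?thesis using that by (metis LIMSEQ_imp_Suc)
qed

lemma triangular_rapid:
  assumes q: "norm q < 1" "q \<noteq> 0"
  shows "rapid (\<lambda>j. q powi triangular j)"
\<comment> \<open>Steps of length 2, because a single step adds only n + 1 to
  \<open>triangular\<close> while \<open>quasi_rapid\<close> wants an exponent of slope 2.\<close>
proof (rule quasi_rapid[OF q(2,1), where d = 2 and e = 3])
  fix n
  have "triangular (n + int 2) = (2 * n + 3) + triangular n"
    using two_triangular[of n] two_triangular[of "n + int 2"] by (simp add: algebra_simps)
  thus "q powi triangular (n + int 2) = q powi (2 * n + 3) * q powi triangular n"
    using q by (simp add: power_int_add)
qed auto

text \<open>The weights \<open>w\<close> are left general so that both z^j and (-1)^j * j can be
  inserted. Since \<open>qpoch q\<close> has a nonzero limit, it and its inverse are bounded; the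
  q-binomials are then uniformly bounded and dominated convergence applies.\<close>

lemma triple_product_limit:
  fixes w :: "int \<Rightarrow> complex"
  assumes q: "norm q < 1" "q \<noteq> 0" and w: "(\<lambda>j. norm (q powi triangular j * w j)) summable_on UNIV"
  shows "(\<lambda>N. qpoch q N * (\<Sum>j\<in>{- int N..int N}. qbinom q (2 * N) (nat (int N + j)) * q powi triangular j * w j))
     \<longlonglongrightarrow> infsum (\<lambda>j. q powi triangular j * w j) UNIV"
proof -
  obtain L where L: "qpoch q \<longlonglongrightarrow> L" "L \<noteq> 0" using qpoch_tendsto[OF q(1)] .
  have "Bseq (qpoch q)" using L convergent_imp_Bseq convergentI by blast
  then obtain C where C: "C > 0" "\<And>n. norm (qpoch q n) \<le> C" unfolding Bseq_def by blast
  have "(\<lambda>n. inverse (qpoch q n)) \<longlonglongrightarrow> inverse L" by (intro tendsto_inverse L)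
  hence "Bseq (\<lambda>n. inverse (qpoch q n))" using convergent_imp_Bseq convergentI by blast
  then obtain D where D: "D > 0" "\<And>n. norm (inverse (qpoch q n)) \<le> D" unfolding Bseq_def by blast
  define a where "a N j = (if j \<in> {- int N..int N} then
      qpoch q N * (qbinom q (2 * N) (nat (int N + j)) * q powi triangular j * w j) else 0)" for N j
  have qb: "qbinom q (2 * N) (nat (int N + j)) = qpoch q (2 * N) * inverse (qpoch q (nat (int N + j))) * inverse (qpoch q (nat (int N - j)))"
    if "j \<in> {- int N..int N}" for N j
  proof -
    have "nat (int N + j) \<le> 2 * N" "2 * N - nat (int N + j) = nat (int N - j)" using that by auto
    thus ?thesis by (simp add: qbinom_def divide_inverse)
  qed
  have "(\<lambda>N. infsum (a N) UNIV) \<longlonglongrightarrow> infsum (\<lambda>j. q powi triangular j * w j) UNIV"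
  proof (rule infsum_int_tannery)
    show "(\<lambda>N. a N j) \<longlonglongrightarrow> q powi triangular j * w j" for j
    proof -
      have lim: "filterlim (\<lambda>N. nat (int N + i)) at_top sequentially" for i
        unfolding filterlim_at_top
      proof safe
        fix Z show "eventually (\<lambda>N. Z \<le> nat (int N + i)) sequentially"
          using eventually_ge_at_top[of "Z + nat \<bar>i\<bar>"] by eventually_elim auto
      qed
      have l2: "filterlim (\<lambda>N::nat. 2 * N) at_top sequentially"
        by (intro mult_nat_left_at_top) auto
      have "(\<lambda>N. qpoch q N * (qpoch q (2 * N) * inverse (qpoch q (nat (int N + j))) * inverse (qpoch q (nat (int N + (- j)))) * q powi triangular j * w j))
          \<longlonglongrightarrow> L * (L * inverse L * inverse L * q powi triangular j * w j)"
        by (intro tendsto_mult tendsto_inverse tendsto_const L filterlim_compose[OF L(1) lim] filterlim_compose[OF L(1) l2])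
      also have "L * (L * inverse L * inverse L * q powi triangular j * w j) = q powi triangular j * w j" using L by simp
      finally show ?thesis
      proof (rule Lim_transform_eventually)
        show "eventually (\<lambda>N. qpoch q N * (qpoch q (2 * N) * inverse (qpoch q (nat (int N + j))) * inverse (qpoch q (nat (int N + (- j)))) * q powi triangular j * w j)
           = a N j) sequentially"
          using eventually_ge_at_top[of "nat \<bar>j\<bar>"]
          by eventually_elim (auto simp: a_def qb)
      qed
    qed
    show "norm (a N j) \<le> C * (C * D * D) * norm (q powi triangular j * w j)" for N j
    proof (cases "j \<in> {- int N..int N}")
      case True
      have "norm (a N j) = norm (qpoch q N) * (norm (qpoch q (2 * N)) * norm (inverse (qpoch q (nat (int N + j)))) * norm (inverse (qpoch q (nat (int N - j)))))
            * norm (q powi triangular j * w j)"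
        using True by (simp add: a_def qb[OF True] norm_mult)
      also have "\<dots> \<le> C * (C * D * D) * norm (q powi triangular j * w j)"
        using C D by (intro mult_right_mono mult_mono) (auto intro: order_less_imp_le)
      finally show ?thesis .
    qed (use C D in \<open>auto simp: a_def\<close>)
    show "(\<lambda>j. C * (C * D * D) * norm (q powi triangular j * w j)) summable_on UNIV"
      by (intro summable_on_cmult_right w)
  qed
  moreover have "infsum (a N) UNIV = qpoch q N * (\<Sum>j\<in>{- int N..int N}. qbinom q (2 * N) (nat (int N + j)) * q powi triangular j * w j)" for N
  proof -
    have "infsum (a N) UNIV = infsum (a N) {- int N..int N}"
      by (rule infsum_cong_neutral) (auto simp: a_def)
    also have "\<dots> = (\<Sum>j\<in>{- int N..int N}. a N j)" by simp
    finally show ?thesis by (simp add: a_def sum_distrib_left)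
  qed
  ultimately show ?thesis by simp
qed

definition theta :: "complex \<Rightarrow> complex \<Rightarrow> complex" where
  "theta q z = infsum (\<lambda>j. q powi triangular j * z powi j) UNIV"

theorem jacobi_triple_product:
  assumes q: "norm q < 1" "q \<noteq> 0" and z: "z \<noteq> 0"
  shows "(\<lambda>N. \<Prod>k<N. (1 - q ^ Suc k) * (1 + z * q ^ Suc k) * (1 + q ^ k / z)) \<longlonglongrightarrow> theta q z"
proof -
  have "(\<lambda>j. norm (q powi triangular j * z powi j)) summable_on UNIV"
    by (rule rapid_powi[OF triangular_rapid[OF q] z])
  from triple_product_limit[OF q this] show ?thesis
    by (simp add: theta_def prod.distrib qpoch_def mult.assoc del: power_Suc flip: finite_triple_product[OF q z, unfolded mult.assoc])
qed

text \<open>The finite triple product is differentiated at z = -1, where its factor 1 + 1 / z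
  vanishes, and only then the limit is taken. So no derivative has to be exchanged with a
  limit.\<close>

theorem jacobi_identity_cube:
  fixes q :: complex
  assumes q: "norm q < 1" "q \<noteq> 0"
  shows "(\<lambda>N. (\<Prod>k<N. 1 - q ^ Suc k) ^ 3) \<longlonglongrightarrow> infsum (\<lambda>j. q powi triangular j * ((-1) powi j * of_int j)) UNIV"
proof -
  define w where "w j = (-1::complex) powi j * of_int j" for j :: int
  have w: "(\<lambda>j. norm (q powi triangular j * w j)) summable_on UNIV"
    using rapid_shift_moment[OF triangular_rapid[OF q], of "-1" 0 1] by (simp add: w_def mult.assoc)
  have fin: "(\<Sum>j\<in>{- int N..int N}. qbinom q (2 * N) (nat (int N + j)) * q powi triangular j * w j)
      = qpoch q N * qpoch q (N - 1)" if N: "N > 0" for N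
  proof -
    define F where "F z = (\<Sum>j\<in>{- int N..int N}. qbinom q (2 * N) (nat (int N + j)) * q powi triangular j * z powi j)" for z
    define R where "R z = (\<Prod>k<N. 1 + z * q ^ Suc k) * (\<Prod>k<N-1. 1 + q ^ Suc k / z)" for z
    have FR: "F z = (1 + 1 / z) * R z" if "z \<noteq> 0" for z
    proof -
      have "(\<Prod>k<N. 1 + q ^ k / z) = (1 + 1 / z) * (\<Prod>k<N-1. 1 + q ^ Suc k / z)"
        using N by (cases N) (simp_all add: prod.lessThan_Suc_shift del: prod.lessThan_Suc)
      thus ?thesis unfolding F_def finite_triple_product[OF q that, symmetric] R_def by (simp add: mult_ac)
    qed
    have "(F has_field_derivative (\<Sum>j\<in>{- int N..int N}. qbinom q (2 * N) (nat (int N + j)) * q powi triangular j * (of_int j * (-1) powi (j - 1)))) (at (-1))"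
      unfolding F_def by (auto intro!: derivative_eq_intros sum.cong)
    also have "(\<Sum>j\<in>{- int N..int N}. qbinom q (2 * N) (nat (int N + j)) * q powi triangular j * (of_int j * (-1) powi (j - 1)))
       = - (\<Sum>j\<in>{- int N..int N}. qbinom q (2 * N) (nat (int N + j)) * q powi triangular j * w j)"
      by (simp add: w_def power_int_diff sum_negf[symmetric] mult_ac)
    finally have 1: "(F has_field_derivative - (\<Sum>j\<in>{- int N..int N}. qbinom q (2 * N) (nat (int N + j)) * q powi triangular j * w j)) (at (-1))" .
    \<comment> \<open>Since F z = (z + 1) * R z / z, this quotient is the difference quotient of
      \<open>F\<close> at -1.\<close>
    have "isCont (\<lambda>z. R z / z) (-1)"
      unfolding R_def by (intro continuous_intros) auto
    hence "((\<lambda>z. R z / z) \<longlongrightarrow> - R (-1)) (at (-1))" by (simp add: isCont_def)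
    moreover have "eventually (\<lambda>z. R z / z = (F z - F (-1)) / (z - (-1))) (at (-1))"
    proof -
      have "eventually (\<lambda>z::complex. z \<in> - {0}) (at (-1))"
        by (intro eventually_at_in_open') auto
      moreover have "eventually (\<lambda>z::complex. z \<noteq> -1) (at (-1))" by (simp add: eventually_at_filter)
      ultimately show ?thesis
      proof eventually_elim
        case (elim z)
        have "F (-1) = 0" using FR[of "-1"] by simp
        moreover have "z + 1 \<noteq> 0" using elim by (metis add.inverse_inverse add_eq_0_iff2)
        ultimately show ?case using FR[of z] elim by (simp add: field_simps)
      qed
    qed
    ultimately have "((\<lambda>z. (F z - F (-1)) / (z - (-1))) \<longlongrightarrow> - R (-1)) (at (-1))"
      by (rule Lim_transform_eventually)
    hence 2: "(F has_field_derivative - R (-1)) (at (-1))" by (simp add: has_field_derivative_iff)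
    have "R (-1) = qpoch q N * qpoch q (N - 1)" by (simp add: R_def qpoch_def)
    with DERIV_unique[OF 1 2] show ?thesis by simp
  qed
  obtain L where L: "qpoch q \<longlonglongrightarrow> L" "L \<noteq> 0" using qpoch_tendsto[OF q(1)] .
  have "(\<lambda>N. qpoch q (Suc N) * (qpoch q (Suc N) * qpoch q N)) \<longlonglongrightarrow> L * (L * L)"
    by (intro tendsto_mult L LIMSEQ_Suc)
  moreover have "(\<lambda>N. qpoch q (Suc N) * (qpoch q (Suc N) * qpoch q N)) \<longlonglongrightarrow> infsum (\<lambda>j. q powi triangular j * w j) UNIV"
    using LIMSEQ_Suc[OF triple_product_limit[OF q w]] by (simp only: fin[OF zero_less_Suc] diff_Suc_1)
  ultimately have "infsum (\<lambda>j. q powi triangular j * w j) UNIV = L ^ 3"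
    using LIMSEQ_unique by (force simp: power3_eq_cube)
  moreover have "(\<lambda>N. qpoch q N ^ 3) \<longlonglongrightarrow> L ^ 3" by (intro tendsto_power L)
  ultimately show ?thesis by (simp add: qpoch_def w_def)
qed

subsection \<open>Convolution and Taylor coefficients of Laurent series\<close>

lemma abs_summable_product2:
  fixes a :: "'a \<Rightarrow> complex" and b :: "'b \<Rightarrow> complex"
  assumes a: "a abs_summable_on A" and b: "b abs_summable_on B"
  shows "(\<lambda>(v, w). a v * b w) abs_summable_on A \<times> B"
  unfolding Infinite_Sum.abs_summable_on_Sigma_iff
proof (intro conjI ballI)
  show "(\<lambda>w. case (v, w) of (v, w) \<Rightarrow> a v * b w) abs_summable_on B" for v
    by (simp add: norm_mult summable_on_cmult_right b)
  show "(\<lambda>v. infsum (\<lambda>w. norm (case (v, w) of (v, w) \<Rightarrow> a v * b w)) B) abs_summable_on A"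
    by (simp add: norm_mult infsum_cmult_right' abs_mult summable_on_cmult_left a)
qed

lemma infsum_product2:
  fixes a :: "'a \<Rightarrow> complex" and b :: "'b \<Rightarrow> complex"
  assumes a: "a abs_summable_on A" and b: "b abs_summable_on B"
  shows "infsum (\<lambda>(v, w). a v * b w) (A \<times> B) = infsum a A * infsum b B"
proof -
  have "infsum (\<lambda>(v, w). a v * b w) (A \<times> B) = infsum (\<lambda>v. infsum (\<lambda>w. a v * b w) B) A"
    by (rule infsum_Sigma'_banach[symmetric]) (rule abs_summable_summable[OF abs_summable_product2[OF a b]])
  thus ?thesis by (simp add: infsum_cmult_right' infsum_cmult_left')
qed

lemma infsum_finite_sum:
  fixes f :: "'i \<Rightarrow> 'a \<Rightarrow> 'b :: {topological_comm_monoid_add, t2_space}"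
  assumes "finite I" and "\<And>i. i \<in> I \<Longrightarrow> f i summable_on A"
  shows "(\<lambda>p. \<Sum>i\<in>I. f i p) summable_on A"
    and "infsum (\<lambda>p. \<Sum>i\<in>I. f i p) A = (\<Sum>i\<in>I. infsum (f i) A)"
proof -
  have "(\<lambda>p. \<Sum>i\<in>I. f i p) summable_on A \<and> infsum (\<lambda>p. \<Sum>i\<in>I. f i p) A = (\<Sum>i\<in>I. infsum (f i) A)"
    using assms by (induction I rule: finite_induct) (simp_all add: summable_on_add infsum_add)
  thus "(\<lambda>p. \<Sum>i\<in>I. f i p) summable_on A"
    and "infsum (\<lambda>p. \<Sum>i\<in>I. f i p) A = (\<Sum>i\<in>I. infsum (f i) A)" by auto
qed

definition conv :: "(int \<Rightarrow> complex) \<Rightarrow> (int \<Rightarrow> complex) \<Rightarrow> int \<Rightarrow> complex" where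
  "conv c d u = infsum (\<lambda>v. c v * d (u - v)) UNIV"

text \<open>Applying a functional to a product of Laurent series. A separable expansion of
  \<open>\<phi> (v + w)\<close> covers two cases at once: evaluation at a point, with one term, and
  moments, with the binomial expansion.\<close>

lemma conv_eval:
  assumes I: "finite I"
    and c: "\<And>i. i \<in> I \<Longrightarrow> (\<lambda>v. c v * f i v) abs_summable_on UNIV"
    and d: "\<And>i. i \<in> I \<Longrightarrow> (\<lambda>w. d w * g i w) abs_summable_on UNIV"
    and \<phi>: "\<And>v w. \<phi> (v + w) = (\<Sum>i\<in>I. f i v * g i w)"
  shows "infsum (\<lambda>u. conv c d u * \<phi> u) UNIV = (\<Sum>i\<in>I. infsum (\<lambda>v. c v * f i v) UNIV * infsum (\<lambda>w. d w * g i w) UNIV)"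
    and "(\<lambda>u. conv c d u * \<phi> u) abs_summable_on UNIV"
proof -
  define h where "h = (\<lambda>(v, w). c v * d w * \<phi> (v + w))"
  have h: "h = (\<lambda>p. \<Sum>i\<in>I. case p of (v, w) \<Rightarrow> (c v * f i v) * (d w * g i w))"
    by (auto simp: h_def fun_eq_iff \<phi> sum_distrib_left mult_ac)
  have sm: "(\<lambda>(v, w). (c v * f i v) * (d w * g i w)) abs_summable_on UNIV" if "i \<in> I" for i
    using abs_summable_product2[OF c[OF that] d[OF that]] by simp
  have hs: "h abs_summable_on UNIV"
  proof (rule summable_on_comparison_test)
    show "(\<lambda>p. \<Sum>i\<in>I. norm (case p of (v, w) \<Rightarrow> (c v * f i v) * (d w * g i w))) summable_on UNIV"
      by (rule infsum_finite_sum(1)[OF I sm])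
    show "norm (h p) \<le> (\<Sum>i\<in>I. norm (case p of (v, w) \<Rightarrow> (c v * f i v) * (d w * g i w)))" for p
      unfolding h by (rule norm_sum)
  qed simp
  have "infsum h UNIV = (\<Sum>i\<in>I. infsum (\<lambda>(v, w). (c v * f i v) * (d w * g i w)) UNIV)"
    unfolding h by (rule infsum_finite_sum(2)[OF I]) (rule abs_summable_summable[OF sm])
  also have "\<dots> = (\<Sum>i\<in>I. infsum (\<lambda>v. c v * f i v) UNIV * infsum (\<lambda>w. d w * g i w) UNIV)"
    by (intro sum.cong refl) (use infsum_product2[OF c d] in simp)
  finally have hval: "infsum h UNIV = (\<Sum>i\<in>I. infsum (\<lambda>v. c v * f i v) UNIV * infsum (\<lambda>w. d w * g i w) UNIV)" .
  define \<sigma> where "\<sigma> = (\<lambda>(u::int, v::int). (v, u - v))"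
  have bij: "bij_betw \<sigma> UNIV UNIV"
    by (rule bij_betwI[of _ _ _ "\<lambda>(v, w). (v + w, v)"]) (auto simp: \<sigma>_def)
  have "(\<lambda>p. norm (h (\<sigma> p))) summable_on UNIV"
    using summable_on_reindex_bij_betw[OF bij, of "\<lambda>p. norm (h p)"] hs by simp
  hence ss: "(\<lambda>p. h (\<sigma> p)) abs_summable_on UNIV \<times> UNIV" by simp
  have rows: "infsum (\<lambda>v. h (\<sigma> (u, v))) UNIV = conv c d u * \<phi> u" for u
    unfolding conv_def infsum_cmult_left'[symmetric] by (simp add: h_def \<sigma>_def)
  show "(\<lambda>u. conv c d u * \<phi> u) abs_summable_on UNIV"
  proof (rule summable_on_comparison_test)
    have "(\<lambda>u. infsum (\<lambda>v. norm (h (\<sigma> (u, v)))) UNIV) abs_summable_on UNIV"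
      using ss unfolding Infinite_Sum.abs_summable_on_Sigma_iff by blast
    thus "(\<lambda>u. infsum (\<lambda>v. norm (h (\<sigma> (u, v)))) UNIV) summable_on UNIV"
      by (rule abs_summable_summable)
    show "norm (conv c d u * \<phi> u) \<le> infsum (\<lambda>v. norm (h (\<sigma> (u, v)))) UNIV" for u
      unfolding rows[symmetric] using ss unfolding Infinite_Sum.abs_summable_on_Sigma_iff by (intro norm_infsum_bound) auto
  qed auto
  have "infsum (\<lambda>u. conv c d u * \<phi> u) UNIV = infsum (\<lambda>u. infsum (\<lambda>v. h (\<sigma> (u, v))) UNIV) UNIV"
    by (simp add: rows)
  also have "\<dots> = infsum (\<lambda>p. h (\<sigma> p)) (UNIV \<times> UNIV)"
    by (rule infsum_Sigma_banach) (rule abs_summable_summable[OF ss])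
  also have "\<dots> = infsum h UNIV"
    using infsum_reindex_bij_betw[OF bij, of h] by simp
  finally show "infsum (\<lambda>u. conv c d u * \<phi> u) UNIV
     = (\<Sum>i\<in>I. infsum (\<lambda>v. c v * f i v) UNIV * infsum (\<lambda>w. d w * g i w) UNIV)"
    using hval by simp
qed

definition laurent :: "(int \<Rightarrow> complex) \<Rightarrow> complex \<Rightarrow> complex" where
  "laurent c z = infsum (\<lambda>n. c n * z powi n) UNIV"

text \<open>The Taylor coefficients at \<open>u = 0\<close> of the function \<open>exp (e * u / 2) * laurent c (exp u)\<close>.\<close>

definition jet :: "int \<Rightarrow> (int \<Rightarrow> complex) \<Rightarrow> complex fps" where
  "jet e c = Abs_fps (\<lambda>k. infsum (\<lambda>n. c n * (of_int n + of_int e / 2) ^ k) UNIV / fact k)"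

lemma laurent_conv:
  assumes "rapid c" "rapid d" "z \<noteq> 0"
  shows "laurent (conv c d) z = laurent c z * laurent d z"
  using conv_eval(1)[of "{()}" c "\<lambda>_ v. z powi v" d "\<lambda>_ v. z powi v" "\<lambda>u. z powi u"] assms
  by (simp add: laurent_def rapid_powi power_int_add)

lemma rapid_conv:
  assumes "rapid c" "rapid d"
  shows "rapid (conv c d)"
  unfolding rapid_def
proof safe
  fix r :: real assume r: "r > 0"
  have "(\<lambda>u. conv c d u * (of_real r) powi u) abs_summable_on UNIV"
    using conv_eval(2)[of "{()}" c "\<lambda>_ v. of_real r powi v" d "\<lambda>_ v. of_real r powi v" "\<lambda>u. of_real r powi u"]
      assms r by (simp add: rapid_powi power_int_add)
  thus "(\<lambda>n. norm (conv c d n) * r powi n) summable_on UNIV"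
    using r by (simp add: norm_mult norm_power_int)
qed

lemma rapid_moment:
  assumes "rapid c"
  shows "(\<lambda>n. c n * (of_int n + w) ^ k) abs_summable_on UNIV"
  using rapid_shift_moment[OF assms, of 1 w k] by simp

text \<open>The shifts e1 / 2 and e2 / 2 add up, so Taylor coefficients of the centred functions
  multiply as power series.\<close>

lemma jet_conv:
  assumes c: "rapid c" and d: "rapid d"
  shows "jet (e1 + e2) (conv c d) = jet e1 c * jet e2 d"
proof (rule fps_ext)
  fix k
  define f g where "f = (\<lambda>i v. (of_int v + of_int e1 / 2 :: complex) ^ i)" and "g = (\<lambda>i v. (of_int v + of_int e2 / 2 :: complex) ^ i)"
  have "infsum (\<lambda>u. conv c d u * (of_int u + of_int (e1 + e2) / 2) ^ k) UNIV
    = (\<Sum>i\<le>k. infsum (\<lambda>v. c v * (of_nat (k choose i) * f i v)) UNIV * infsum (\<lambda>w. d w * g (k - i) w) UNIV)"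
  proof (rule conv_eval)
    show "(\<lambda>v. c v * (of_nat (k choose i) * f i v)) abs_summable_on UNIV" for i
      using summable_on_cmult_right[OF rapid_moment[OF c, of "of_int e1 / 2" i], of "of_nat (k choose i)"]
      by (simp add: f_def norm_mult norm_power mult_ac)
    show "(\<lambda>w. d w * g (k - i) w) abs_summable_on UNIV" for i
      unfolding g_def by (rule rapid_moment[OF d])
    show "(of_int (v + w) + of_int (e1 + e2) / 2) ^ k = (\<Sum>i\<le>k. of_nat (k choose i) * f i v * g (k - i) w)" for v w
      using binomial_ring[of "of_int v + of_int e1 / 2 :: complex" "of_int w + of_int e2 / 2" k]
      by (simp add: f_def g_def add_divide_distrib algebra_simps)
  qed auto
  also have "\<dots> = (\<Sum>i\<le>k. of_nat (k choose i) * infsum (\<lambda>v. c v * f i v) UNIV * infsum (\<lambda>w. d w * g (k - i) w) UNIV)"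
  proof (intro sum.cong refl)
    fix i
    have "infsum (\<lambda>v. c v * (of_nat (k choose i) * f i v)) UNIV = of_nat (k choose i) * infsum (\<lambda>v. c v * f i v) UNIV"
      unfolding infsum_cmult_right'[symmetric] by (intro infsum_cong) simp
    thus "infsum (\<lambda>v. c v * (of_nat (k choose i) * f i v)) UNIV * infsum (\<lambda>w. d w * g (k - i) w) UNIV
      = of_nat (k choose i) * infsum (\<lambda>v. c v * f i v) UNIV * infsum (\<lambda>w. d w * g (k - i) w) UNIV" by simp
  qed
  also have "\<dots> / fact k = (\<Sum>i\<le>k. (infsum (\<lambda>v. c v * f i v) UNIV / fact i) * (infsum (\<lambda>w. d w * g (k - i) w) UNIV / fact (k - i)))"
    unfolding sum_divide_distrib
    by (intro sum.cong refl) (simp add: binomial_fact field_simps)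
  finally show "fps_nth (jet (e1 + e2) (conv c d)) k = fps_nth (jet e1 c * jet e2 d) k"
    by (simp add: jet_def fps_mult_nth f_def g_def atMost_atLeast0)
qed

subsection \<open>Theta functions\<close>

text \<open>In terms of \<open>f = laurent c\<close>: \<open>f (x\<^sup>2 * z) = x powi (- D - e) * z powi (- D) * f z\<close> and
  \<open>f (1 / z) = z powi e * f z\<close>.\<close>

definition theta_family :: "complex \<Rightarrow> int \<Rightarrow> int \<Rightarrow> (int \<Rightarrow> complex) \<Rightarrow> bool" where
  "theta_family x D e c \<longleftrightarrow> (\<forall>n. c (n + D) = x powi (2 * n + D + e) * c n) \<and> (\<forall>n. c (- n - e) = c n)"

lemma theta_family_rapid:
  assumes "theta_family x D e c" "D > 0" "x \<noteq> 0" "norm x < 1"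
  shows "rapid c"
  by (rule quasi_rapid[of x "nat D" c "D + e"]) (use assms in \<open>auto simp: theta_family_def add.assoc\<close>)

text \<open>Degrees and symmetry parameters add: the summation index absorbs the shift by
  \<open>D\<close> and leaves \<open>D'\<close> to the second factor; the reflection is split in the
  same way.\<close>

lemma theta_family_conv:
  assumes x: "x \<noteq> 0" and c: "theta_family x D e c" and d: "theta_family x D' e' d"
  shows "theta_family x (D + D') (e + e') (conv c d)"
  unfolding theta_family_def
proof safe
  fix u
  have "conv c d (u + (D + D')) = infsum (\<lambda>v. c (v + D) * d (u + (D + D') - (v + D))) UNIV"
    unfolding conv_def
    by (rule infsum_reindex_bij_betw[symmetric]) (rule bij_betwI[of _ _ _ "\<lambda>v. v - D"], auto)
  also have "\<dots> = infsum (\<lambda>v. x powi (2 * u + (D + D') + (e + e')) * (c v * d (u - v))) UNIV"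
  proof (rule infsum_cong)
    fix v
    have "u + (D + D') - (v + D) = (u - v) + D'" by simp
    moreover have "d ((u - v) + D') = x powi (2 * (u - v) + D' + e') * d (u - v)"
      using d unfolding theta_family_def by blast
    moreover have "c (v + D) = x powi (2 * v + D + e) * c v"
      using c unfolding theta_family_def by blast
    ultimately have "c (v + D) * d (u + (D + D') - (v + D))
        = x powi (2 * v + D + e) * x powi (2 * (u - v) + D' + e') * (c v * d (u - v))"
      by (simp only: mult_ac)
    also have "x powi (2 * v + D + e) * x powi (2 * (u - v) + D' + e') = x powi (2 * u + (D + D') + (e + e'))"
      using x by (simp add: power_int_add[symmetric] algebra_simps)
    finally show "c (v + D) * d (u + (D + D') - (v + D)) = x powi (2 * u + (D + D') + (e + e')) * (c v * d (u - v))" .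
  qed
  finally show "conv c d (u + (D + D')) = x powi (2 * u + (D + D') + (e + e')) * conv c d u"
    by (simp add: infsum_cmult_right' conv_def)
next
  fix u
  have "conv c d (- u - (e + e')) = infsum (\<lambda>v. c (- v - e) * d (- u - (e + e') - (- v - e))) UNIV"
    unfolding conv_def
    by (rule infsum_reindex_bij_betw[symmetric]) (rule bij_betwI[of _ _ _ "\<lambda>v. - v - e"], auto)
  also have "\<dots> = infsum (\<lambda>v. c v * d (u - v)) UNIV"
  proof (rule infsum_cong)
    fix v
    have "- u - (e + e') - (- v - e) = - (u - v) - e'" by simp
    thus "c (- v - e) * d (- u - (e + e') - (- v - e)) = c v * d (u - v)"
      using c d unfolding theta_family_def by metis
  qed
  finally show "conv c d (- u - (e + e')) = conv c d u" by (simp add: conv_def)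
qed

text \<open>The recurrence iterated k times, upwards and downwards. The quadratic exponent is the
  later \<open>energy\<close>.\<close>

lemma theta_family_shift:
  assumes x: "x \<noteq> 0" and c: "theta_family x (2 * int t) 1 c"
  shows "c (i + 2 * int t * k) = x powi (2 * int t * k\<^sup>2 + (2 * i + 1) * k) * c i"
proof -
  have step: "c (i + 2 * int t * (k + 1)) = x powi (2 * (i + 2 * int t * k) + 2 * int t + 1) * c (i + 2 * int t * k)" for k
    using c[unfolded theta_family_def, THEN conjunct1, rule_format, of "i + 2 * int t * k"] by (simp add: algebra_simps)
  have e: "2 * int t * (k + 1)\<^sup>2 + (2 * i + 1) * (k + 1) = (2 * (i + 2 * int t * k) + 2 * int t + 1) + (2 * int t * k\<^sup>2 + (2 * i + 1) * k)" for k
    by (simp add: power2_eq_square algebra_simps)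
  show ?thesis
  proof (induction k rule: int_induct[where k = 0])
    case base
    show ?case by simp
  next
    case (step1 k)
    thus ?case unfolding step e power_int_add[OF disjI1[OF x]] by simp
  next
    case (step2 k)
    define A B where "A = 2 * (i + 2 * int t * (k - 1)) + 2 * int t + 1" and "B = 2 * int t * (k - 1)\<^sup>2 + (2 * i + 1) * (k - 1)"
    have "x powi A * c (i + 2 * int t * (k - 1)) = x powi (A + B) * c i"
      using step2(2) step[of "k - 1"] e[of "k - 1"] unfolding A_def B_def by (simp only: diff_add_cancel)
    hence "c (i + 2 * int t * (k - 1)) = x powi B * c i"
      using x by (simp add: power_int_add)
    thus ?case by (simp only: B_def)
  qed
qed

text \<open>A family of degree 2 * t with e = 1 has only t free coefficients: the recurrence leaves
  one per residue class, and the reflection identifies the classes of i and - i - 1.\<close>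

lemma theta_family_decompose:
  assumes x: "x \<noteq> 0" and t: "t > 0" and c: "theta_family x (2 * int t) 1 c"
    and s: "(\<lambda>n. c n * \<phi> n) abs_summable_on UNIV"
  shows "infsum (\<lambda>n. c n * \<phi> n) UNIV
    = (\<Sum>i<t. c (int i) * infsum (\<lambda>k. x powi (2 * int t * k\<^sup>2 + (2 * int i + 1) * k)
         * (\<phi> (int i + 2 * int t * k) + \<phi> (- (int i + 2 * int t * k) - 1))) UNIV)"
proof -
  \<comment> \<open>The classes of 0, ..., t - 1; the map n -> - n - 1 sends their union onto its
    complement.\<close>
  define P where "P = {n::int. n mod (2 * int t) < int t}"
  have s': "(\<lambda>n. c n * \<phi> n) summable_on A" for A
    by (rule summable_on_subset_banach[OF abs_summable_summable[OF s]]) auto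
  have modneg: "(- n - 1) mod (2 * int t) = 2 * int t - 1 - n mod (2 * int t)" for n
  proof -
    define r where "r = n mod (2 * int t)"
    have r: "0 \<le> r" "r < 2 * int t" using t by (auto simp: r_def)
    have "- n - 1 = (2 * int t - 1 - r) + (2 * int t) * (- (n div (2 * int t)) - 1)"
      using div_mult_mod_eq[of n "2 * int t"] by (simp add: r_def algebra_simps)
    hence "(- n - 1) mod (2 * int t) = (2 * int t - 1 - r) mod (2 * int t)" by (simp only: mod_mult_self2)
    thus ?thesis using r by (simp add: r_def[symmetric])
  qed
  have bijN: "bij_betw (\<lambda>n. - n - 1) P (- P)"
    by (rule bij_betwI[of _ _ _ "\<lambda>n. - n - 1"]) (auto simp: P_def modneg)
  have sN: "(\<lambda>n. c n * \<phi> (- n - 1)) summable_on P"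
    using summable_on_reindex_bij_betw[OF bijN, of "\<lambda>n. c n * \<phi> n"] s'[of "- P"] c
    by (simp add: theta_family_def)
  have "infsum (\<lambda>n. c n * \<phi> n) UNIV = infsum (\<lambda>n. c n * \<phi> n) P + infsum (\<lambda>n. c n * \<phi> n) (- P)"
    using infsum_Un_disjoint[OF s' s', of P "- P"] by (simp add: Compl_partition)
  also have "infsum (\<lambda>n. c n * \<phi> n) (- P) = infsum (\<lambda>n. c n * \<phi> (- n - 1)) P"
    using infsum_reindex_bij_betw[OF bijN, of "\<lambda>n. c n * \<phi> n"] c by (simp add: theta_family_def)
  also have "infsum (\<lambda>n. c n * \<phi> n) P + infsum (\<lambda>n. c n * \<phi> (- n - 1)) P = infsum (\<lambda>n. c n * (\<phi> n + \<phi> (- n - 1))) P"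
    using infsum_add[OF s' sN] by (simp add: distrib_left)
  also have "\<dots> = infsum (\<lambda>(i, k). c (int i + 2 * int t * k) * (\<phi> (int i + 2 * int t * k) + \<phi> (- (int i + 2 * int t * k) - 1))) ({..<t} \<times> UNIV)"
  proof -
    have bij: "bij_betw (\<lambda>(i, k). int i + 2 * int t * k) ({..<t} \<times> UNIV) P"
      by (rule bij_betwI[of _ _ _ "\<lambda>n. (nat (n mod (2 * int t)), n div (2 * int t))"])
         (use t in \<open>auto simp: P_def nat_less_iff\<close>)
    show ?thesis
      using infsum_reindex_bij_betw[OF bij, of "\<lambda>n. c n * (\<phi> n + \<phi> (- n - 1))"] by (simp add: case_prod_unfold)
  qed
  also have "\<dots> = infsum (\<lambda>i. infsum (\<lambda>k. c (int i + 2 * int t * k) * (\<phi> (int i + 2 * int t * k) + \<phi> (- (int i + 2 * int t * k) - 1))) UNIV) {..<t}"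
  proof (rule infsum_Sigma'_banach[symmetric])
    have bij: "bij_betw (\<lambda>(i, k). int i + 2 * int t * k) ({..<t} \<times> UNIV) P"
      by (rule bij_betwI[of _ _ _ "\<lambda>n. (nat (n mod (2 * int t)), n div (2 * int t))"])
         (use t in \<open>auto simp: P_def nat_less_iff\<close>)
    have "(\<lambda>n. c n * (\<phi> n + \<phi> (- n - 1))) summable_on P"
      using summable_on_add[OF s' sN] by (simp add: distrib_left)
    thus "(\<lambda>(i, k). c (int i + 2 * int t * k) * (\<phi> (int i + 2 * int t * k) + \<phi> (- (int i + 2 * int t * k) - 1))) summable_on ({..<t} \<times> UNIV)"
      using summable_on_reindex_bij_betw[OF bij, of "\<lambda>n. c n * (\<phi> n + \<phi> (- n - 1))"] by (simp add: case_prod_unfold)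
  qed
  also have "\<dots> = (\<Sum>i<t. c (int i) * infsum (\<lambda>k. x powi (2 * int t * k\<^sup>2 + (2 * int i + 1) * k)
         * (\<phi> (int i + 2 * int t * k) + \<phi> (- (int i + 2 * int t * k) - 1))) UNIV)"
    unfolding infsum_finite[OF finite_lessThan] infsum_cmult_right'[symmetric] theta_family_shift[OF x c]
    by (intro sum.cong infsum_cong refl) (simp only: mult_ac)
  finally show ?thesis .
qed

definition full_coeff :: "complex \<Rightarrow> int \<Rightarrow> complex" where
  "full_coeff x n = x powi triangular n"

text \<open>This and the next definition are the odd and the even half of the series of x^(n^2 / 2)
  * z^n, the odd half divided by x^(1/2) so that the exponents are integers.\<close>

definition odd_coeff :: "complex \<Rightarrow> int \<Rightarrow> complex" where
  "odd_coeff x n = (if odd n then x powi ((n\<^sup>2 - 1) div 2) else 0)"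

definition even_coeff :: "complex \<Rightarrow> int \<Rightarrow> complex" where
  "even_coeff x n = (if even n then x powi (n\<^sup>2 div 2) else 0)"

definition cross_coeff :: "complex \<Rightarrow> int \<Rightarrow> complex" where
  "cross_coeff x n = (-1) powi n * (x\<^sup>2) powi triangular n"

lemma theta_family_full_coeff:
  assumes "x \<noteq> 0"
  shows "theta_family x 2 1 (full_coeff x)"
  unfolding theta_family_def
proof safe
  fix n
  have "triangular (n + 2) = (2 * n + 2 + 1) + triangular n"
    using two_triangular[of n] two_triangular[of "n + 2"] by (simp add: algebra_simps)
  thus "full_coeff x (n + 2) = x powi (2 * n + 2 + 1) * full_coeff x n"
    using assms by (simp add: full_coeff_def power_int_add)
  have "triangular (- n - 1) = triangular n"
    using two_triangular[of n] two_triangular[of "- n - 1"] by (simp add: algebra_simps)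
  thus "full_coeff x (- n - 1) = full_coeff x n" by (simp add: full_coeff_def)
qed

lemma theta_family_odd_coeff:
  assumes "x \<noteq> 0"
  shows "theta_family x 2 0 (odd_coeff x)"
  unfolding theta_family_def
proof safe
  fix n :: int
  have aux: "(N + 4 * n + 4 - 1) div 2 = (2 * n + 2) + (N - 1) div 2" for N n :: int by presburger
  have sq: "(n + 2)\<^sup>2 = n\<^sup>2 + 4 * n + 4" by (simp add: power2_eq_square algebra_simps)
  have "((n + 2)\<^sup>2 - 1) div 2 = (2 * n + 2) + (n\<^sup>2 - 1) div 2" unfolding sq by (rule aux)
  thus "odd_coeff x (n + 2) = x powi (2 * n + 2 + 0) * odd_coeff x n"
    using assms by (simp add: odd_coeff_def power_int_add)
  show "odd_coeff x (- n - 0) = odd_coeff x n" by (simp add: odd_coeff_def)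
qed

lemma theta_family_even_coeff:
  assumes "x \<noteq> 0"
  shows "theta_family x 2 0 (even_coeff x)"
  unfolding theta_family_def
proof safe
  fix n :: int
  have aux: "(N + 4 * n + 4) div 2 = (2 * n + 2) + N div 2" for N n :: int by presburger
  have sq: "(n + 2)\<^sup>2 = n\<^sup>2 + 4 * n + 4" by (simp add: power2_eq_square algebra_simps)
  have "(n + 2)\<^sup>2 div 2 = (2 * n + 2) + n\<^sup>2 div 2" unfolding sq by (rule aux)
  thus "even_coeff x (n + 2) = x powi (2 * n + 2 + 0) * even_coeff x n"
    using assms by (simp add: even_coeff_def power_int_add)
  show "even_coeff x (- n - 0) = even_coeff x n" by (simp add: even_coeff_def)
qed

lemma rapid_full_coeff: "x \<noteq> 0 \<Longrightarrow> norm x < 1 \<Longrightarrow> rapid (full_coeff x)"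
  by (rule theta_family_rapid[OF theta_family_full_coeff]) auto

lemma rapid_odd_coeff: "x \<noteq> 0 \<Longrightarrow> norm x < 1 \<Longrightarrow> rapid (odd_coeff x)"
  by (rule theta_family_rapid[OF theta_family_odd_coeff]) auto

lemma rapid_even_coeff: "x \<noteq> 0 \<Longrightarrow> norm x < 1 \<Longrightarrow> rapid (even_coeff x)"
  by (rule theta_family_rapid[OF theta_family_even_coeff]) auto

lemma rapid_cross_coeff:
  assumes "x \<noteq> 0" "norm x < 1"
  shows "rapid (cross_coeff x)"
proof -
  have "norm (x\<^sup>2) < 1" using assms by (simp add: norm_power power_less_one_iff)
  thus ?thesis
    using triangular_rapid[of "x\<^sup>2"] assms by (simp add: rapid_def cross_coeff_def norm_mult norm_power_int)
qed

lemma laurent_full_coeff: "laurent (full_coeff x) z = theta x z"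
  by (simp add: laurent_def full_coeff_def theta_def)

lemma laurent_cross_coeff: "laurent (cross_coeff x) z = theta (x\<^sup>2) (- z)"
proof -
  have "(- z) powi n = (-1) powi n * z powi n" for n
    by (metis mult_minus1 power_int_mult_distrib)
  thus ?thesis by (simp add: laurent_def cross_coeff_def theta_def mult_ac)
qed

lemma parity_square_div:
  fixes m n :: int
  assumes p: "p = m + n + 1" and q: "q = m - n"
  shows "even (m + n) \<Longrightarrow> (p\<^sup>2 - 1) div 2 + q\<^sup>2 div 2 = 2 * triangular m + 2 * triangular n"
    and "odd (m + n) \<Longrightarrow> p\<^sup>2 div 2 + (q\<^sup>2 - 1) div 2 = 2 * triangular m + 2 * triangular n"
proof -
  have eq: "p\<^sup>2 - 1 + q\<^sup>2 = 2 * (2 * triangular m + 2 * triangular n)"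
    unfolding two_triangular distrib_left by (simp add: p q power2_eq_square algebra_simps)
  have dbl: "u div 2 + v div 2 = W" if "even u" "even v" "u + v = 2 * W" for u v W :: int
    using that by presburger
  show "(p\<^sup>2 - 1) div 2 + q\<^sup>2 div 2 = 2 * triangular m + 2 * triangular n" if "even (m + n)"
  proof -
    have "even (q\<^sup>2)" "even (p\<^sup>2 - 1)" using that by (auto simp: p q)
    from dbl[OF this(2,1)] eq show ?thesis by simp
  qed
  show "p\<^sup>2 div 2 + (q\<^sup>2 - 1) div 2 = 2 * triangular m + 2 * triangular n" if "odd (m + n)"
  proof -
    have "even (p\<^sup>2)" "even (q\<^sup>2 - 1)" using that by (auto simp: p q)
    moreover have "p\<^sup>2 + (q\<^sup>2 - 1) = 2 * (2 * triangular m + 2 * triangular n)" using eq by linarith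
    ultimately show ?thesis by (rule dbl)
  qed
qed

text \<open>The indices p = m + n + 1 and q = m - n have opposite parity, so exactly one of the two
  products survives, and the parity of m + n decides its sign. The exponents match because p^2 + q^2
  - 1 = 2 * m * (m + 1) + 2 * n * (n + 1).\<close>

lemma cross_coefficient:
  assumes x: "x \<noteq> 0"
  shows "odd_coeff x (m + n + 1) * even_coeff x (m - n) - even_coeff x (m + n + 1) * odd_coeff x (m - n) = cross_coeff x m * cross_coeff x n"
proof -
  have sgn: "(-1::complex) powi m * (-1) powi n = (if even (m + n) then 1 else -1)"
    by (simp add: power_int_add[symmetric] power_int_minus_left)
  have T: "cross_coeff x m * cross_coeff x n = (if even (m + n) then 1 else -1) * x powi (2 * triangular m + 2 * triangular n)"
  proof -
    have "cross_coeff x m * cross_coeff x n = ((-1) powi m * (-1) powi n) * ((x\<^sup>2) powi triangular m * (x\<^sup>2) powi triangular n)"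
      by (simp add: cross_coeff_def mult_ac)
    also have "(x\<^sup>2) powi triangular m * (x\<^sup>2) powi triangular n = x powi (2 * triangular m + 2 * triangular n)"
      using x by (simp add: power_int_add power_int_mult)
    finally show ?thesis by (simp only: sgn)
  qed
  show ?thesis
  proof (cases "even (m + n)")
    case True
    hence par: "odd (m + n + 1)" "even (m - n)" by auto
    show ?thesis
      using True par x by (simp add: T odd_coeff_def even_coeff_def parity_square_div(1)[OF refl refl True, symmetric] power_int_add)
  next
    case False
    hence par: "even (m + n + 1)" "odd (m - n)" by auto
    show ?thesis
      using False par x by (simp add: T odd_coeff_def even_coeff_def parity_square_div(2)[OF refl refl False, symmetric] power_int_add)
  qed
qed

text \<open>The minor is a double sum over pairs of opposite parity, and (m, n) -> (m + n + 1, m -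
  n) parametrises these bijectively. With \<open>\<phi>\<close> and \<open>\<psi>\<close> arbitrary,
  it yields both the addition formula and its version for moments.\<close>

lemma cross_general:
  assumes x: "x \<noteq> 0"
    and a1: "(\<lambda>p. odd_coeff x p * \<phi> p) abs_summable_on UNIV" and b1: "(\<lambda>p. even_coeff x p * \<phi> p) abs_summable_on UNIV"
    and a2: "(\<lambda>p. odd_coeff x p * \<psi> p) abs_summable_on UNIV" and b2: "(\<lambda>p. even_coeff x p * \<psi> p) abs_summable_on UNIV"
  shows "infsum (\<lambda>p. odd_coeff x p * \<phi> p) UNIV * infsum (\<lambda>p. even_coeff x p * \<psi> p) UNIV
       - infsum (\<lambda>p. even_coeff x p * \<phi> p) UNIV * infsum (\<lambda>p. odd_coeff x p * \<psi> p) UNIV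
    = infsum (\<lambda>(m, n). cross_coeff x m * cross_coeff x n * (\<phi> (m + n + 1) * \<psi> (m - n))) UNIV"
proof -
  define g where "g = (\<lambda>(p, q). (odd_coeff x p * even_coeff x q - even_coeff x p * odd_coeff x q) * (\<phi> p * \<psi> q))"
  define F where "F = (\<lambda>(p, q). (odd_coeff x p * \<phi> p) * (even_coeff x q * \<psi> q))"
  define G where "G = (\<lambda>(p, q). (even_coeff x p * \<phi> p) * (odd_coeff x q * \<psi> q))"
  have sF: "F summable_on UNIV"
    using abs_summable_summable[OF abs_summable_product2[OF a1 b2]] by (simp add: F_def)
  have sG: "G summable_on UNIV"
    using abs_summable_summable[OF abs_summable_product2[OF b1 a2]] by (simp add: G_def)
  have "infsum (\<lambda>p. F p + - G p) UNIV = infsum F UNIV + - infsum G UNIV"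
    using infsum_add[OF sF summable_on_uminus[THEN iffD2, OF sG]] by (simp add: infsum_uminus)
  also have "(\<lambda>p. F p + - G p) = g"
    by (auto simp: F_def G_def g_def fun_eq_iff algebra_simps)
  finally have 1: "infsum (\<lambda>p. odd_coeff x p * \<phi> p) UNIV * infsum (\<lambda>p. even_coeff x p * \<psi> p) UNIV
       - infsum (\<lambda>p. even_coeff x p * \<phi> p) UNIV * infsum (\<lambda>p. odd_coeff x p * \<psi> p) UNIV = infsum g UNIV"
    using infsum_product2[OF a1 b2] infsum_product2[OF b1 a2] by (simp add: F_def G_def)
  define S where "S = {(p::int, q). odd (p + q)}"
  have bij: "bij_betw (\<lambda>(m, n). (m + n + 1, m - n)) UNIV S"
  proof (rule bij_betwI[of _ _ _ "\<lambda>(p, q). ((p + q - 1) div 2, (p - q - 1) div 2)"], goal_cases)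
    case (4 z)
    obtain p q where z: "z = (p, q)" by fastforce
    with 4 have "odd (p + q)" by (simp add: S_def)
    then obtain k where "p + q = 2 * k + 1" by (rule oddE)
    hence p: "p = 2 * k + 1 - q" by simp
    have "(p - q - 1) div 2 = k - q" unfolding p by simp
    moreover have "(p + q - 1) div 2 = k" unfolding p by simp
    moreover have "- (2 * u) div 2 = - u" for u :: int by presburger
    ultimately show ?case using p by (simp add: z)
  qed (auto simp: S_def)
  have "infsum g UNIV = infsum g S"
    by (rule infsum_cong_neutral) (auto simp: g_def S_def odd_coeff_def even_coeff_def split: if_splits)
  also have "\<dots> = infsum (\<lambda>z. g (case z of (m, n) \<Rightarrow> (m + n + 1, m - n))) UNIV"
    using infsum_reindex_bij_betw[OF bij, of g] by simp
  also have "\<dots> = infsum (\<lambda>(m, n). cross_coeff x m * cross_coeff x n * (\<phi> (m + n + 1) * \<psi> (m - n))) UNIV"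
    by (intro infsum_cong) (auto simp: g_def cross_coefficient[OF x])
  finally show ?thesis using 1 by simp
qed

text \<open>This addition formula turns the two-by-two minors in a homogeneous Vandermonde determinant into
  products of theta functions.\<close>

lemma cross_laurent:
  assumes x: "x \<noteq> 0" "norm x < 1" and z: "z \<noteq> 0" and w: "w \<noteq> 0"
  shows "laurent (odd_coeff x) z * laurent (even_coeff x) w - laurent (even_coeff x) z * laurent (odd_coeff x) w
     = z * theta (x\<^sup>2) (- (z * w)) * theta (x\<^sup>2) (- (z / w))"
proof -
  have "laurent (odd_coeff x) z * laurent (even_coeff x) w - laurent (even_coeff x) z * laurent (odd_coeff x) w
     = infsum (\<lambda>(m, n). cross_coeff x m * cross_coeff x n * (z powi (m + n + 1) * w powi (m - n))) UNIV"
    unfolding laurent_def by (rule cross_general[OF x(1)]) (intro rapid_powi rapid_odd_coeff rapid_even_coeff x z w)+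
  also have "\<dots> = infsum (\<lambda>p. z * (case p of (m, n) \<Rightarrow> (cross_coeff x m * (z * w) powi m) * (cross_coeff x n * (z / w) powi n))) UNIV"
    using z w by (intro infsum_cong)
      (auto simp: power_int_add power_int_diff power_int_mult_distrib power_int_divide_distrib field_simps)
  also have "\<dots> = z * infsum (\<lambda>(m, n). (cross_coeff x m * (z * w) powi m) * (cross_coeff x n * (z / w) powi n)) (UNIV \<times> UNIV)"
    by (simp add: infsum_cmult_right')
  also have "\<dots> = z * (laurent (cross_coeff x) (z * w) * laurent (cross_coeff x) (z / w))"
    unfolding laurent_def using z w
    by (subst infsum_product2) (auto intro!: rapid_powi rapid_cross_coeff x)
  finally show ?thesis by (simp add: laurent_cross_coeff mult.assoc)
qed

section \<open>Moments of the theta coefficients\<close>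

definition moment :: "(int \<Rightarrow> complex) \<Rightarrow> nat \<Rightarrow> complex" where
  "moment c k = infsum (\<lambda>n. c n * of_int n ^ k) UNIV"

text \<open>The zero of the theta function at z = 1: the coefficients are antisymmetric under n -> -
  n - 1.\<close>

lemma moment_cross_coeff_0: "moment (cross_coeff x) 0 = 0"
proof -
  have bij: "bij_betw (\<lambda>n::int. - n - 1) UNIV UNIV"
    by (rule bij_betwI[of _ _ _ "\<lambda>n. - n - 1"]) auto
  have "cross_coeff x (- n - 1) = - cross_coeff x n" for n
  proof -
    have "triangular (- n - 1) = triangular n"
      using two_triangular[of n] two_triangular[of "- n - 1"] by (simp add: algebra_simps)
    thus ?thesis by (auto simp: cross_coeff_def power_int_minus_left)
  qed
  hence "infsum (cross_coeff x) UNIV = - infsum (cross_coeff x) UNIV"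
    using infsum_reindex_bij_betw[OF bij, of "cross_coeff x"] by (simp add: infsum_uminus)
  thus ?thesis by (simp add: moment_def)
qed

text \<open>The infinitesimal addition formula, with weights p^2 and 1. Expanding (m + (n + 1))^2,
  both pure squares meet a vanishing zeroth moment; the mixed term alone remains and gives the
  factor 2.\<close>

lemma cross_moment:
  assumes x: "x \<noteq> 0" "norm x < 1"
  shows "moment (odd_coeff x) 2 * moment (even_coeff x) 0 - moment (even_coeff x) 2 * moment (odd_coeff x) 0 = 2 * (moment (cross_coeff x) 1)\<^sup>2"
proof -
  have mom: "(\<lambda>n. c n * of_int n ^ k) abs_summable_on UNIV" if "rapid c" for c k
    using rapid_moment[OF that, of 0 k] by simp
  define h where "h = (\<lambda>i (m, n). (cross_coeff x m * (of_nat (2 choose i) * of_int m ^ i)) * (cross_coeff x n * (of_int n + 1) ^ (2 - i)))"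
  have s1: "(\<lambda>m. cross_coeff x m * (of_nat (2 choose i) * of_int m ^ i)) abs_summable_on UNIV" for i
    using summable_on_cmult_right[OF mom[OF rapid_cross_coeff[OF x], of i], of "of_nat (2 choose i)"]
    by (simp add: norm_mult norm_power mult_ac)
  have s2: "(\<lambda>n. cross_coeff x n * (of_int n + 1) ^ (2 - i)) abs_summable_on UNIV" for i
    by (rule rapid_moment[OF rapid_cross_coeff[OF x]])
  have sh: "h i summable_on UNIV" for i
    using abs_summable_summable[OF abs_summable_product2[OF s1 s2]] by (simp add: h_def)
  have ih: "infsum (h i) UNIV = of_nat (2 choose i) * moment (cross_coeff x) i * infsum (\<lambda>n. cross_coeff x n * (of_int n + 1) ^ (2 - i)) UNIV" for i
  proof -
    have "infsum (\<lambda>m. cross_coeff x m * (of_nat (2 choose i) * of_int m ^ i)) UNIV = of_nat (2 choose i) * moment (cross_coeff x) i"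
      unfolding moment_def infsum_cmult_right'[symmetric] by (intro infsum_cong) simp
    thus ?thesis using infsum_product2[OF s1 s2, of i i] by (simp add: h_def)
  qed
  have l1: "infsum (\<lambda>n. cross_coeff x n * (of_int n + 1) ^ 1) UNIV = moment (cross_coeff x) 1"
  proof -
    have "infsum (\<lambda>n. cross_coeff x n * (of_int n + 1) ^ 1) UNIV = infsum (\<lambda>n. cross_coeff x n * of_int n ^ 1 + cross_coeff x n * of_int n ^ 0) UNIV"
      by (intro infsum_cong) (simp add: algebra_simps)
    also have "\<dots> = moment (cross_coeff x) 1 + moment (cross_coeff x) 0"
      unfolding moment_def
      by (rule infsum_add; rule abs_summable_summable; rule mom; rule rapid_cross_coeff[OF x])
    finally show ?thesis by (simp add: moment_cross_coeff_0)
  qed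
  have l0: "infsum (\<lambda>n. cross_coeff x n * (of_int n + 1) ^ 0) UNIV = 0"
    using moment_cross_coeff_0[of x] by (simp add: moment_def)
  have "moment (odd_coeff x) 2 * moment (even_coeff x) 0 - moment (even_coeff x) 2 * moment (odd_coeff x) 0
    = infsum (\<lambda>(m, n). cross_coeff x m * cross_coeff x n * (of_int (m + n + 1) ^ 2 * of_int (m - n) ^ 0)) UNIV"
    unfolding moment_def by (rule cross_general[OF x(1)]) (intro mom rapid_odd_coeff rapid_even_coeff x)+
  also have "\<dots> = infsum (\<lambda>p. \<Sum>i\<le>2. h i p) UNIV"
  proof (intro infsum_cong)
    fix p :: "int \<times> int"
    obtain m n where p: "p = (m, n)" by fastforce
    have "(of_int (m + n + 1) :: complex) ^ 2 = (of_int m + (of_int n + 1)) ^ 2" by (simp add: add.assoc)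
    also have "\<dots> = (\<Sum>i\<le>2. of_nat (2 choose i) * of_int m ^ i * (of_int n + 1) ^ (2 - i))"
      by (rule binomial_ring)
    finally have e: "(of_int (m + n + 1) :: complex) ^ 2 = (\<Sum>i\<le>2. of_nat (2 choose i) * of_int m ^ i * (of_int n + 1) ^ (2 - i))" .
    show "(case p of (m, n) \<Rightarrow> cross_coeff x m * cross_coeff x n * (of_int (m + n + 1) ^ 2 * of_int (m - n) ^ 0)) = (\<Sum>i\<le>2. h i p)"
      unfolding p prod.case h_def e power_0 mult_1_right sum_distrib_left by (intro sum.cong refl) (simp only: mult_ac)
  qed
  also have "\<dots> = (\<Sum>i\<le>2. infsum (h i) UNIV)"
    by (rule infsum_finite_sum) (auto simp: sh)
  also have "\<dots> = 2 * (moment (cross_coeff x) 1)\<^sup>2"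
    by (simp only: ih numeral_2_eq_2 sum.atMost_Suc atMost_0 sum.insert sum.empty finite.emptyI)
       (use l0 l1 in \<open>simp add: moment_cross_coeff_0 power2_eq_square numeral_2_eq_2[symmetric]\<close>)
  finally show ?thesis .
qed

lemma moment_cross_coeff_1:
  assumes x: "x \<noteq> 0" "norm x < 1"
  shows "(\<lambda>N. (\<Prod>k<N. 1 - (x\<^sup>2) ^ Suc k) ^ 3) \<longlonglongrightarrow> moment (cross_coeff x) 1"
proof -
  have n: "norm (x\<^sup>2) < 1" "x\<^sup>2 \<noteq> 0" using x by (auto simp: norm_power power_less_one_iff)
  have "infsum (\<lambda>j. (x\<^sup>2) powi triangular j * ((-1) powi j * of_int j)) UNIV = moment (cross_coeff x) 1"
    unfolding moment_def by (intro infsum_cong) (simp add: cross_coeff_def)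
  thus ?thesis using jacobi_identity_cube[OF n] by simp
qed

text \<open>All terms are nonnegative and the one at n = 1 is 1. This is the reason for working with
  real x.\<close>

lemma moment_odd_coeff_0_nonzero:
  assumes r: "0 < r" "r < 1"
  shows "moment (odd_coeff (of_real r)) 0 \<noteq> 0"
proof -
  define f where "f n = (if odd n then r powi ((n\<^sup>2 - 1) div 2) else 0)" for n :: int
  have fr: "odd_coeff (of_real r) n = of_real (f n)" for n by (simp add: odd_coeff_def f_def)
  have s: "f summable_on UNIV"
  proof -
    have "(\<lambda>n. odd_coeff (of_real r) n * of_int n ^ 0) abs_summable_on UNIV"
      using rapid_moment[OF rapid_odd_coeff, of "of_real r" 0 0] r by simp
    hence "(\<lambda>n. norm (f n)) summable_on UNIV" by (simp add: fr)
    thus ?thesis by (rule abs_summable_summable)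
  qed
  have "f 1 \<le> infsum f UNIV"
    using finite_sum_le_infsum[OF s, of "{1}"] r by (simp add: f_def)
  moreover have "f 1 = 1" by (simp add: f_def)
  moreover have "moment (odd_coeff (of_real r)) 0 = of_real (infsum f UNIV)"
    using has_sum_of_real[OF has_sum_infsum[OF s], where ?'a = complex]
    by (simp add: moment_def fr infsumI)
  ultimately show ?thesis by (simp add: of_real_eq_0_iff)
qed

subsection \<open>Vandermonde determinants\<close>

text \<open>Passing from the monomials to the monic Newton polynomials \<open>p k\<close> is a
  unitriangular change of basis; afterwards the matrix is upper triangular, because
  \<open>p k\<close> vanishes at the first k nodes.\<close>

lemma det_vandermonde:
  fixes \<tau> :: "nat \<Rightarrow> 'a :: idom"
  shows "Determinant.det (Matrix.mat t t (\<lambda>(k, j). \<tau> j ^ k)) = (\<Prod>j<t. \<Prod>i<j. \<tau> j - \<tau> i)"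
proof -
  define p where "p k = (\<Prod>i<k. [:- \<tau> i, 1:])" for k
  have deg: "degree (p k) = k" for k
    unfolding p_def by (subst degree_prod_eq_sum_degree) auto
  have lc: "coeff (p k) k = 1" for k
    using lead_coeff_prod[of "\<lambda>i. [:- \<tau> i, 1:]" "{..<k}"] deg[of k] by (simp add: p_def)
  define V where "V = Matrix.mat t t (\<lambda>(k, j). \<tau> j ^ k)"
  define C where "C = Matrix.mat t t (\<lambda>(k, l). coeff (p k) l)"
  define U where "U = Matrix.mat t t (\<lambda>(k, j). poly (p k) (\<tau> j))"
  have [simp]: "V \<in> carrier_mat t t" "C \<in> carrier_mat t t" "U \<in> carrier_mat t t"
    by (auto simp: V_def C_def U_def)
  have "U = C * V"
  proof (rule eq_matI)
    fix k j assume "k < dim_row (C * V)" "j < dim_col (C * V)"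
    hence kj: "k < t" "j < t" by (auto simp: C_def V_def)
    have "poly (p k) (\<tau> j) = (\<Sum>l\<le>k. coeff (p k) l * \<tau> j ^ l)"
      by (simp add: poly_altdef deg)
    also have "\<dots> = (\<Sum>l<t. coeff (p k) l * \<tau> j ^ l)"
      by (rule sum.mono_neutral_left) (use kj in \<open>auto simp: coeff_eq_0 deg\<close>)
    finally show "U $$ (k, j) = (C * V) $$ (k, j)"
      using kj by (simp add: U_def C_def V_def scalar_prod_def lessThan_atLeast0)
  qed (auto simp: C_def V_def U_def)
  hence "Determinant.det U = Determinant.det C * Determinant.det V"
    by (simp add: det_mult[of _ t])
  moreover have "Determinant.det C = 1"
  proof -
    have "Determinant.det C = prod_list (diag_mat C)"
      by (rule det_lower_triangular[of t]) (auto simp: C_def coeff_eq_0 deg)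
    also have "\<dots> = (\<Prod>k<t. C $$ (k, k))"
      by (simp add: diag_mat_def C_def prod.list_conv_set_nth lessThan_atLeast0)
    also have "\<dots> = 1" by (simp add: C_def lc)
    finally show ?thesis .
  qed
  moreover have "Determinant.det U = (\<Prod>j<t. \<Prod>i<j. \<tau> j - \<tau> i)"
  proof -
    have "Determinant.det U = prod_list (diag_mat U)"
      by (rule det_upper_triangular[of _ t]) (auto simp: U_def p_def poly_prod upper_triangular_def intro!: prod_zero)
    also have "\<dots> = (\<Prod>k<t. U $$ (k, k))"
      by (simp add: diag_mat_def U_def prod.list_conv_set_nth lessThan_atLeast0)
    also have "\<dots> = (\<Prod>j<t. \<Prod>i<j. \<tau> j - \<tau> i)" by (simp add: U_def p_def poly_prod)
    finally show ?thesis .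
  qed
  ultimately show ?thesis by (simp add: V_def)
qed

lemma det_scale_columns:
  fixes A :: "'a :: idom mat"
  assumes A: "A \<in> carrier_mat t t"
  shows "Determinant.det (Matrix.mat t t (\<lambda>(k, j). c j * A $$ (k, j))) = (\<Prod>j<t. c j) * Determinant.det A"
proof -
  define D where "D = Matrix.mat t t (\<lambda>(k, j). if k = j then c j else 0)"
  have D: "D \<in> carrier_mat t t" by (simp add: D_def)
  have "Matrix.mat t t (\<lambda>(k, j). c j * A $$ (k, j)) = A * D"
  proof (rule eq_matI)
    fix k j assume "k < dim_row (A * D)" "j < dim_col (A * D)"
    hence kj: "k < t" "j < t" using A by (auto simp: D_def)
    have "(A * D) $$ (k, j) = (\<Sum>l<t. A $$ (k, l) * (if l = j then c j else 0))"
      using kj A by (simp add: D_def scalar_prod_def lessThan_atLeast0)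
    also have "\<dots> = c j * A $$ (k, j)" using kj by (simp add: if_distrib[of "(*) _"] sum.delta' mult.commute cong: if_cong)
    finally show "Matrix.mat t t (\<lambda>(k, j). c j * A $$ (k, j)) $$ (k, j) = (A * D) $$ (k, j)" using kj by simp
  qed (use A in \<open>auto simp: D_def\<close>)
  moreover have "Determinant.det D = (\<Prod>j<t. c j)"
  proof -
    have "Determinant.det D = prod_list (diag_mat D)"
      by (rule det_upper_triangular[of _ t]) (auto simp: D_def upper_triangular_def)
    also have "\<dots> = (\<Prod>j<t. c j)"
      by (simp add: diag_mat_def D_def prod.list_conv_set_nth lessThan_atLeast0)
    finally show ?thesis .
  qed
  ultimately show ?thesis using A D by (simp add: det_mult[of _ t])
qed

lemma det_scale_rows:
  fixes A :: "'a :: idom mat"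
  assumes A: "A \<in> carrier_mat t t"
  shows "Determinant.det (Matrix.mat t t (\<lambda>(k, j). c k * A $$ (k, j))) = (\<Prod>k<t. c k) * Determinant.det A"
proof -
  have "Determinant.det (Matrix.mat t t (\<lambda>(k, j). c k * A $$ (k, j)))
      = Determinant.det (transpose_mat (Matrix.mat t t (\<lambda>(k, j). c k * A $$ (k, j))))"
    by (rule det_transpose[symmetric]) auto
  also have "transpose_mat (Matrix.mat t t (\<lambda>(k, j). c k * A $$ (k, j))) = Matrix.mat t t (\<lambda>(k, j). c j * transpose_mat A $$ (k, j))"
    using A by (intro eq_matI) auto
  also have "Determinant.det \<dots> = (\<Prod>k<t. c k) * Determinant.det A"
    using A by (subst det_scale_columns) (auto simp: det_transpose)
  finally show ?thesis .
qed

text \<open>Each index belongs to t - 1 of the pairs.\<close>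

lemma prod_pairs_commute:
  fixes f :: "nat \<Rightarrow> 'a :: comm_monoid_mult"
  shows "(\<Prod>j<t. \<Prod>i<j. f i * f j) = (\<Prod>j<t. f j ^ (t - 1))"
proof (induction t)
  case (Suc t)
  have "(\<Prod>j<Suc t. f j ^ (Suc t - 1)) = (\<Prod>j<t. f j ^ t) * f t ^ t" by simp
  also have "(\<Prod>j<t. f j ^ t) = (\<Prod>j<t. f j ^ (t - 1)) * (\<Prod>j<t. f j)"
    unfolding prod.distrib[symmetric] by (intro prod.cong refl) (auto simp flip: power_Suc2)
  finally show ?case using Suc by (simp add: prod.distrib mult_ac)
qed auto

text \<open>For nonvanishing \<open>\<alpha>\<close> this is the Vandermonde determinant in the
  ratios \<open>\<beta> j / \<alpha> j\<close>. The general case follows by continuity.\<close>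

lemma det_homogeneous_vandermonde:
  fixes \<kappa> \<alpha> \<beta> :: "nat \<Rightarrow> complex"
  shows "Determinant.det (Matrix.mat t t (\<lambda>(k, j). \<kappa> j * \<alpha> j ^ (t - 1 - k) * \<beta> j ^ k))
    = (\<Prod>j<t. \<kappa> j) * (\<Prod>j<t. \<Prod>i<j. \<alpha> i * \<beta> j - \<beta> i * \<alpha> j)"
proof -
  define M where "M a = Matrix.mat t t (\<lambda>(k, j). \<kappa> j * a j ^ (t - 1 - k) * \<beta> j ^ k)" for a
  define R where "R a = (\<Prod>j<t. \<kappa> j) * (\<Prod>j<t. \<Prod>i<j. a i * \<beta> j - \<beta> i * a j)" for a
  have nz: "Determinant.det (M a) = R a" if a: "\<And>j. j < t \<Longrightarrow> a j \<noteq> 0" for a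
  proof -
    define V where "V = Matrix.mat t t (\<lambda>(k, j). (\<beta> j / a j) ^ k)"
    have "M a = Matrix.mat t t (\<lambda>(k, j). (\<kappa> j * a j ^ (t - 1)) * V $$ (k, j))"
    proof (rule eq_matI, goal_cases)
      case (1 k j)
      hence kj: "k < t" "j < t" by auto
      have "a j ^ (t - 1) = a j ^ (t - 1 - k) * a j ^ k" using kj by (simp flip: power_add)
      thus ?case using kj a[of j] by (simp add: M_def V_def power_divide)
    qed (auto simp: M_def)
    hence "Determinant.det (M a) = (\<Prod>j<t. \<kappa> j * a j ^ (t - 1)) * Determinant.det V"
      by (simp only:) (subst det_scale_columns, auto simp: V_def)
    also have "Determinant.det V = (\<Prod>j<t. \<Prod>i<j. \<beta> j / a j - \<beta> i / a i)"
      unfolding V_def by (rule det_vandermonde)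
    also have "(\<Prod>j<t. \<kappa> j * a j ^ (t - 1)) * \<dots> = (\<Prod>j<t. \<kappa> j) * ((\<Prod>j<t. \<Prod>i<j. a i * a j) * (\<Prod>j<t. \<Prod>i<j. \<beta> j / a j - \<beta> i / a i))"
      by (simp only: prod_pairs_commute) (simp only: prod.distrib mult.assoc)
    also have "(\<Prod>j<t. \<Prod>i<j. a i * a j) * (\<Prod>j<t. \<Prod>i<j. \<beta> j / a j - \<beta> i / a i) = (\<Prod>j<t. \<Prod>i<j. a i * \<beta> j - \<beta> i * a j)"
    proof -
      have "a i * a j * (\<beta> j / a j - \<beta> i / a i) = a i * \<beta> j - \<beta> i * a j" if "j < t" "i < j" for i j
        using a[of i] a[of j] that by (simp add: field_simps)
      thus ?thesis unfolding prod.distrib[symmetric] by (intro prod.cong refl) simp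
    qed
    finally show ?thesis by (simp add: R_def)
  qed
  \<comment> \<open>A perturbation that is eventually nonzero for all j, whether or not
    \<open>\<alpha> j\<close> vanishes.\<close>
  define e where "e n j = \<alpha> j + of_real (1 / real (Suc n))" for n j
  have elim: "(\<lambda>n. e n j) \<longlonglongrightarrow> \<alpha> j" for j
  proof -
    have "(\<lambda>n. \<alpha> j + of_real (1 / real (Suc n))) \<longlonglongrightarrow> \<alpha> j + of_real 0"
      by (intro tendsto_add tendsto_const tendsto_of_real LIMSEQ_Suc[OF lim_1_over_n])
    thus ?thesis by (simp add: e_def)
  qed
  have "eventually (\<lambda>n. \<forall>j\<in>{..<t}. e n j \<noteq> 0) sequentially"
  proof (rule eventually_ball_finite)
    show "\<forall>j\<in>{..<t}. eventually (\<lambda>n. e n j \<noteq> 0) sequentially"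
    proof
      fix j
      show "eventually (\<lambda>n. e n j \<noteq> 0) sequentially"
      proof (cases "\<alpha> j = 0")
        case True
        thus ?thesis by (simp add: e_def del: of_nat_Suc)
      next
        case False
        thus ?thesis using tendsto_imp_eventually_ne[OF elim] by blast
      qed
    qed
  qed auto
  hence ev: "eventually (\<lambda>n. Determinant.det (M (e n)) = R (e n)) sequentially"
    by eventually_elim (auto intro: nz)
  have l1: "(\<lambda>n. Determinant.det (M (e n))) \<longlonglongrightarrow> Determinant.det (M \<alpha>)"
  proof -
    have d: "Determinant.det (M a) = (\<Sum>p | p permutes {0..<t}. signof p * (\<Prod>i = 0..<t. \<kappa> (p i) * a (p i) ^ (t - 1 - i) * \<beta> (p i) ^ i))" for a
    proof -
      have "p i < t" if "p permutes {0..<t}" "i < t" for p i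
        using permutes_in_image[OF that(1), of i] that(2) by simp
      thus ?thesis unfolding M_def by (subst det_def'[of _ t]) (auto intro!: sum.cong prod.cong)
    qed
    show ?thesis unfolding d by (intro tendsto_intros elim)
  qed
  have l2: "(\<lambda>n. R (e n)) \<longlonglongrightarrow> R \<alpha>"
    unfolding R_def by (intro tendsto_intros elim)
  have "(\<lambda>n. R (e n)) \<longlonglongrightarrow> Determinant.det (M \<alpha>)"
    using Lim_transform_eventually[OF l1 ev] .
  from LIMSEQ_unique[OF this l2] show ?thesis by (simp add: M_def R_def)
qed

text \<open>Subtracting a multiple of \<open>A\<close> from \<open>B\<close> gives a series
  \<open>C\<close> without constant term. The binomial theorem makes this a unitriangular change of
  rows, and since C^m is divisible by X^m, the new matrix is triangular with diagonal built from
  \<open>fps_nth C 1\<close>.\<close>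

lemma det_fps_coeffs:
  fixes P A B :: "complex fps"
  assumes A0: "fps_nth A 0 \<noteq> 0"
  shows "Determinant.det (Matrix.mat t t (\<lambda>(k, l). fps_nth (P * A ^ (t - 1 - k) * B ^ k) l))
    = fps_nth P 0 ^ t * (fps_nth A 0 * fps_nth B 1 - fps_nth A 1 * fps_nth B 0) ^ (\<Sum>m<t. m)"
proof -
  define \<beta> where "\<beta> = fps_nth B 0 / fps_nth A 0"
  define C where "C = B - fps_const \<beta> * A"
  have C0: "fps_nth C 0 = 0" using A0 by (simp add: C_def \<beta>_def)
  have C1: "fps_nth A 0 * fps_nth C 1 = fps_nth A 0 * fps_nth B 1 - fps_nth A 1 * fps_nth B 0"
    using A0 by (simp add: C_def \<beta>_def field_simps)
  define L where "L = Matrix.mat t t (\<lambda>(k, m). of_nat (k choose m) * \<beta> ^ (k - m))"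
  define U where "U = Matrix.mat t t (\<lambda>(m, l). fps_nth (P * A ^ (t - 1 - m) * C ^ m) l)"
  define M where "M = Matrix.mat t t (\<lambda>(k, l). fps_nth (P * A ^ (t - 1 - k) * B ^ k) l)"
  have car: "L \<in> carrier_mat t t" "U \<in> carrier_mat t t" by (auto simp: L_def U_def)
  have "M = L * U"
  proof (rule eq_matI)
    fix k l assume "k < dim_row (L * U)" "l < dim_col (L * U)"
    hence kl: "k < t" "l < t" by (auto simp: L_def U_def)
    have "P * A ^ (t - 1 - k) * B ^ k = P * A ^ (t - 1 - k) * (C + fps_const \<beta> * A) ^ k" by (simp add: C_def)
    also have "\<dots> = P * A ^ (t - 1 - k) * (\<Sum>m\<le>k. of_nat (k choose m) * C ^ m * (fps_const \<beta> * A) ^ (k - m))"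
      by (simp add: binomial_ring)
    also have "\<dots> = (\<Sum>m\<le>k. fps_const (of_nat (k choose m) * \<beta> ^ (k - m)) * (P * A ^ (t - 1 - m) * C ^ m))"
      unfolding sum_distrib_left
    proof (intro sum.cong refl, goal_cases)
      case (1 m)
      hence "A ^ (t - 1 - m) = A ^ (t - 1 - k) * A ^ (k - m)" using kl by (simp flip: power_add)
      thus ?case
        by (simp only: power_mult_distrib fps_const_power fps_of_nat[symmetric] fps_const_mult[symmetric] mult_ac)
    qed
    also have "\<dots> = (\<Sum>m<t. fps_const (of_nat (k choose m) * \<beta> ^ (k - m)) * (P * A ^ (t - 1 - m) * C ^ m))"
      by (rule sum.mono_neutral_left) (use kl in auto)
    finally have "fps_nth (P * A ^ (t - 1 - k) * B ^ k) l
       = (\<Sum>m<t. (of_nat (k choose m) * \<beta> ^ (k - m)) * fps_nth (P * A ^ (t - 1 - m) * C ^ m) l)"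
      by (simp add: fps_sum_nth)
    thus "M $$ (k, l) = (L * U) $$ (k, l)"
      using kl by (simp add: M_def L_def U_def scalar_prod_def lessThan_atLeast0)
  qed (auto simp: M_def L_def U_def)
  hence "Determinant.det M = Determinant.det L * Determinant.det U"
    using car by (simp add: det_mult[of _ t])
  moreover have "Determinant.det L = 1"
  proof -
    have "Determinant.det L = prod_list (diag_mat L)"
      by (rule det_lower_triangular[of t]) (auto simp: L_def)
    also have "\<dots> = 1"
      by (simp add: diag_mat_def L_def prod.list_conv_set_nth)
    finally show ?thesis .
  qed
  moreover have "Determinant.det U = (\<Prod>m<t. fps_nth P 0 * fps_nth A 0 ^ (t - 1 - m) * fps_nth C 1 ^ m)"
  proof -
    have Cm: "C ^ m = fps_X ^ m * (fps_shift 1 C) ^ m" for m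
    proof -
      have "C = fps_X * fps_shift 1 C"
        using C0 by (intro fps_ext) (auto simp: fps_X_mult_nth)
      thus ?thesis by (metis power_mult_distrib)
    qed
    have nth: "fps_nth (P * A ^ (t - 1 - m) * C ^ m) l = (if l < m then 0 else fps_nth (P * A ^ (t - 1 - m) * (fps_shift 1 C) ^ m) (l - m))" for m l
    proof -
      have "P * A ^ (t - 1 - m) * C ^ m = fps_X ^ m * (P * A ^ (t - 1 - m) * (fps_shift 1 C) ^ m)"
        by (subst Cm) (simp add: mult_ac)
      thus ?thesis by (simp only: fps_X_power_mult_nth)
    qed
    have "Determinant.det U = prod_list (diag_mat U)"
      by (rule det_upper_triangular[of _ t]) (auto simp: U_def upper_triangular_def nth[simplified])
    also have "\<dots> = (\<Prod>m<t. U $$ (m, m))"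
      by (simp add: diag_mat_def U_def prod.list_conv_set_nth lessThan_atLeast0)
    also have "\<dots> = (\<Prod>m<t. fps_nth P 0 * fps_nth A 0 ^ (t - 1 - m) * fps_nth C 1 ^ m)"
      by (intro prod.cong refl) (simp add: U_def nth[simplified] fps_power_zeroth)
    finally show ?thesis .
  qed
  moreover have "(\<Prod>m<t. fps_nth P 0 * fps_nth A 0 ^ (t - 1 - m) * fps_nth C 1 ^ m)
     = fps_nth P 0 ^ t * (fps_nth A 0 * fps_nth C 1) ^ (\<Sum>m<t. m)"
  proof -
    have "(\<Prod>m<t. fps_nth A 0 ^ (t - 1 - m)) = (\<Prod>m<t. fps_nth A 0 ^ m)"
      using prod.nat_diff_reindex[of "\<lambda>m. fps_nth A 0 ^ m" t] by simp
    thus ?thesis by (simp add: prod.distrib power_sum power_mult_distrib)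
  qed
  ultimately have "Determinant.det M = fps_nth P 0 ^ t * (fps_nth A 0 * fps_nth C 1) ^ (\<Sum>m<t. m)" by simp
  thus ?thesis unfolding C1 M_def .
qed

subsection \<open>Two determinants in the space of theta functions\<close>

text \<open>For an even series f(u) = g(u^2) this is g, so on even series it is
  multiplicative.\<close>

definition even_part :: "'a :: zero fps \<Rightarrow> 'a fps" where
  "even_part f = Abs_fps (\<lambda>l. fps_nth f (2 * l))"

lemma even_part_mult:
  fixes f g :: "'a :: comm_ring_1 fps"
  assumes "\<And>n. odd n \<Longrightarrow> fps_nth f n = 0"
  shows "even_part (f * g) = even_part f * even_part g"
proof (rule fps_ext)
  fix l
  have "fps_nth (f * g) (2 * l) = (\<Sum>i\<in>{0..2*l}. fps_nth f i * fps_nth g (2 * l - i))"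
    by (simp add: fps_mult_nth)
  also have "\<dots> = (\<Sum>i\<in>(\<lambda>i. 2 * i) ` {0..l}. fps_nth f i * fps_nth g (2 * l - i))"
  proof (rule sum.mono_neutral_right)
    show "\<forall>i\<in>{0..2*l} - (\<lambda>i. 2 * i) ` {0..l}. fps_nth f i * fps_nth g (2 * l - i) = 0"
    proof
      fix i assume i: "i \<in> {0..2*l} - (\<lambda>i. 2 * i) ` {0..l}"
      have "odd i"
      proof (rule ccontr)
        assume "\<not> odd i"
        then obtain j where "i = 2 * j" by blast
        with i show False by auto
      qed
      thus "fps_nth f i * fps_nth g (2 * l - i) = 0" by (simp add: assms)
    qed
  qed auto
  also have "\<dots> = (\<Sum>i=0..l. fps_nth f (2 * i) * fps_nth g (2 * (l - i)))"
    by (subst sum.reindex) (auto simp: inj_on_def diff_mult_distrib2)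
  finally show "fps_nth (even_part (f * g)) l = fps_nth (even_part f * even_part g) l"
    by (simp add: even_part_def fps_mult_nth)
qed

lemma odd_coeff_power:
  fixes f g :: "'a :: comm_ring_1 fps"
  assumes "\<And>n. odd n \<Longrightarrow> fps_nth f n = 0"
  shows "odd n \<Longrightarrow> fps_nth (f ^ k) n = 0"
proof (induction k arbitrary: n)
  case (Suc k)
  show ?case
    unfolding power_Suc fps_mult_nth
  proof (rule sum.neutral, safe)
    fix i assume "i \<in> {0..n}"
    thus "fps_nth f i * fps_nth (f ^ k) (n - i) = 0"
      using Suc assms by (cases "odd i") auto
  qed
qed (auto elim: oddE)

lemma even_part_power:
  fixes f :: "'a :: comm_ring_1 fps"
  assumes "\<And>n. odd n \<Longrightarrow> fps_nth f n = 0"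
  shows "even_part (f ^ k) = even_part f ^ k"
proof (induction k)
  case 0
  show ?case by (rule fps_ext) (auto simp: even_part_def)
qed (simp add: even_part_mult assms)

text \<open>The \<open>Suc s\<close> families \<open>k = 0, \<dots>, s\<close> lie in the span of the theta functions supported on the
  residue classes of \<open>i\<close> and \<open>- i - 1\<close> modulo \<open>2 * Suc s\<close>, \<open>i \<le> s\<close>, and make every alternant a
  homogeneous Vandermonde determinant.\<close>

definition theta_basis :: "complex \<Rightarrow> nat \<Rightarrow> nat \<Rightarrow> int \<Rightarrow> complex" where
  "theta_basis x s k = (conv (even_coeff x) ^^ k) ((conv (odd_coeff x) ^^ (s - k)) (full_coeff x))"

lemma theta_family_conv_power:
  assumes x: "x \<noteq> 0" and a: "theta_family x 2 0 a" and c: "theta_family x D e c"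
  shows "theta_family x (2 * int n + D) e ((conv a ^^ n) c)"
proof (induction n)
  case (Suc n)
  show ?case using theta_family_conv[OF x a Suc] by (simp add: algebra_simps)
qed (use c in auto)

lemma rapid_conv_power: "rapid a \<Longrightarrow> rapid c \<Longrightarrow> rapid ((conv a ^^ n) c)"
  by (induction n) (auto intro: rapid_conv)

lemma laurent_conv_power: "rapid a \<Longrightarrow> rapid c \<Longrightarrow> z \<noteq> 0 \<Longrightarrow> laurent ((conv a ^^ n) c) z = laurent a z ^ n * laurent c z"
  by (induction n) (auto simp: laurent_conv rapid_conv_power)

lemma jet_conv_power: "rapid a \<Longrightarrow> rapid c \<Longrightarrow> jet e ((conv a ^^ n) c) = jet 0 a ^ n * jet e c"
proof (induction n)
  case (Suc n)
  show ?case using jet_conv[of a "(conv a ^^ n) c" 0 e] Suc by (simp add: rapid_conv_power mult.assoc)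
qed auto

context
  fixes x :: complex and s :: nat
  assumes x: "x \<noteq> 0" "norm x < 1"
begin

lemma theta_family_theta_basis: "k \<le> s \<Longrightarrow> theta_family x (2 * int (Suc s)) 1 (theta_basis x s k)"
  using theta_family_conv_power[OF x(1) theta_family_even_coeff[OF x(1)] theta_family_conv_power[OF x(1) theta_family_odd_coeff[OF x(1)] theta_family_full_coeff[OF x(1)], of "s - k"], of k]
  by (simp add: theta_basis_def algebra_simps)

lemma rapid_theta_basis: "rapid (theta_basis x s k)"
  unfolding theta_basis_def by (intro rapid_conv_power rapid_odd_coeff rapid_even_coeff rapid_full_coeff x)

lemma laurent_theta_basis: "z \<noteq> 0 \<Longrightarrow> laurent (theta_basis x s k) z = laurent (full_coeff x) z * laurent (odd_coeff x) z ^ (s - k) * laurent (even_coeff x) z ^ k"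
  unfolding theta_basis_def using x by (simp add: laurent_conv_power rapid_conv_power rapid_odd_coeff rapid_even_coeff rapid_full_coeff)

lemma jet_theta_basis: "jet 1 (theta_basis x s k) = jet 1 (full_coeff x) * jet 0 (odd_coeff x) ^ (s - k) * jet 0 (even_coeff x) ^ k"
  unfolding theta_basis_def using x by (simp add: jet_conv_power rapid_conv_power rapid_odd_coeff rapid_even_coeff rapid_full_coeff mult_ac)

end

text \<open>The shift by e / 2 centres the exponents: the reflection n -> - n - e becomes a change
  of sign.\<close>

lemma jet_odd:
  assumes c: "theta_family x D e c" and k: "odd k"
  shows "fps_nth (jet e c) k = 0"
proof -
  have bij: "bij_betw (\<lambda>n::int. - n - e) UNIV UNIV"
    by (rule bij_betwI[of _ _ _ "\<lambda>n. - n - e"]) auto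
  define f where "f n = c n * (of_int n + of_int e / 2) ^ k" for n
  have "f (- n - e) = - f n" for n
  proof -
    have "(of_int (- n - e) + of_int e / 2 :: complex) = - (of_int n + of_int e / 2)" by simp
    moreover have "c (- n - e) = c n" using c unfolding theta_family_def by blast
    ultimately show ?thesis unfolding f_def by (simp only: power_minus_odd[OF k]) simp
  qed
  hence "infsum f UNIV = - infsum f UNIV"
    using infsum_reindex_bij_betw[OF bij, of f] by (simp add: infsum_uminus)
  thus ?thesis by (simp add: jet_def f_def[abs_def])
qed

text \<open>The functional with weights \<open>\<phi>\<close> applied to the basis theta function
  with coefficient 1 at i and - i - 1; these are the multipliers of \<open>c (int i)\<close> in
  \<open>theta_family_decompose\<close>.\<close>

definition class_sum :: "complex \<Rightarrow> nat \<Rightarrow> nat \<Rightarrow> (int \<Rightarrow> complex) \<Rightarrow> complex" where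
  "class_sum x t i \<phi> = infsum (\<lambda>k. x powi (2 * int t * k\<^sup>2 + (2 * int i + 1) * k)
         * (\<phi> (int i + 2 * int t * k) + \<phi> (- (int i + 2 * int t * k) - 1))) UNIV"

definition wronskian :: "complex \<Rightarrow> nat \<Rightarrow> complex" where
  "wronskian x t = Determinant.det (Matrix.mat t t (\<lambda>(i, l). class_sum x t i (\<lambda>n. (of_int n + 1 / 2) ^ (2 * l)) / fact (2 * l)))"

text \<open>The matrix product collects the values of the functions of \<open>theta_basis\<close>,
  which have the form of a homogeneous Vandermonde matrix.\<close>

lemma det_laurent_class_sum:
  assumes x: "x \<noteq> 0" "norm x < 1" and t: "t > 0" and z: "\<And>j. j < t \<Longrightarrow> z j \<noteq> 0"
  shows "Determinant.det (Matrix.mat t t (\<lambda>(k, i). theta_basis x (t - 1) k (int i)))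
       * Determinant.det (Matrix.mat t t (\<lambda>(i, j). class_sum x t i (\<lambda>n. z j powi n)))
     = (\<Prod>j<t. laurent (full_coeff x) (z j))
       * (\<Prod>j<t. \<Prod>i<j. laurent (odd_coeff x) (z i) * laurent (even_coeff x) (z j) - laurent (even_coeff x) (z i) * laurent (odd_coeff x) (z j))"
proof -
  define N where "N = Matrix.mat t t (\<lambda>(k, i). theta_basis x (t - 1) k (int i))"
  define M where "M = Matrix.mat t t (\<lambda>(i, j). class_sum x t i (\<lambda>n. z j powi n))"
  have "Determinant.det N * Determinant.det M = Determinant.det (N * M)"
    by (rule det_mult[of _ t, symmetric]) (auto simp: N_def M_def)
  also have "N * M = Matrix.mat t t (\<lambda>(k, j). laurent (full_coeff x) (z j) * laurent (odd_coeff x) (z j) ^ (t - 1 - k) * laurent (even_coeff x) (z j) ^ k)"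
  proof (rule eq_matI, goal_cases)
    case (1 k j)
    hence kj: "k < t" "j < t" by auto
    have tf: "theta_family x (2 * int t) 1 (theta_basis x (t - 1) k)"
      using theta_family_theta_basis[OF x, of k "t - 1"] kj by simp
    have "(N * M) $$ (k, j) = (\<Sum>i<t. theta_basis x (t - 1) k (int i) * class_sum x t i (\<lambda>n. z j powi n))"
      using kj by (simp add: N_def M_def scalar_prod_def lessThan_atLeast0)
    also have "\<dots> = laurent (theta_basis x (t - 1) k) (z j)"
      unfolding laurent_def class_sum_def
      by (rule theta_family_decompose[symmetric, OF x(1) t tf rapid_powi[OF rapid_theta_basis[OF x]]]) (use z kj in auto)
    finally show ?case using kj z by (simp add: laurent_theta_basis[OF x])
  qed (auto simp: N_def M_def)
  finally show ?thesis
    unfolding det_homogeneous_vandermonde N_def M_def .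
qed

text \<open>The same transition matrix as for the values, now followed by even Taylor coefficients.
  Evenness lets the even parts be multiplied, so that \<open>det_fps_coeffs\<close> applies.\<close>

lemma det_jet_class_sum:
  assumes x: "x \<noteq> 0" "norm x < 1" and t: "t > 0" and a0: "moment (odd_coeff x) 0 \<noteq> 0"
  shows "Determinant.det (Matrix.mat t t (\<lambda>(k, i). theta_basis x (t - 1) k (int i))) * wronskian x t
     = theta x 1 ^ t * (- ((moment (cross_coeff x) 1)\<^sup>2)) ^ (\<Sum>m<t. m)"
proof -
  define N where "N = Matrix.mat t t (\<lambda>(k, i). theta_basis x (t - 1) k (int i))"
  define M where "M = Matrix.mat t t (\<lambda>(i, l). class_sum x t i (\<lambda>n. (of_int n + 1 / 2) ^ (2 * l)) / fact (2 * l))"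
  define P A B where "P = even_part (jet 1 (full_coeff x))" and "A = even_part (jet 0 (odd_coeff x))" and "B = even_part (jet 0 (even_coeff x))"
  have Pn: "fps_nth P 0 = theta x 1"
    by (simp add: P_def even_part_def jet_def full_coeff_def theta_def)
  have An: "fps_nth A 0 = moment (odd_coeff x) 0" "fps_nth A 1 = moment (odd_coeff x) 2 / 2"
    and Bn: "fps_nth B 0 = moment (even_coeff x) 0" "fps_nth B 1 = moment (even_coeff x) 2 / 2"
    by (simp_all add: A_def B_def even_part_def jet_def moment_def fact_2)
  \<comment> \<open>The halves come from fact 2 and cancel the factor 2 of
    \<open>cross_moment\<close>; the minor is taken in the opposite order there, hence the
    sign.\<close>
  have det: "fps_nth A 0 * fps_nth B 1 - fps_nth A 1 * fps_nth B 0 = - ((moment (cross_coeff x) 1)\<^sup>2)"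
    using cross_moment[OF x] unfolding An Bn by (simp add: field_simps)
  have "Determinant.det (N * M) = Determinant.det N * Determinant.det M"
    by (rule det_mult[of _ t]) (auto simp: N_def M_def)
  moreover have "N * M = Matrix.mat t t (\<lambda>(k, l). fps_nth (P * A ^ (t - 1 - k) * B ^ k) l)"
  proof (rule eq_matI, goal_cases)
    case (1 k l)
    hence kl: "k < t" "l < t" by auto
    have tf: "theta_family x (2 * int t) 1 (theta_basis x (t - 1) k)"
      using theta_family_theta_basis[OF x, of k "t - 1"] kl by simp
    have "(N * M) $$ (k, l) = (\<Sum>i<t. theta_basis x (t - 1) k (int i) * class_sum x t i (\<lambda>n. (of_int n + 1 / 2) ^ (2 * l))) / fact (2 * l)"
      using kl by (simp add: N_def M_def scalar_prod_def lessThan_atLeast0 sum_divide_distrib)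
    also have "\<dots> = infsum (\<lambda>n. theta_basis x (t - 1) k n * (of_int n + 1 / 2) ^ (2 * l)) UNIV / fact (2 * l)"
      unfolding class_sum_def
      by (subst theta_family_decompose[symmetric, OF x(1) t tf rapid_moment[OF rapid_theta_basis[OF x]]]) simp
    also have "\<dots> = fps_nth (even_part (jet 1 (theta_basis x (t - 1) k))) l"
      by (simp add: jet_def even_part_def)
    also have "even_part (jet 1 (theta_basis x (t - 1) k)) = P * A ^ (t - 1 - k) * B ^ k"
    proof -
      note o1 = jet_odd[OF theta_family_full_coeff[OF x(1)]] and o2 = jet_odd[OF theta_family_odd_coeff[OF x(1)]] and o3 = jet_odd[OF theta_family_even_coeff[OF x(1)]]
      have "jet 1 (theta_basis x (t - 1) k) = jet 1 (full_coeff x) * (jet 0 (odd_coeff x) ^ (t - 1 - k) * jet 0 (even_coeff x) ^ k)"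
        by (simp only: jet_theta_basis[OF x] mult.assoc)
      also have "even_part \<dots> = P * (A ^ (t - 1 - k) * B ^ k)"
        unfolding P_def A_def B_def
      proof -
        have "even_part (jet 1 (full_coeff x) * g) = even_part (jet 1 (full_coeff x)) * even_part g" for g
          by (rule even_part_mult) (rule o1)
        moreover have "even_part (jet 0 (odd_coeff x) ^ n * g) = even_part (jet 0 (odd_coeff x) ^ n) * even_part g" for n g
          by (rule even_part_mult) (rule odd_coeff_power[OF o2])
        moreover have "even_part (jet 0 (odd_coeff x) ^ n) = even_part (jet 0 (odd_coeff x)) ^ n" for n
          by (rule even_part_power) (rule o2)
        moreover have "even_part (jet 0 (even_coeff x) ^ n) = even_part (jet 0 (even_coeff x)) ^ n" for n
          by (rule even_part_power) (rule o3)
        ultimately show "even_part (jet 1 (full_coeff x) * (jet 0 (odd_coeff x) ^ (t - 1 - k) * jet 0 (even_coeff x) ^ k)) =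
          even_part (jet 1 (full_coeff x)) * (even_part (jet 0 (odd_coeff x)) ^ (t - 1 - k) * even_part (jet 0 (even_coeff x)) ^ k)"
          by simp
      qed
      finally show ?thesis by (simp only: mult.assoc)
    qed
    finally show ?case using kl by simp
  qed (auto simp: N_def M_def)
  ultimately have "Determinant.det N * Determinant.det M = fps_nth P 0 ^ t * (- ((moment (cross_coeff x) 1)\<^sup>2)) ^ (\<Sum>m<t. m)"
    using det_fps_coeffs[of A t P B, unfolded det] a0 by (simp add: An(1))
  thus ?thesis by (simp add: N_def M_def wronskian_def Pn)
qed

subsection \<open>Evaluation at the roots of -1\<close>

definition euler :: "complex \<Rightarrow> complex" where
  "euler q = lim (qpoch q)"

lemma euler: 
  assumes "norm q < 1"
  shows "qpoch q \<longlonglongrightarrow> euler q" "euler q \<noteq> 0"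
  using qpoch_tendsto[OF assms] limI unfolding euler_def by metis+

lemma prod_lessThan_double:
  fixes f :: "nat \<Rightarrow> 'a :: comm_monoid_mult"
  shows "(\<Prod>m<2*n. f m) = (\<Prod>m<n. f (2 * m) * f (2 * m + 1))"
  by (induction n) (auto simp: mult_ac)

lemma filterlim_mult_nat: "c > 0 \<Longrightarrow> filterlim (\<lambda>N::nat. c * N) at_top sequentially"
  by (rule mult_nat_left_at_top)

lemma odd_factor_limit:
  assumes x: "norm x < 1"
  shows "(\<lambda>M. \<Prod>m<M. 1 - x ^ (2 * m + 1)) \<longlonglongrightarrow> euler x / euler (x\<^sup>2)"
proof -
  have n: "norm (x\<^sup>2) < 1" using x by (simp add: norm_power power_less_one_iff)
  have eq: "qpoch x (2 * M) / qpoch (x\<^sup>2) M = (\<Prod>m<M. 1 - x ^ (2 * m + 1))" for M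
  proof -
    have "qpoch x (2 * M) = (\<Prod>m<M. (1 - x ^ (2 * m + 1)) * (1 - x ^ (2 * m + 2)))"
      unfolding qpoch_def prod_lessThan_double by simp
    also have "\<dots> = (\<Prod>m<M. 1 - x ^ (2 * m + 1)) * qpoch (x\<^sup>2) M"
    proof -
      have "x ^ (2 * m + 2) = (x\<^sup>2) ^ Suc m" for m
        by (simp add: power_mult[symmetric] del: power_Suc)
      thus ?thesis unfolding qpoch_def prod.distrib by simp
    qed
    finally show ?thesis using qpoch_nonzero[OF n] by simp
  qed
  have "(\<lambda>M. qpoch x (2 * M) / qpoch (x\<^sup>2) M) \<longlonglongrightarrow> euler x / euler (x\<^sup>2)"
    by (intro tendsto_divide filterlim_compose[OF euler(1)[OF x] filterlim_mult_nat] euler n) auto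
  thus ?thesis by (simp only: eq)
qed

text \<open>With the boundary factor 1 + 1 / z removed, the k-th factor is a function of u = q^(k +
  1) alone. Products of several theta functions can then be compared factor by factor, as identities
  in u.\<close>

lemma theta_limit_shifted:
  assumes q: "norm q < 1" "q \<noteq> 0" and z: "z \<noteq> 0" "z \<noteq> -1"
  shows "(\<lambda>N. \<Prod>k<N. (1 - q ^ Suc k) * (1 + z * q ^ Suc k) * (1 + q ^ Suc k / z)) \<longlonglongrightarrow> theta q z / (1 + 1 / z)"
proof -
  define F where "F N = (\<Prod>k<N. (1 - q ^ Suc k) * (1 + z * q ^ Suc k) * (1 + q ^ k / z))" for N
  define G where "G N = (\<Prod>k<N. (1 - q ^ Suc k) * (1 + z * q ^ Suc k) * (1 + q ^ Suc k / z))" for N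
  have tel: "(\<Prod>k<N. 1 + q ^ k / z) * (1 + q ^ N / z) = (1 + 1 / z) * (\<Prod>k<N. 1 + q ^ Suc k / z)" for N
    using prod.lessThan_Suc_shift[of "\<lambda>k. 1 + q ^ k / z" N] by simp
  have FG: "F N * (1 + q ^ N / z) = (1 + 1 / z) * G N" for N
  proof -
    have "F N * (1 + q ^ N / z) = (\<Prod>k<N. 1 - q ^ Suc k) * (\<Prod>k<N. 1 + z * q ^ Suc k) * ((\<Prod>k<N. 1 + q ^ k / z) * (1 + q ^ N / z))"
      unfolding F_def prod.distrib by (simp only: mult.assoc)
    also have "\<dots> = (1 + 1 / z) * G N"
      unfolding tel G_def prod.distrib by (simp only: mult_ac)
    finally show ?thesis .
  qed
  have nz: "1 + 1 / z \<noteq> 0" using z by (simp add: field_simps add_eq_0_iff)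
  have "(\<lambda>N. q ^ N) \<longlonglongrightarrow> 0" using q by (intro LIMSEQ_power_zero)
  hence "(\<lambda>N. F N * (1 + q ^ N / z) / (1 + 1 / z)) \<longlonglongrightarrow> theta q z * (1 + 0 / z) / (1 + 1 / z)"
    unfolding F_def by (intro tendsto_mult tendsto_divide tendsto_add tendsto_const jacobi_triple_product[OF q z(1)] nz z)
  moreover have "F N * (1 + q ^ N / z) / (1 + 1 / z) = G N" for N
    unfolding FG using nz by simp
  ultimately show ?thesis by (simp add: G_def)
qed

lemma theta_one:
  assumes x: "norm x < 1" "x \<noteq> 0"
  shows "theta x 1 = 2 * euler (x\<^sup>2) ^ 2 / euler x"
proof -
  have n: "norm (x\<^sup>2) < 1" using x by (simp add: norm_power power_less_one_iff)
  have "(\<lambda>N. \<Prod>k<N. (1 - x ^ Suc k) * (1 + 1 * x ^ Suc k) * (1 + x ^ Suc k / 1)) \<longlonglongrightarrow> theta x 1 / (1 + 1 / 1)"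
    by (rule theta_limit_shifted) (use x in auto)
  moreover have "(\<Prod>k<N. (1 - x ^ Suc k) * (1 + 1 * x ^ Suc k) * (1 + x ^ Suc k / 1)) = qpoch (x\<^sup>2) N ^ 2 / qpoch x N" for N
  proof -
    have e: "1 - (x\<^sup>2) ^ Suc k = (1 - x ^ Suc k) * (1 + x ^ Suc k)" for k
      by (simp add: algebra_simps power2_eq_square power_mult_distrib)
    define P where "P = (\<Prod>k<N. 1 + x ^ Suc k)"
    have "qpoch (x\<^sup>2) N = qpoch x N * P" by (simp only: qpoch_def P_def e prod.distrib)
    moreover have "(\<Prod>k<N. (1 - x ^ Suc k) * (1 + 1 * x ^ Suc k) * (1 + x ^ Suc k / 1)) = qpoch x N * P * P"
      by (simp only: qpoch_def P_def prod.distrib mult_1 div_by_1)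
    ultimately have "qpoch (x\<^sup>2) N ^ 2 = qpoch x N * (\<Prod>k<N. (1 - x ^ Suc k) * (1 + 1 * x ^ Suc k) * (1 + x ^ Suc k / 1))"
      by (simp only: power2_eq_square mult_ac)
    thus ?thesis using qpoch_nonzero[OF x(1)] by simp
  qed
  ultimately have "(\<lambda>N. qpoch (x\<^sup>2) N ^ 2 / qpoch x N) \<longlonglongrightarrow> theta x 1 / 2" by simp
  moreover have "(\<lambda>N. qpoch (x\<^sup>2) N ^ 2 / qpoch x N) \<longlonglongrightarrow> euler (x\<^sup>2) ^ 2 / euler x"
    by (intro tendsto_intros euler n x)
  ultimately have "theta x 1 / 2 = euler (x\<^sup>2) ^ 2 / euler x" by (rule LIMSEQ_unique)
  thus ?thesis by (simp add: field_simps)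
qed

lemma moment_cross_coeff_1_euler:
  assumes x: "norm x < 1" "x \<noteq> 0"
  shows "moment (cross_coeff x) 1 = euler (x\<^sup>2) ^ 3"
proof -
  have n: "norm (x\<^sup>2) < 1" using x by (simp add: norm_power power_less_one_iff)
  have "(\<lambda>N. qpoch (x\<^sup>2) N ^ 3) \<longlonglongrightarrow> moment (cross_coeff x) 1"
    using moment_cross_coeff_1 x by (simp add: qpoch_def)
  moreover have "(\<lambda>N. qpoch (x\<^sup>2) N ^ 3) \<longlonglongrightarrow> euler (x\<^sup>2) ^ 3" by (intro tendsto_intros euler n)
  ultimately show ?thesis by (rule LIMSEQ_unique)
qed

section \<open>Products over the roots of -1 in the upper half-plane\<close>

definition antiroot :: "nat \<Rightarrow> nat \<Rightarrow> complex" where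
  "antiroot t j = cis (pi * (2 * real j + 1) / (2 * real t))"

lemma antiroot_nonzero [simp]: "antiroot t j \<noteq> 0"
  by (simp add: antiroot_def)

lemma antiroot_power: "t > 0 \<Longrightarrow> antiroot t j ^ (2 * t) = -1"
proof -
  assume t: "t > 0"
  have "antiroot t j ^ (2 * t) = cis (real (2 * t) * (pi * (2 * real j + 1) / (2 * real t)))"
    unfolding antiroot_def by (rule Complex.DeMoivre)
  also have "real (2 * t) * (pi * (2 * real j + 1) / (2 * real t)) = pi + 2 * pi * real j"
    using t by (simp add: field_simps)
  also have "cis \<dots> = cis pi" using cis_multiple_2pi[of "real j"] by (simp add: cis_mult[symmetric])
  finally show ?thesis by simp
qed

lemma antiroot_angle:
  assumes "j < t"
  shows "0 < pi * (2 * real j + 1) / (2 * real t)" "pi * (2 * real j + 1) / (2 * real t) < pi"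
proof -
  have "2 * real j + 1 < 2 * real t" using assms by linarith
  hence "pi * (2 * real j + 1) < pi * (2 * real t)" by (intro mult_strict_left_mono) auto
  thus "pi * (2 * real j + 1) / (2 * real t) < pi" using assms by (simp add: pos_divide_less_eq)
qed (use assms in auto)

lemma Im_antiroot: "j < t \<Longrightarrow> Im (antiroot t j) > 0"
  unfolding antiroot_def cis.sel by (intro sin_gt_zero antiroot_angle)

lemma antiroot_inj:
  assumes "i < t" "j < t" "antiroot t i = antiroot t j"
  shows "i = j"
proof -
  have "cos (pi * (2 * real i + 1) / (2 * real t)) = cos (pi * (2 * real j + 1) / (2 * real t))"
    using assms(3) by (metis antiroot_def cis.sel(1))
  hence "pi * (2 * real i + 1) / (2 * real t) = pi * (2 * real j + 1) / (2 * real t)"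
    by (rule cos_inj_pi[OF less_imp_le[OF antiroot_angle(1)[OF assms(1)]] less_imp_le[OF antiroot_angle(2)[OF assms(1)]]
          less_imp_le[OF antiroot_angle(1)[OF assms(2)]] less_imp_le[OF antiroot_angle(2)[OF assms(2)]]])
  hence "2 * real i + 1 = 2 * real j + 1" using assms(1) by (simp del: add_left_cancel add_right_cancel)
  thus ?thesis by simp
qed

lemma Im_inverse_antiroot: "j < t \<Longrightarrow> Im (inverse (antiroot t j)) < 0"
  unfolding antiroot_def cis_inverse cis.sel sin_minus neg_less_0_iff_less by (intro sin_gt_zero antiroot_angle)

lemma antiroot_inverse_neq: "i < t \<Longrightarrow> j < t \<Longrightarrow> antiroot t i \<noteq> inverse (antiroot t j)"
  using Im_antiroot[of i t] Im_inverse_antiroot[of j t] by force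

text \<open>Both sides are monic of degree 2 * t and vanish at the chosen points and their inverses,
  which are 2 * t distinct numbers as they lie in opposite half-planes.\<close>

lemma antiroot_poly:
  assumes t: "t > 0"
  shows "(\<Prod>j<t. (X - antiroot t j) * (X - inverse (antiroot t j))) = X ^ (2 * t) + 1"
proof -
  define p where "p = (\<Prod>j<t. [:- antiroot t j, 1:] * [:- inverse (antiroot t j), 1:])"
  define q where "q = Polynomial.monom (1::complex) (2 * t) + 1"
  define A where "A = antiroot t ` {..<t} \<union> (\<lambda>j. inverse (antiroot t j)) ` {..<t}"
  have card: "card A = 2 * t"
  proof -
    have "card (antiroot t ` {..<t}) = t" by (subst card_image) (auto intro: inj_onI antiroot_inj)
    moreover have "card ((\<lambda>j. inverse (antiroot t j)) ` {..<t}) = t"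
      by (subst card_image) (auto intro!: inj_onI antiroot_inj)
    moreover have "antiroot t ` {..<t} \<inter> (\<lambda>j. inverse (antiroot t j)) ` {..<t} = {}"
      using antiroot_inverse_neq by auto
    ultimately show ?thesis unfolding A_def by (subst card_Un_disjoint) auto
  qed
  have degf: "degree ([:- antiroot t j, 1:] * [:- inverse (antiroot t j), 1:]) = 2" for j
    by (subst degree_mult_eq) auto
  have degp: "degree p = 2 * t"
    unfolding p_def by (subst degree_prod_eq_sum_degree) (auto simp only: degf sum_constant card_lessThan mult.commute, auto)
  have lp: "coeff p (2 * t) = 1"
  proof -
    have "lead_coeff p = (\<Prod>j<t. lead_coeff ([:- antiroot t j, 1:] * [:- inverse (antiroot t j), 1:]))"
      unfolding p_def by (rule lead_coeff_prod)
    also have "\<dots> = 1" unfolding lead_coeff_mult by simp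
    finally show ?thesis by (simp add: degp)
  qed
  have pl: "poly [:- a, 1:] z = z - a" for a z :: complex by simp
  have pp: "poly p z = (\<Prod>j<t. (z - antiroot t j) * (z - inverse (antiroot t j)))" for z
    by (simp only: p_def poly_prod poly_mult pl)
  have "p = q"
  proof (rule poly_eqI_degree_lead_coeff[where n = "2 * t" and A = A])
    show "coeff p (2 * t) = coeff q (2 * t)" using lp t by (simp add: q_def)
    show "2 * t \<le> card A" by (simp add: card)
    show "degree p \<le> 2 * t" by (simp add: degp)
    show "degree q \<le> 2 * t" unfolding q_def by (intro degree_add_le degree_monom_le) auto
    show "poly p z = poly q z" if "z \<in> A" for z
    proof -
      have "z ^ (2 * t) = -1" using that antiroot_power[OF t] by (auto simp: A_def power_inverse)
      hence "poly q z = 0" by (simp add: q_def poly_monom)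
      moreover have "poly p z = 0" unfolding pp using that by (intro prod_zero) (auto simp: A_def)
      ultimately show ?thesis by simp
    qed
  qed
  hence "poly p X = poly q X" by simp
  thus ?thesis unfolding pp by (simp add: q_def poly_monom)
qed

lemma antiroot_prod:
  assumes t: "t > 0"
  shows "(\<Prod>j<t. (1 - Y * antiroot t j) * (1 - Y / antiroot t j)) = 1 + Y ^ (2 * t)"
proof (cases "Y = 0")
  case True
  thus ?thesis using t by simp
next
  case False
  have "(\<Prod>j<t. (1 - Y * antiroot t j) * (1 - Y / antiroot t j))
      = (\<Prod>j<t. Y ^ 2 * ((1 / Y - antiroot t j) * (1 / Y - inverse (antiroot t j))))"
    using False by (intro prod.cong refl) (simp add: field_simps power2_eq_square)
  also have "\<dots> = Y ^ (2 * t) * ((1 / Y) ^ (2 * t) + 1)"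
    unfolding prod.distrib[of "\<lambda>_. Y ^ 2"] antiroot_poly[OF t] by (simp add: power_mult)
  also have "\<dots> = 1 + Y ^ (2 * t)" using False by (simp add: field_simps)
  finally show ?thesis .
qed

lemma prod_square_symmetric:
  fixes f :: "nat \<Rightarrow> nat \<Rightarrow> 'a :: comm_monoid_mult"
  assumes "\<And>i j. f i j = f j i"
  shows "(\<Prod>i<t. \<Prod>j<t. f i j) = (\<Prod>j<t. \<Prod>i<j. f i j) ^ 2 * (\<Prod>i<t. f i i)"
proof (induction t)
  case (Suc t)
  have "(\<Prod>i<Suc t. \<Prod>j<Suc t. f i j) = (\<Prod>i<t. \<Prod>j<t. f i j) * (\<Prod>i<t. f i t) * (\<Prod>j<t. f t j) * f t t"
    unfolding prod.lessThan_Suc prod.distrib by (simp only: mult_ac)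
  also have "(\<Prod>j<t. f t j) = (\<Prod>i<t. f i t)" using assms by (intro prod.cong refl) auto
  finally show ?case unfolding Suc prod.lessThan_Suc power2_eq_square by (simp only: mult_ac)
qed auto

text \<open>The product of 1 - y * z^a * w^b over the four choices a, b = 1, -1. It is symmetric in
  z and w, which allows completing a product over pairs i < j to a full square of indices.\<close>

definition quad :: "complex \<Rightarrow> complex \<Rightarrow> complex \<Rightarrow> complex" where
  "quad y z w = (1 - y * (z * w)) * (1 - y / (z * w)) * ((1 - y * (z / w)) * (1 - y / (z / w)))"

text \<open>The product over all ordered pairs equals the squared product over i < j times the
  diagonal. Each row is evaluated by \<open>antiroot_prod\<close> and does not depend on i, as the 2
  * t-th power of the point is -1. On the diagonal, y = u^2 lets 1 - y * z^2 split into (1 - u * z)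
  * (1 + u * z).\<close>

lemma quad_antiroot:
  assumes t: "t > 0"
  shows "(\<Prod>j<t. \<Prod>i<j. quad (u\<^sup>2) (antiroot t i) (antiroot t j)) ^ 2 * ((1 + u ^ (2 * t)) ^ 2 * (1 - u\<^sup>2) ^ (2 * t))
       = (1 - u ^ (4 * t)) ^ (2 * t)"
proof -
  define y where "y = u\<^sup>2"
  have sym: "quad y z w = quad y w z" for z w
    by (simp add: quad_def mult_ac)
  have diag: "(\<Prod>i<t. quad y (antiroot t i) (antiroot t i)) = (1 + u ^ (2 * t)) ^ 2 * (1 - u\<^sup>2) ^ (2 * t)"
  proof -
    have "quad y (antiroot t i) (antiroot t i) = ((1 - u * antiroot t i) * (1 - u / antiroot t i)) * ((1 - (- u) * antiroot t i) * (1 - (- u) / antiroot t i)) * ((1 - u\<^sup>2) * (1 - u\<^sup>2))" for i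
      by (simp add: quad_def y_def field_simps power2_eq_square)
    hence "(\<Prod>i<t. quad y (antiroot t i) (antiroot t i)) = (1 + u ^ (2 * t)) * (1 + (- u) ^ (2 * t)) * ((1 - u\<^sup>2) * (1 - u\<^sup>2)) ^ t"
      by (simp only: prod.distrib[of "\<lambda>i. _ i * _ i" "\<lambda>i. (1 - u\<^sup>2) * (1 - u\<^sup>2)"] prod.distrib[of "\<lambda>i. (1 - u * antiroot t i) * (1 - u / antiroot t i)"] antiroot_prod[OF t] prod_constant card_lessThan)
    also have "(- u) ^ (2 * t) = u ^ (2 * t)" by simp
    finally show ?thesis by (simp only: power2_eq_square power_mult)
  qed
  have row: "(\<Prod>j<t. quad y (antiroot t i) (antiroot t j)) = (1 - u ^ (4 * t)) ^ 2" for i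
  proof -
    have "(\<Prod>j<t. quad y (antiroot t i) (antiroot t j)) = (\<Prod>j<t. ((1 - (y * antiroot t i) * antiroot t j) * (1 - (y * antiroot t i) / antiroot t j)) * ((1 - (y / antiroot t i) * antiroot t j) * (1 - (y / antiroot t i) / antiroot t j)))"
      by (intro prod.cong refl) (simp add: quad_def field_simps)
    also have "\<dots> = (1 + (y * antiroot t i) ^ (2 * t)) * (1 + (y / antiroot t i) ^ (2 * t))"
      by (simp only: prod.distrib[of "\<lambda>j. (1 - (y * antiroot t i) * antiroot t j) * (1 - (y * antiroot t i) / antiroot t j)"] antiroot_prod[OF t])
    also have "\<dots> = (1 - y ^ (2 * t)) ^ 2"
      by (simp add: power_mult_distrib power_divide antiroot_power[OF t] power2_eq_square)
    also have "y ^ (2 * t) = u ^ (4 * t)" by (simp add: y_def flip: power_mult)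
    finally show ?thesis .
  qed
  have "(\<Prod>i<t. \<Prod>j<t. quad y (antiroot t i) (antiroot t j)) = (\<Prod>j<t. \<Prod>i<j. quad y (antiroot t i) (antiroot t j)) ^ 2 * (\<Prod>i<t. quad y (antiroot t i) (antiroot t i))"
    by (rule prod_square_symmetric) (rule sym)
  also have "(\<Prod>i<t. \<Prod>j<t. quad y (antiroot t i) (antiroot t j)) = ((1 - u ^ (4 * t)) ^ 2) ^ t"
    by (simp only: row prod_constant card_lessThan)
  also have "((1 - u ^ (4 * t)) ^ 2) ^ t = (1 - u ^ (4 * t)) ^ (2 * t)" by (rule power_mult[symmetric])
  finally show ?thesis unfolding y_def diag[unfolded y_def] by (simp only:)
qed

text \<open>Collects what is free of x: the boundary factors removed in
  \<open>theta_limit_shifted\<close> and the factor z of the addition formula.\<close>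

definition antiroot_const :: "nat \<Rightarrow> complex" where
  "antiroot_const t = (\<Prod>j<t. 1 + 1 / antiroot t j) *
     (\<Prod>j<t. \<Prod>i<j. antiroot t i * ((1 - 1 / (antiroot t i * antiroot t j)) * (1 - 1 / (antiroot t i / antiroot t j))))"

lemma antiroot_neq_minus_one: "j < t \<Longrightarrow> antiroot t j \<noteq> -1"
  using Im_antiroot[of j t] by force

lemma antiroot_mult_neq_one: "i < t \<Longrightarrow> j < t \<Longrightarrow> antiroot t i * antiroot t j \<noteq> 1"
  using antiroot_inverse_neq[of i t j] by (metis inverse_unique mult.commute)

lemma antiroot_div_neq_one: "i < j \<Longrightarrow> j < t \<Longrightarrow> antiroot t i / antiroot t j \<noteq> 1"
  using antiroot_inj[of i t j] by force

lemma antiroot_const_nonzero: "antiroot_const t \<noteq> 0"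
proof -
  have "1 + 1 / antiroot t j \<noteq> 0" if "j < t" for j
    using antiroot_neq_minus_one[OF that] by (simp add: field_simps add_eq_0_iff)
  moreover have "1 - 1 / (antiroot t i * antiroot t j) \<noteq> 0" if "i < j" "j < t" for i j
    using antiroot_mult_neq_one[of i t j] that by (simp add: field_simps)
  moreover have "1 - 1 / (antiroot t i / antiroot t j) \<noteq> 0" if "i < j" "j < t" for i j
    using antiroot_div_neq_one[OF that] by (simp add: field_simps)
  ultimately show ?thesis by (auto simp: antiroot_const_def)
qed

text \<open>Up to \<open>antiroot_const\<close>, X is the limit of products of
  \<open>G (x ^ Suc k)\<close>, where \<open>G\<close> gathers the factors of all theta products at
  one step. It is therefore enough to evaluate the square of \<open>G u\<close>
  algebraically.\<close>

lemma antiroot_side_limit: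
  assumes x: "norm x < 1" "x \<noteq> 0" and t: "t > 0"
  defines "X \<equiv> ((\<Prod>j<t. laurent (full_coeff x) (antiroot t j))
       * (\<Prod>j<t. \<Prod>i<j. laurent (odd_coeff x) (antiroot t i) * laurent (even_coeff x) (antiroot t j) - laurent (even_coeff x) (antiroot t i) * laurent (odd_coeff x) (antiroot t j)))"
  shows "X ^ 2 * euler (x\<^sup>2) ^ (2 * t) = antiroot_const t ^ 2 * euler x ^ (2 * t) * euler (x\<^sup>2) ^ (2 * (t * (t - 1))) * euler (x ^ (4 * t)) ^ (2 * t)"
proof -
  define G where "G u = (\<Prod>j<t. (1 - u) * (1 + antiroot t j * u) * (1 + u / antiroot t j))
     * (\<Prod>j<t. \<Prod>i<j. ((1 - u\<^sup>2) * (1 + (- (antiroot t i * antiroot t j)) * u\<^sup>2) * (1 + u\<^sup>2 / (- (antiroot t i * antiroot t j))))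
         * ((1 - u\<^sup>2) * (1 + (- (antiroot t i / antiroot t j)) * u\<^sup>2) * (1 + u\<^sup>2 / (- (antiroot t i / antiroot t j)))))" for u
  have n: "norm (x\<^sup>2) < 1" "x\<^sup>2 \<noteq> 0" using x by (auto simp: norm_power power_less_one_iff)
  have n4: "norm (x ^ (4 * t)) < 1" using x t by (simp add: norm_power power_less_one_iff)
  have sq: "(x\<^sup>2) ^ k = (x ^ k)\<^sup>2" for k by (simp flip: power_mult add: mult.commute)
  have lim: "(\<lambda>N. \<Prod>k<N. G (x ^ Suc k)) \<longlonglongrightarrow> X / antiroot_const t"
  proof -
    have "(\<lambda>N. (\<Prod>j<t. \<Prod>k<N. (1 - x ^ Suc k) * (1 + antiroot t j * x ^ Suc k) * (1 + x ^ Suc k / antiroot t j))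
      * (\<Prod>j<t. \<Prod>i<j. (\<Prod>k<N. (1 - (x\<^sup>2) ^ Suc k) * (1 + (- (antiroot t i * antiroot t j)) * (x\<^sup>2) ^ Suc k) * (1 + (x\<^sup>2) ^ Suc k / (- (antiroot t i * antiroot t j))))
         * (\<Prod>k<N. (1 - (x\<^sup>2) ^ Suc k) * (1 + (- (antiroot t i / antiroot t j)) * (x\<^sup>2) ^ Suc k) * (1 + (x\<^sup>2) ^ Suc k / (- (antiroot t i / antiroot t j))))))
     \<longlonglongrightarrow> (\<Prod>j<t. theta x (antiroot t j) / (1 + 1 / antiroot t j))
      * (\<Prod>j<t. \<Prod>i<j. (theta (x\<^sup>2) (- (antiroot t i * antiroot t j)) / (1 + 1 / (- (antiroot t i * antiroot t j)))) *
                        (theta (x\<^sup>2) (- (antiroot t i / antiroot t j)) / (1 + 1 / (- (antiroot t i / antiroot t j)))))"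
    proof (intro tendsto_mult tendsto_prod theta_limit_shifted x n antiroot_nonzero)
      fix j assume "j \<in> {..<t}"
      thus "antiroot t j \<noteq> -1" by (auto dest: antiroot_neq_minus_one)
    next
      fix i j assume ij: "j \<in> {..<t}" "i \<in> {..<j}"
      show "- (antiroot t i * antiroot t j) \<noteq> 0" "- (antiroot t i / antiroot t j) \<noteq> 0" by auto
      show "- (antiroot t i * antiroot t j) \<noteq> -1" using antiroot_mult_neq_one[of i t j] ij by auto
      show "- (antiroot t i / antiroot t j) \<noteq> -1" using antiroot_div_neq_one[of i j t] ij by auto
    qed
    also have "(\<lambda>N. (\<Prod>j<t. \<Prod>k<N. (1 - x ^ Suc k) * (1 + antiroot t j * x ^ Suc k) * (1 + x ^ Suc k / antiroot t j))
      * (\<Prod>j<t. \<Prod>i<j. (\<Prod>k<N. (1 - (x\<^sup>2) ^ Suc k) * (1 + (- (antiroot t i * antiroot t j)) * (x\<^sup>2) ^ Suc k) * (1 + (x\<^sup>2) ^ Suc k / (- (antiroot t i * antiroot t j))))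
         * (\<Prod>k<N. (1 - (x\<^sup>2) ^ Suc k) * (1 + (- (antiroot t i / antiroot t j)) * (x\<^sup>2) ^ Suc k) * (1 + (x\<^sup>2) ^ Suc k / (- (antiroot t i / antiroot t j))))))
       = (\<lambda>N. \<Prod>k<N. G (x ^ Suc k))"
    proof (rule ext)
      fix N
      have sw: "(\<Prod>j<t. \<Prod>i<j. \<Prod>k<N. f i j k) = (\<Prod>k<N. \<Prod>j<t. \<Prod>i<j. f i j k)" for f :: "nat \<Rightarrow> nat \<Rightarrow> nat \<Rightarrow> complex"
      proof -
        have "(\<Prod>j<t. \<Prod>i<j. \<Prod>k<N. f i j k) = (\<Prod>j<t. \<Prod>k<N. \<Prod>i<j. f i j k)"
          by (rule prod.cong[OF refl]) (rule prod.swap)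
        also have "\<dots> = (\<Prod>k<N. \<Prod>j<t. \<Prod>i<j. f i j k)" by (rule prod.swap)
        finally show ?thesis .
      qed
      show "(\<Prod>j<t. \<Prod>k<N. (1 - x ^ Suc k) * (1 + antiroot t j * x ^ Suc k) * (1 + x ^ Suc k / antiroot t j))
      * (\<Prod>j<t. \<Prod>i<j. (\<Prod>k<N. (1 - (x\<^sup>2) ^ Suc k) * (1 + (- (antiroot t i * antiroot t j)) * (x\<^sup>2) ^ Suc k) * (1 + (x\<^sup>2) ^ Suc k / (- (antiroot t i * antiroot t j))))
         * (\<Prod>k<N. (1 - (x\<^sup>2) ^ Suc k) * (1 + (- (antiroot t i / antiroot t j)) * (x\<^sup>2) ^ Suc k) * (1 + (x\<^sup>2) ^ Suc k / (- (antiroot t i / antiroot t j)))))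
        = (\<Prod>k<N. G (x ^ Suc k))"
        unfolding prod.distrib[of _ _ "{..<N}", symmetric] sw G_def sq
        by (subst prod.swap) (simp only: prod.distrib[of _ _ "{..<N}", symmetric])
    qed
    also have "(\<Prod>j<t. theta x (antiroot t j) / (1 + 1 / antiroot t j))
      * (\<Prod>j<t. \<Prod>i<j. (theta (x\<^sup>2) (- (antiroot t i * antiroot t j)) / (1 + 1 / (- (antiroot t i * antiroot t j)))) *
                        (theta (x\<^sup>2) (- (antiroot t i / antiroot t j)) / (1 + 1 / (- (antiroot t i / antiroot t j)))))
      = X / antiroot_const t"
    proof -
      have "laurent (odd_coeff x) (antiroot t i) * laurent (even_coeff x) (antiroot t j) - laurent (even_coeff x) (antiroot t i) * laurent (odd_coeff x) (antiroot t j)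
          = antiroot t i * ((1 - 1 / (antiroot t i * antiroot t j)) * (1 - 1 / (antiroot t i / antiroot t j))) *
            ((theta (x\<^sup>2) (- (antiroot t i * antiroot t j)) / (1 + 1 / (- (antiroot t i * antiroot t j)))) *
             (theta (x\<^sup>2) (- (antiroot t i / antiroot t j)) / (1 + 1 / (- (antiroot t i / antiroot t j)))))" if ij: "i < j" "j < t" for i j
      proof -
        define p q where "p = antiroot t i * antiroot t j" and "q = antiroot t i / antiroot t j"
        have pq: "p \<noteq> 0" "q \<noteq> 0" "p \<noteq> 1" "q \<noteq> 1"
          using antiroot_mult_neq_one[of i t j] antiroot_div_neq_one[OF ij] ij by (auto simp: p_def q_def)
        have e: "1 + 1 / (- p) = 1 - 1 / p" "1 + 1 / (- q) = 1 - 1 / q" and nz: "1 - 1 / p \<noteq> 0" "1 - 1 / q \<noteq> 0"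
          using pq by (auto simp: field_simps)
        have gen: "a * b * c = a * (P * Q) * ((b / P) * (c / Q))" if "P \<noteq> 0" "Q \<noteq> 0" for a b c P Q :: complex
          using that by (simp add: field_simps)
        show ?thesis
          unfolding cross_laurent[OF x(2,1) antiroot_nonzero antiroot_nonzero] p_def[symmetric] q_def[symmetric] e
          by (rule gen[OF nz])
      qed
      hence "(\<Prod>j<t. \<Prod>i<j. laurent (odd_coeff x) (antiroot t i) * laurent (even_coeff x) (antiroot t j) - laurent (even_coeff x) (antiroot t i) * laurent (odd_coeff x) (antiroot t j))
         = (\<Prod>j<t. \<Prod>i<j. antiroot t i * ((1 - 1 / (antiroot t i * antiroot t j)) * (1 - 1 / (antiroot t i / antiroot t j)))) *
           (\<Prod>j<t. \<Prod>i<j. (theta (x\<^sup>2) (- (antiroot t i * antiroot t j)) / (1 + 1 / (- (antiroot t i * antiroot t j)))) *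
             (theta (x\<^sup>2) (- (antiroot t i / antiroot t j)) / (1 + 1 / (- (antiroot t i / antiroot t j)))))"
        unfolding prod.distrib[symmetric] by (intro prod.cong refl) auto
      moreover have "(\<Prod>j<t. laurent (full_coeff x) (antiroot t j)) = (\<Prod>j<t. 1 + 1 / antiroot t j) * (\<Prod>j<t. theta x (antiroot t j) / (1 + 1 / antiroot t j))"
      proof -
        have "1 + 1 / antiroot t j \<noteq> 0" if "j < t" for j
          using antiroot_neq_minus_one[OF that] by (simp add: field_simps add_eq_0_iff)
        thus ?thesis unfolding prod.distrib[symmetric] laurent_full_coeff by (intro prod.cong refl) auto
      qed
      ultimately have "X = antiroot_const t * ((\<Prod>j<t. theta x (antiroot t j) / (1 + 1 / antiroot t j))
      * (\<Prod>j<t. \<Prod>i<j. (theta (x\<^sup>2) (- (antiroot t i * antiroot t j)) / (1 + 1 / (- (antiroot t i * antiroot t j)))) *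
                        (theta (x\<^sup>2) (- (antiroot t i / antiroot t j)) / (1 + 1 / (- (antiroot t i / antiroot t j))))))"
        unfolding X_def antiroot_const_def by (simp only: mult_ac)
      thus ?thesis using antiroot_const_nonzero[of t] by simp
    qed
    finally show ?thesis .
  qed
  \<comment> \<open>The power of 1 - u^2 on the left clears the diagonal factor of
    \<open>quad_antiroot\<close>.\<close>
  have Gsq: "G u ^ 2 * (1 - u\<^sup>2) ^ (2 * t) = (1 - u) ^ (2 * t) * (1 - u\<^sup>2) ^ (2 * (t * (t - 1))) * (1 - u ^ (4 * t)) ^ (2 * t)" for u
  proof -
    define H where "H = (\<Prod>j<t. \<Prod>i<j. quad (u\<^sup>2) (antiroot t i) (antiroot t j))"
    have 1: "(\<Prod>j<t. (1 - u) * (1 + antiroot t j * u) * (1 + u / antiroot t j)) = (1 - u) ^ t * (1 + u ^ (2 * t))"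
    proof -
      have "(\<Prod>j<t. (1 - u) * (1 + antiroot t j * u) * (1 + u / antiroot t j)) = (\<Prod>j<t. (1 - u) * ((1 - (- u) * antiroot t j) * (1 - (- u) / antiroot t j)))"
        by (intro prod.cong refl) (simp add: mult_ac)
      thus ?thesis unfolding prod.distrib[of "\<lambda>j. 1 - u"] antiroot_prod[OF t] by simp
    qed
    have 2: "(\<Prod>j<t. \<Prod>i<j. ((1 - u\<^sup>2) * (1 + (- (antiroot t i * antiroot t j)) * u\<^sup>2) * (1 + u\<^sup>2 / (- (antiroot t i * antiroot t j))))
         * ((1 - u\<^sup>2) * (1 + (- (antiroot t i / antiroot t j)) * u\<^sup>2) * (1 + u\<^sup>2 / (- (antiroot t i / antiroot t j))))) = (1 - u\<^sup>2) ^ (t * (t - 1)) * H"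
    proof -
      have "(\<Prod>j<t. \<Prod>i<j. ((1 - u\<^sup>2) * (1 + (- (antiroot t i * antiroot t j)) * u\<^sup>2) * (1 + u\<^sup>2 / (- (antiroot t i * antiroot t j))))
         * ((1 - u\<^sup>2) * (1 + (- (antiroot t i / antiroot t j)) * u\<^sup>2) * (1 + u\<^sup>2 / (- (antiroot t i / antiroot t j)))))
         = (\<Prod>j<t. \<Prod>i<j. ((1 - u\<^sup>2) * (1 - u\<^sup>2)) * quad (u\<^sup>2) (antiroot t i) (antiroot t j))"
      proof -
        have "((1 - u\<^sup>2) * (1 + (- p) * u\<^sup>2) * (1 + u\<^sup>2 / (- p))) * ((1 - u\<^sup>2) * (1 + (- q) * u\<^sup>2) * (1 + u\<^sup>2 / (- q)))
          = ((1 - u\<^sup>2) * (1 - u\<^sup>2)) * ((1 - u\<^sup>2 * p) * (1 - u\<^sup>2 / p) * ((1 - u\<^sup>2 * q) * (1 - u\<^sup>2 / q)))" for p q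
          by (simp add: mult_ac)
        thus ?thesis unfolding quad_def by (intro prod.cong refl)
      qed
      also have "\<dots> = (\<Prod>j<t. \<Prod>i<j. (1 - u\<^sup>2) * (1 - u\<^sup>2)) * H"
        unfolding H_def prod.distrib[symmetric] ..
      also have "(\<Prod>j<t. \<Prod>i<j. (1 - u\<^sup>2) * (1 - u\<^sup>2)) = (\<Prod>j<t. (1 - u\<^sup>2) ^ (t - 1))"
        by (rule prod_pairs_commute[of "\<lambda>_. 1 - u\<^sup>2"])
      also have "\<dots> = (1 - u\<^sup>2) ^ (t * (t - 1))" by (simp add: power_mult mult.commute[of t])
      finally show ?thesis .
    qed
    have "G u ^ 2 * (1 - u\<^sup>2) ^ (2 * t) = ((1 - u) ^ t) ^ 2 * ((1 - u\<^sup>2) ^ (t * (t - 1))) ^ 2 * (H ^ 2 * ((1 + u ^ (2 * t)) ^ 2 * (1 - u\<^sup>2) ^ (2 * t)))"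
      unfolding G_def 1 2 by (simp only: power_mult_distrib mult_ac)
    also have "H ^ 2 * ((1 + u ^ (2 * t)) ^ 2 * (1 - u\<^sup>2) ^ (2 * t)) = (1 - u ^ (4 * t)) ^ (2 * t)"
      unfolding H_def by (rule quad_antiroot[OF t])
    finally show ?thesis by (simp only: power_mult[symmetric] mult.commute[of _ 2])
  qed
  have eq: "(\<Prod>k<N. G (x ^ Suc k)) ^ 2 * qpoch (x\<^sup>2) N ^ (2 * t)
     = qpoch x N ^ (2 * t) * qpoch (x\<^sup>2) N ^ (2 * (t * (t - 1))) * qpoch (x ^ (4 * t)) N ^ (2 * t)" for N
  proof -
    have e4: "(x ^ (4 * t)) ^ Suc k = (x ^ Suc k) ^ (4 * t)" for k
      by (simp only: power_mult[symmetric] mult.commute)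
    show ?thesis
      unfolding qpoch_def prod_power_distrib prod.distrib[symmetric] sq e4 by (intro prod.cong refl Gsq)
  qed
  have "(\<lambda>N. (\<Prod>k<N. G (x ^ Suc k)) ^ 2 * qpoch (x\<^sup>2) N ^ (2 * t)) \<longlonglongrightarrow> (X / antiroot_const t) ^ 2 * euler (x\<^sup>2) ^ (2 * t)"
    by (intro tendsto_mult tendsto_power lim euler n)
  moreover have "(\<lambda>N. (\<Prod>k<N. G (x ^ Suc k)) ^ 2 * qpoch (x\<^sup>2) N ^ (2 * t)) \<longlonglongrightarrow>
     euler x ^ (2 * t) * euler (x\<^sup>2) ^ (2 * (t * (t - 1))) * euler (x ^ (4 * t)) ^ (2 * t)"
    unfolding eq by (intro tendsto_mult tendsto_power euler n x n4)
  ultimately have "(X / antiroot_const t) ^ 2 * euler (x\<^sup>2) ^ (2 * t)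
     = euler x ^ (2 * t) * euler (x\<^sup>2) ^ (2 * (t * (t - 1))) * euler (x ^ (4 * t)) ^ (2 * t)"
    by (rule LIMSEQ_unique)
  thus ?thesis using antiroot_const_nonzero[of t] by (simp add: power_divide field_simps)
qed

lemma prod_lessThan_add:
  fixes f :: "nat \<Rightarrow> 'a :: comm_monoid_mult"
  shows "(\<Prod>i<a+b. f i) = (\<Prod>i<a. f i) * (\<Prod>i<b. f (a + i))"
  by (induction b) (auto simp: mult.assoc)

text \<open>In the triple products over all i the exponents are 2 * m + 1 with m = 2 * t * k + t + i
  and m = 2 * t * k + t - 1 - i. Every m occurs exactly once, so the factors combine to the product
  over all odd exponents.\<close>

lemma theta_class_limit:
  assumes x: "norm x < 1" "x \<noteq> 0" and t: "t > 0"
  shows "(\<Prod>i<t. theta (x ^ (4 * t)) (- (x powi (2 * int i + 1 - 2 * int t))))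
    = euler (x ^ (4 * t)) ^ t * (euler x / euler (x\<^sup>2))"
proof -
  define q where "q = x ^ (4 * t)"
  have q: "norm q < 1" "q \<noteq> 0" using x t by (auto simp: q_def norm_power power_less_one_iff)
  define z where "z i = - (x powi (2 * int i + 1 - 2 * int t))" for i
  have z: "z i \<noteq> 0" for i using x by (simp add: z_def)
  have fac: "1 + z i * q ^ Suc k = 1 - x ^ (2 * (2 * t * k + (t + i)) + 1)"
    "1 + q ^ k / z i = 1 - x ^ (2 * (2 * t * k + (t - Suc i)) + 1)" if i: "i < t" for i k
  proof -
    have "x powi (2 * int i + 1 - 2 * int t) * q ^ Suc k = x powi (2 * int i + 1 - 2 * int t + int (4 * t * Suc k))"
      unfolding q_def power_mult[symmetric] by (simp only: power_int_add[OF disjI1[OF x(2)]] power_int_of_nat)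
    also have "2 * int i + 1 - 2 * int t + int (4 * t * Suc k) = int (2 * (2 * t * k + (t + i)) + 1)"
      by (simp add: algebra_simps)
    finally show "1 + z i * q ^ Suc k = 1 - x ^ (2 * (2 * t * k + (t + i)) + 1)"
      unfolding z_def power_int_of_nat by simp
    have "q ^ k / x powi (2 * int i + 1 - 2 * int t) = x powi (int (4 * t * k) - (2 * int i + 1 - 2 * int t))"
      unfolding q_def power_mult[symmetric] by (simp only: power_int_diff[OF disjI1[OF x(2)]] power_int_of_nat)
    also have "int (4 * t * k) - (2 * int i + 1 - 2 * int t) = int (2 * (2 * t * k + (t - Suc i)) + 1)"
      using i by (simp add: algebra_simps of_nat_diff)
    finally show "1 + q ^ k / z i = 1 - x ^ (2 * (2 * t * k + (t - Suc i)) + 1)"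
      unfolding z_def power_int_of_nat by simp
  qed
  \<comment> \<open>A block of 2 * t consecutive indices is its upper half together with its
    reversed lower half.\<close>
  have blk: "(\<Prod>m<2*t*N. g m) = (\<Prod>k<N. \<Prod>i<t. g (2 * t * k + (t + i)) * g (2 * t * k + (t - Suc i)))" for g :: "nat \<Rightarrow> complex" and N
  proof (induction N)
    case (Suc N)
    have "(\<Prod>m<2*t*Suc N. g m) = (\<Prod>m<2*t*N + (t + t). g m)" by (rule prod.cong) auto
    also have "\<dots> = (\<Prod>m<2*t*N. g m) * (\<Prod>i<t+t. g (2 * t * N + i))"
      by (rule prod_lessThan_add)
    also have "(\<Prod>i<t+t. g (2 * t * N + i)) = (\<Prod>i<t. g (2 * t * N + i)) * (\<Prod>i<t. g (2 * t * N + (t + i)))"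
      unfolding prod_lessThan_add[of _ t t] by (simp only: add.assoc)
    also have "(\<Prod>i<t. g (2 * t * N + i)) = (\<Prod>i<t. g (2 * t * N + (t - Suc i)))"
      by (rule prod.nat_diff_reindex[symmetric])
    finally show ?case unfolding prod.lessThan_Suc Suc prod.distrib by (simp only: mult_ac)
  qed auto
  have eq: "(\<Prod>i<t. \<Prod>k<N. (1 - q ^ Suc k) * (1 + z i * q ^ Suc k) * (1 + q ^ k / z i))
      = qpoch q N ^ t * (\<Prod>m<2*t*N. 1 - x ^ (2 * m + 1))" for N
  proof -
    have "(\<Prod>i<t. \<Prod>k<N. (1 - q ^ Suc k) * (1 + z i * q ^ Suc k) * (1 + q ^ k / z i))
      = (\<Prod>i<t. qpoch q N * (\<Prod>k<N. (1 - x ^ (2 * (2 * t * k + (t + i)) + 1)) * (1 - x ^ (2 * (2 * t * k + (t - Suc i)) + 1))))"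
    proof (rule prod.cong[OF refl])
      fix i assume "i \<in> {..<t}"
      hence i: "i < t" by simp
      show "(\<Prod>k<N. (1 - q ^ Suc k) * (1 + z i * q ^ Suc k) * (1 + q ^ k / z i))
        = qpoch q N * (\<Prod>k<N. (1 - x ^ (2 * (2 * t * k + (t + i)) + 1)) * (1 - x ^ (2 * (2 * t * k + (t - Suc i)) + 1)))"
        unfolding fac[OF i] qpoch_def prod.distrib by (simp only: mult.assoc)
    qed
    also have "\<dots> = qpoch q N ^ t * (\<Prod>k<N. \<Prod>i<t. (1 - x ^ (2 * (2 * t * k + (t + i)) + 1)) * (1 - x ^ (2 * (2 * t * k + (t - Suc i)) + 1)))"
      unfolding prod.distrib[of "\<lambda>_. qpoch q N"] prod_constant card_lessThan by (subst prod.swap) (rule refl)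
    also have "(\<Prod>k<N. \<Prod>i<t. (1 - x ^ (2 * (2 * t * k + (t + i)) + 1)) * (1 - x ^ (2 * (2 * t * k + (t - Suc i)) + 1)))
       = (\<Prod>m<2*t*N. 1 - x ^ (2 * m + 1))"
      by (rule blk[of "\<lambda>m. 1 - x ^ (2 * m + 1)", symmetric])
    finally show ?thesis .
  qed
  have "(\<lambda>N. \<Prod>i<t. \<Prod>k<N. (1 - q ^ Suc k) * (1 + z i * q ^ Suc k) * (1 + q ^ k / z i)) \<longlonglongrightarrow> (\<Prod>i<t. theta q (z i))"
    by (intro tendsto_prod jacobi_triple_product q z)
  moreover have "(\<lambda>N. qpoch q N ^ t * (\<Prod>m<2*t*N. 1 - x ^ (2 * m + 1))) \<longlonglongrightarrow> euler q ^ t * (euler x / euler (x\<^sup>2))"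
    by (intro tendsto_mult tendsto_power euler q filterlim_compose[OF odd_factor_limit[OF x(1)] filterlim_mult_nat]) (use t in auto)
  ultimately have "(\<Prod>i<t. theta q (z i)) = euler q ^ t * (euler x / euler (x\<^sup>2))"
    unfolding eq by (rule LIMSEQ_unique)
  thus ?thesis by (simp only: q_def z_def)
qed

text \<open>Shifting the exponent by 2 * t * k only multiplies the power of the point by (-1)^k. So
  the sum separates into a theta constant depending on i and an entry free of x.\<close>

lemma class_sum_antiroot:
  assumes x: "norm x < 1" "x \<noteq> 0" and t: "t > 0"
  shows "class_sum x t i (\<lambda>n. antiroot t j powi n)
    = theta (x ^ (4 * t)) (- (x powi (2 * int i + 1 - 2 * int t))) * (antiroot t j powi int i + antiroot t j powi (- int i - 1))"
proof -
  define w where "w = antiroot t j"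
  have w: "w \<noteq> 0" "w ^ (2 * t) = -1" using antiroot_power[OF t] by (auto simp: w_def)
  have "w powi (2 * int t) = -1" using w(2) power_int_of_nat[of w "2 * t"] by simp
  hence wk: "w powi (2 * int t * k) = (-1) powi k" for k
    by (simp only: power_int_mult)
  have m1: "(-1::complex) powi (- k) = (-1) powi k" for k :: int
    by (cases "even k") (auto simp: power_int_minus_left)
  have "class_sum x t i (\<lambda>n. w powi n) = infsum (\<lambda>k. (x ^ (4 * t)) powi triangular k * (- (x powi (2 * int i + 1 - 2 * int t))) powi k * (w powi int i + w powi (- int i - 1))) UNIV"
    unfolding class_sum_def
  proof (rule infsum_cong)
    fix k :: int
    have "- (int i + 2 * int t * k) - 1 = (- int i - 1) + 2 * int t * (- k)" by simp
    hence 1: "w powi (int i + 2 * int t * k) + w powi (- (int i + 2 * int t * k) - 1) = (-1) powi k * (w powi int i + w powi (- int i - 1))"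
      by (simp only: power_int_add[OF disjI1[OF w(1)]] wk m1) (simp add: distrib_left mult_ac)
    have "(x ^ (4 * t)) powi triangular k * (- (x powi (2 * int i + 1 - 2 * int t))) powi k
       = (-1) powi k * (x powi (int (4 * t) * triangular k) * x powi ((2 * int i + 1 - 2 * int t) * k))"
    proof -
      have "(- (x powi (2 * int i + 1 - 2 * int t))) powi k = ((-1) * x powi (2 * int i + 1 - 2 * int t)) powi k" by simp
      thus ?thesis unfolding power_int_mult_distrib power_int_mult power_int_of_nat by (simp only: mult_ac)
    qed
    also have "x powi (int (4 * t) * triangular k) * x powi ((2 * int i + 1 - 2 * int t) * k) = x powi (int (4 * t) * triangular k + (2 * int i + 1 - 2 * int t) * k)"
      using x by (simp add: power_int_add)
    also have "int (4 * t) * triangular k + (2 * int i + 1 - 2 * int t) * k = 2 * int t * k\<^sup>2 + (2 * int i + 1) * k"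
    proof -
      have "int (4 * t) * triangular k = 2 * int t * (k * (k + 1))" using two_triangular[of k] by simp
      thus ?thesis by (simp add: algebra_simps power2_eq_square)
    qed
    finally have 2: "(x ^ (4 * t)) powi triangular k * (- (x powi (2 * int i + 1 - 2 * int t))) powi k = (-1) powi k * x powi (2 * int t * k\<^sup>2 + (2 * int i + 1) * k)" .
    show "x powi (2 * int t * k\<^sup>2 + (2 * int i + 1) * k) * (w powi (int i + 2 * int t * k) + w powi (- (int i + 2 * int t * k) - 1))
      = (x ^ (4 * t)) powi triangular k * (- (x powi (2 * int i + 1 - 2 * int t))) powi k * (w powi int i + w powi (- int i - 1))"
      unfolding 1 2 by (simp only: mult_ac)
  qed
  thus ?thesis unfolding w_def theta_def infsum_cmult_left' .
qed

text \<open>What remains of the determinant of values after the theta constants are taken out of the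
  rows. It is free of x and is fixed later by comparing constant terms.\<close>

definition antiroot_det :: "nat \<Rightarrow> complex" where
  "antiroot_det t = Determinant.det (Matrix.mat t t (\<lambda>(i, j). antiroot t j powi int i + antiroot t j powi (- int i - 1)))"

text \<open>If D is the transition determinant, then D * V = X for the values and D * W is an
  explicit product for the Taylor coefficients. Multiplying crosswise removes D. Everything is
  squared since only X^2 is known.\<close>

theorem wronskian_euler:
  assumes r: "0 < r" "r < 1" and t: "t > 0"
  defines "x \<equiv> complex_of_real r"
  shows "antiroot_const t ^ 2 * (wronskian x t ^ 2 * euler x ^ (4 * t - 2)) = (antiroot_det t ^ 2 * 4 ^ t) * euler (x\<^sup>2) ^ (2 * ((2 * t - 1) * (t + 1)))"
proof -
  have x: "x \<noteq> 0" "norm x < 1" using r by (auto simp: x_def)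
  define D where "D = Determinant.det (Matrix.mat t t (\<lambda>(k, i). theta_basis x (t - 1) k (int i)))"
  define V where "V = Determinant.det (Matrix.mat t t (\<lambda>(i, j). class_sum x t i (\<lambda>n. antiroot t j powi n)))"
  define X where "X = (\<Prod>j<t. laurent (full_coeff x) (antiroot t j))
       * (\<Prod>j<t. \<Prod>i<j. laurent (odd_coeff x) (antiroot t i) * laurent (even_coeff x) (antiroot t j) - laurent (even_coeff x) (antiroot t i) * laurent (odd_coeff x) (antiroot t j))"
  define e1 e2 e4 where "e1 = euler x" and "e2 = euler (x\<^sup>2)" and "e4 = euler (x ^ (4 * t))"
  have nz: "e1 \<noteq> 0" "e2 \<noteq> 0" "e4 \<noteq> 0"
    using x t unfolding e1_def e2_def e4_def by (auto intro!: euler simp: norm_power power_less_one_iff)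
  have R1: "D * V = X"
    unfolding D_def V_def X_def by (rule det_laurent_class_sum[OF x t]) simp
  have R2: "D * wronskian x t = (2 * e2 ^ 2 / e1) ^ t * (- ((e2 ^ 3)\<^sup>2)) ^ (\<Sum>m<t. m)"
  proof -
    have "moment (odd_coeff x) 0 \<noteq> 0" unfolding x_def by (rule moment_odd_coeff_0_nonzero[OF r])
    from det_jet_class_sum[OF x t this] show ?thesis
      by (simp only: D_def theta_one[OF x(2,1)] moment_cross_coeff_1_euler[OF x(2,1)] e1_def e2_def)
  qed
  have V: "V = (e4 ^ t * (e1 / e2)) * antiroot_det t"
  proof -
    define A where "A = Matrix.mat t t (\<lambda>(i, j). antiroot t j powi int i + antiroot t j powi (- int i - 1))"
    have "Matrix.mat t t (\<lambda>(i, j). class_sum x t i (\<lambda>n. antiroot t j powi n))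
      = Matrix.mat t t (\<lambda>(i, j). theta (x ^ (4 * t)) (- (x powi (2 * int i + 1 - 2 * int t))) * A $$ (i, j))"
      by (rule eq_matI) (auto simp: class_sum_antiroot[OF x(2,1) t] A_def)
    hence "V = (\<Prod>i<t. theta (x ^ (4 * t)) (- (x powi (2 * int i + 1 - 2 * int t)))) * Determinant.det A"
      unfolding V_def by (simp only:) (rule det_scale_rows, simp add: A_def)
    thus ?thesis unfolding theta_class_limit[OF x(2,1) t] antiroot_det_def A_def e1_def e2_def e4_def .
  qed
  have X: "X ^ 2 * e2 ^ (2 * t) = antiroot_const t ^ 2 * e1 ^ (2 * t) * e2 ^ (2 * (t * (t - 1))) * e4 ^ (2 * t)"
    unfolding X_def e1_def e2_def e4_def by (rule antiroot_side_limit[OF x(2,1) t])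
  have gauss: "2 * (\<Sum>m<t. m) = t * (t - 1)"
    by (induction t) (auto simp: algebra_simps)
  have sqR2: "((2 * e2 ^ 2 / e1) ^ t * (- ((e2 ^ 3)\<^sup>2)) ^ (\<Sum>m<t. m)) ^ 2 = 4 ^ t * e2 ^ (4 * t) * e2 ^ (6 * (t * (t - 1))) / e1 ^ (2 * t)"
  proof -
    have "((- ((e2 ^ 3)\<^sup>2)) ^ (\<Sum>m<t. m)) ^ 2 = ((e2 ^ 6) ^ 2) ^ (\<Sum>m<t. m)"
      by (simp only: power_mult[symmetric] mult.commute[of _ 2]) (simp add: power_mult)
    also have "\<dots> = e2 ^ (6 * (t * (t - 1)))"
      unfolding gauss[symmetric] power_mult[symmetric] by (simp only: mult.assoc)
    moreover have "((2 * e2 ^ 2 / e1) ^ t) ^ 2 = 4 ^ t * e2 ^ (4 * t) / e1 ^ (2 * t)"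
    proof -
      have "((2 * e2 ^ 2 / e1) ^ t) ^ 2 = ((2 * e2 ^ 2 / e1) ^ 2) ^ t"
        by (simp only: power_mult[symmetric] mult.commute)
      also have "(2 * e2 ^ 2 / e1) ^ 2 = 4 * e2 ^ 4 / e1 ^ 2"
        by (simp add: power_divide power_mult_distrib flip: power_mult)
      finally show ?thesis by (simp only: power_divide power_mult_distrib power_mult)
    qed
    ultimately show ?thesis by (simp only: power_mult_distrib) simp
  qed
  define W where "W = wronskian x t"
  have "W * X = V * (D * W)" unfolding R1[symmetric] by (simp only: mult_ac)
  hence WX: "W * X = (e4 ^ t * (e1 / e2)) * antiroot_det t * ((2 * e2 ^ 2 / e1) ^ t * (- ((e2 ^ 3)\<^sup>2)) ^ (\<Sum>m<t. m))"
    unfolding V W_def R2 .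
  have "W ^ 2 * (X ^ 2 * e2 ^ (2 * t)) = (W * X) ^ 2 * e2 ^ (2 * t)" by (simp only: power_mult_distrib mult_ac)
  also have "\<dots> = (e4 ^ t) ^ 2 * (e1 / e2) ^ 2 * antiroot_det t ^ 2 * (4 ^ t * e2 ^ (4 * t) * e2 ^ (6 * (t * (t - 1))) / e1 ^ (2 * t)) * e2 ^ (2 * t)"
    unfolding WX power_mult_distrib[of _ "(2 * e2 ^ 2 / e1) ^ t * (- ((e2 ^ 3)\<^sup>2)) ^ (\<Sum>m<t. m)"] sqR2
    by (simp only: power_mult_distrib mult_ac)
  also have "(e4 ^ t) ^ 2 = e4 ^ (2 * t)" by (simp only: power_mult[symmetric] mult.commute)
  finally have main: "W ^ 2 * (antiroot_const t ^ 2 * e1 ^ (2 * t) * e2 ^ (2 * (t * (t - 1))) * e4 ^ (2 * t))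
    = e4 ^ (2 * t) * (e1 / e2) ^ 2 * antiroot_det t ^ 2 * (4 ^ t * e2 ^ (4 * t) * e2 ^ (6 * (t * (t - 1))) / e1 ^ (2 * t)) * e2 ^ (2 * t)"
    unfolding X .
  hence main': "W ^ 2 * antiroot_const t ^ 2 * e1 ^ (2 * t) * e2 ^ (2 * (t * (t - 1))) * e1 ^ (2 * t) * e2 ^ 2
    = e1 ^ 2 * antiroot_det t ^ 2 * 4 ^ t * e2 ^ (4 * t) * e2 ^ (6 * (t * (t - 1))) * e2 ^ (2 * t)"
    using nz by (simp add: field_simps)
  obtain s where s: "t = Suc s" using t by (cases t) auto
  have p1: "e1 ^ (2 * t) * e1 ^ (2 * t) = e1 ^ (4 * t - 2) * e1 ^ 2" unfolding power_add[symmetric] s by simp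
  have p2: "e2 ^ (4 * t) * e2 ^ (6 * (t * (t - 1))) * e2 ^ (2 * t) = e2 ^ (2 * ((2 * t - 1) * (t + 1))) * (e2 ^ (2 * (t * (t - 1))) * e2 ^ 2)"
    unfolding power_add[symmetric] s by (rule arg_cong[of _ _ "\<lambda>n. e2 ^ n"]) (simp add: algebra_simps)
  have "(antiroot_const t ^ 2 * (W ^ 2 * e1 ^ (4 * t - 2))) * (e1 ^ 2 * (e2 ^ (2 * (t * (t - 1))) * e2 ^ 2))
     = W ^ 2 * antiroot_const t ^ 2 * (e1 ^ (4 * t - 2) * e1 ^ 2) * e2 ^ (2 * (t * (t - 1))) * e2 ^ 2" by (simp only: mult_ac)
  also have "\<dots> = e1 ^ 2 * antiroot_det t ^ 2 * 4 ^ t * (e2 ^ (4 * t) * e2 ^ (6 * (t * (t - 1))) * e2 ^ (2 * t))"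
    using main' unfolding p1[symmetric] by (simp only: mult_ac)
  also have "\<dots> = ((antiroot_det t ^ 2 * 4 ^ t) * e2 ^ (2 * ((2 * t - 1) * (t + 1)))) * (e1 ^ 2 * (e2 ^ (2 * (t * (t - 1))) * e2 ^ 2))"
    unfolding p2 by (simp only: mult_ac)
  finally show ?thesis using nz by (simp add: W_def e1_def e2_def)
qed

subsection \<open>Euler products as formal power series\<close>

definition euler_partial :: "nat \<Rightarrow> nat \<Rightarrow> 'a :: comm_ring_1 fps" where
  "euler_partial d N = (\<Prod>k<N. 1 - fps_X ^ (d * Suc k))"

text \<open>Factors beyond the first m affect only coefficients above m, so the coefficient of index
  m can be read from the partial product with m factors.\<close>

definition euler_fps :: "nat \<Rightarrow> 'a :: comm_ring_1 fps" where
  "euler_fps d = Abs_fps (\<lambda>m. fps_nth (euler_partial d m) m)"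

lemma fps_nth_euler_partial_stable:
  assumes d: "d > 0" and N: "N \<ge> m"
  shows "fps_nth (euler_partial d N :: 'a :: comm_ring_1 fps) m = fps_nth (euler_fps d) m"
proof -
  have "fps_nth (euler_partial d (m + j) :: 'a fps) m = fps_nth (euler_partial d m) m" for j
  proof (induction j)
    case (Suc j)
    have "m < d * Suc (m + j)" using d by (metis le_add1 less_Suc_eq_le mult.commute mult_le_mono2 mult_1_right One_nat_def Suc_leI order_less_le_trans)
    hence "fps_nth (euler_partial d (m + j) * fps_X ^ (d * Suc (m + j)) :: 'a fps) m = 0"
      unfolding fps_X_power_mult_right_nth by simp
    thus ?case using Suc by (simp add: euler_partial_def algebra_simps)
  qed auto
  from this[of "N - m"] N show ?thesis by (simp add: euler_fps_def)
qed

lemma euler_fps_nth_0 [simp]: "fps_nth (euler_fps d) 0 = 1"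
  by (simp add: euler_fps_def euler_partial_def)

lemma eval_euler_partial:
  fixes x :: complex
  shows "(\<lambda>m. fps_nth (euler_partial d N) m * x ^ m) sums (\<Prod>k<N. 1 - (x ^ d) ^ Suc k)"
proof -
  define p where "p = (\<Prod>k<N. 1 - Polynomial.monom (1::complex) (d * Suc k))"
  have "fps_of_poly p = euler_partial d N"
    by (simp only: p_def euler_partial_def fps_of_poly_prod fps_of_poly_diff fps_of_poly_1 fps_of_poly_monom fps_const_1_eq_1 mult_1_left)
  moreover have "poly p x = (\<Prod>k<N. 1 - (x ^ d) ^ Suc k)"
    by (simp only: p_def poly_prod poly_diff poly_1 poly_monom mult_1_left power_mult)
  moreover have "(\<lambda>m. fps_nth (fps_of_poly p) m * x ^ m) sums eval_fps (fps_of_poly p) x"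
    by (rule sums_eval_fps) simp
  moreover have "eval_fps (fps_of_poly p) x = poly p x" by simp
  ultimately show ?thesis by (simp only:)
qed

text \<open>The same product with plus signs; its nonnegative coefficients dominate those of
  \<open>euler_partial\<close>.\<close>

definition eplus :: "nat \<Rightarrow> nat \<Rightarrow> real fps" where
  "eplus d N = (\<Prod>k<N. 1 + fps_X ^ (d * Suc k))"

text \<open>The coefficients of the majorant grow with the number of factors and are stable from m
  factors on; the inequality 1 + y <= exp y and a geometric series bound their weighted sums
  uniformly.\<close>

lemma euler_partial_majorant:
  assumes d: "d > 0"
  shows "norm (fps_nth (euler_partial d N :: complex fps) m) \<le> fps_nth (eplus d N) m"
    and "fps_nth (eplus d N) m \<le> fps_nth (eplus d m) m"
    and "0 \<le> r \<Longrightarrow> r < 1 \<Longrightarrow> (\<Sum>m\<le>M. fps_nth (eplus d m) m * r ^ m) \<le> exp (r ^ d / (1 - r ^ d))"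
proof -
  define Q where Q_eq: "Q = eplus d"
  have Q_def: "Q N = (\<Prod>k<N. 1 + fps_X ^ (d * Suc k))" for N by (simp only: Q_eq eplus_def)
  have QS: "fps_nth (Q (Suc N)) m = fps_nth (Q N) m + (if m < d * Suc N then 0 else fps_nth (Q N) (m - d * Suc N))" for N m
    unfolding Q_def prod.lessThan_Suc distrib_left mult_1_right fps_add_nth fps_X_power_mult_right_nth ..
  have ES: "fps_nth (euler_partial d (Suc N) :: complex fps) m = fps_nth (euler_partial d N) m - (if m < d * Suc N then 0 else fps_nth (euler_partial d N) (m - d * Suc N))" for N m
    unfolding euler_partial_def prod.lessThan_Suc right_diff_distrib mult_1_right fps_sub_nth fps_X_power_mult_right_nth ..
  have Qpos: "fps_nth (Q N) m \<ge> 0" for N m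
  proof (induction N arbitrary: m)
    case 0
    show ?case by (simp add: Q_def)
  qed (simp add: QS)
  show 1: "norm (fps_nth (euler_partial d N :: complex fps) m) \<le> fps_nth (eplus d N) m" for N m
    unfolding Q_eq[symmetric]
  proof (induction N arbitrary: m)
    case 0
    show ?case by (simp add: Q_def euler_partial_def)
  next
    case (Suc N)
    have "norm (fps_nth (euler_partial d (Suc N) :: complex fps) m) \<le> norm (fps_nth (euler_partial d N :: complex fps) m) + norm (if m < d * Suc N then 0 else fps_nth (euler_partial d N :: complex fps) (m - d * Suc N))"
      unfolding ES by (rule norm_triangle_ineq4)
    also have "\<dots> \<le> fps_nth (Q (Suc N)) m" unfolding QS using Suc by (intro add_mono) auto
    finally show ?case .
  qed
  have mono: "fps_nth (Q N) m \<le> fps_nth (Q (N + j)) m" for N j m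
    by (induction j) (auto simp: QS Qpos intro: order_trans)
  have stable: "fps_nth (Q (m + j)) m = fps_nth (Q m) m" for m j
  proof (induction j)
    case (Suc j)
    have "m < Suc (m + j)" by simp
    also have "\<dots> \<le> d * Suc (m + j)"
    proof -
      have "1 * Suc (m + j) \<le> d * Suc (m + j)" by (rule mult_le_mono1) (use d in simp)
      thus ?thesis by (simp only: mult_1)
    qed
    finally show ?case using Suc by (simp only: add_Suc_right QS if_True add_0_right)
  qed auto
  show 2: "fps_nth (eplus d N) m \<le> fps_nth (eplus d m) m" for N m
  proof (cases "N \<le> m")
    case True
    thus ?thesis using mono[of N m "m - N"] by (simp add: Q_eq)
  next
    case False
    thus ?thesis using stable[of m "N - m"] by (simp add: Q_eq)
  qed
  show "(\<Sum>m\<le>M. fps_nth (eplus d m) m * r ^ m) \<le> exp (r ^ d / (1 - r ^ d))" if r: "0 \<le> r" "r < 1"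
  proof -
    have "(\<Sum>m\<le>M. fps_nth (Q m) m * r ^ m) = (\<Sum>m\<le>M. fps_nth (Q M) m * r ^ m)"
    proof (intro sum.cong refl)
      fix m assume "m \<in> {..M}"
      thus "fps_nth (Q m) m * r ^ m = fps_nth (Q M) m * r ^ m" using stable[of m "M - m"] by simp
    qed
    also have "\<dots> \<le> (\<Prod>k<M. 1 + r ^ (d * Suc k))"
    proof -
      define p where "p = (\<Prod>k<M. 1 + Polynomial.monom (1::real) (d * Suc k))"
      have pQ: "fps_of_poly p = Q M"
        by (simp only: p_def Q_def fps_of_poly_prod fps_of_poly_add fps_of_poly_1 fps_of_poly_monom fps_const_1_eq_1 mult_1_left)
      have S: "(\<lambda>m. fps_nth (Q M) m * r ^ m) sums poly p r"
        using sums_eval_fps[of r "fps_of_poly p"] by (simp add: pQ[symmetric])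
      have "(\<Sum>m\<le>M. fps_nth (Q M) m * r ^ m) \<le> poly p r"
        using sum_le_suminf[OF sums_summable[OF S], of "{..M}"] Qpos r by (simp add: sums_unique[OF S, symmetric])
      also have "poly p r = (\<Prod>k<M. 1 + r ^ (d * Suc k))"
        by (simp only: p_def poly_prod poly_add poly_1 poly_monom mult_1_left)
      finally show ?thesis .
    qed
    also have "\<dots> \<le> exp (\<Sum>k<M. r ^ (d * Suc k))"
      using r by (intro prod_le_exp_sum) auto
    also have "(\<Sum>k<M. r ^ (d * Suc k)) \<le> r ^ d / (1 - r ^ d)"
    proof -
      have rd: "0 \<le> r ^ d" "r ^ d < 1" using r d by (auto simp: power_less_one_iff)
      have S: "(\<lambda>k. (r ^ d) ^ Suc k) sums (r ^ d * (1 / (1 - r ^ d)))"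
        using sums_mult[OF geometric_sums[of "r ^ d"], of "r ^ d"] rd by simp
      have "(\<Sum>k<M. (r ^ d) ^ Suc k) \<le> r ^ d * (1 / (1 - r ^ d))"
        using sum_le_suminf[OF sums_summable[OF S], of "{..<M}"] rd unfolding sums_unique[OF S, symmetric] by (simp del: power_Suc)
      thus ?thesis by (simp only: power_mult) simp
    qed
    finally show ?thesis by (simp add: Q_eq)
  qed
qed

text \<open>The coefficients of the partial products are eventually constant, and the majorant
  permits passing to the limit inside the sum.\<close>

lemma eval_euler_fps:
  fixes x :: complex
  assumes d: "d > 0" and x: "norm x < 1"
  shows "summable (\<lambda>m. fps_nth (euler_fps d) m * x ^ m)"
    and "(\<lambda>N. \<Prod>k<N. 1 - (x ^ d) ^ Suc k) \<longlonglongrightarrow> (\<Sum>m. fps_nth (euler_fps d) m * x ^ m)"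
proof -
  define Q where "Q = eplus d"
  note maj = euler_partial_majorant[OF d, folded Q_def]
  have pos: "fps_nth (Q m) m \<ge> 0" for m by (rule order_trans[OF norm_ge_zero maj(1)])
  have sm: "summable (\<lambda>m. fps_nth (Q m) m * norm x ^ m)"
    by (rule bounded_imp_summable[of _ "exp (norm x ^ d / (1 - norm x ^ d))"]) (use pos maj(3) x in auto)
  have lim: "(\<lambda>N. fps_nth (euler_partial d N) m * x ^ m) \<longlonglongrightarrow> fps_nth (euler_fps d) m * x ^ m" for m
  proof (rule tendsto_eventually)
    show "eventually (\<lambda>N. fps_nth (euler_partial d N) m * x ^ m = fps_nth (euler_fps d) m * x ^ m) sequentially"
      using eventually_ge_at_top[of m] by eventually_elim (simp add: fps_nth_euler_partial_stable[OF d])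
  qed
  have bd: "norm (fps_nth (euler_partial d N) m * x ^ m) \<le> fps_nth (Q m) m * norm x ^ m" for N m
    unfolding norm_mult norm_power
    using order_trans[OF maj(1)[of N m] maj(2)[of N m]] by (intro mult_right_mono) auto
  have *: "(\<lambda>N. \<Sum>m. fps_nth (euler_partial d N) m * x ^ m) \<longlonglongrightarrow> (\<Sum>m. fps_nth (euler_fps d) m * x ^ m)"
    "summable (\<lambda>m. norm (fps_nth (euler_fps d) m * x ^ m))"
    using tannerys_theorem[OF lim always_eventually sm] bd by auto
  from *(2) show "summable (\<lambda>m. fps_nth (euler_fps d) m * x ^ m)" by (rule summable_norm_cancel)
  have "(\<Sum>m. fps_nth (euler_partial d N) m * x ^ m) = (\<Prod>k<N. 1 - (x ^ d) ^ Suc k)" for N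
    using eval_euler_partial by (rule sums_unique[symmetric])
  with *(1) show "(\<lambda>N. \<Prod>k<N. 1 - (x ^ d) ^ Suc k) \<longlonglongrightarrow> (\<Sum>m. fps_nth (euler_fps d) m * x ^ m)" by simp
qed

lemma conv_radius_ge_1I:
  fixes F :: "complex fps"
  assumes "\<And>r. 0 < r \<Longrightarrow> r < 1 \<Longrightarrow> summable (\<lambda>m. fps_nth F m * complex_of_real r ^ m)"
  shows "fps_conv_radius F \<ge> 1"
proof -
  have "conv_radius (fps_nth F) \<ge> 1"
  proof (rule conv_radius_geI_ex)
    fix r :: real assume "0 < r" "ereal r < 1"
    thus "\<exists>z. norm z = r \<and> summable (\<lambda>n. fps_nth F n * z ^ n)"
      using assms[of r] by (intro exI[of _ "complex_of_real r"]) auto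
  qed
  thus ?thesis by (simp add: fps_conv_radius_def)
qed

lemma conv_radius_euler_fps: "d > 0 \<Longrightarrow> fps_conv_radius (euler_fps d :: complex fps) \<ge> 1"
  by (rule conv_radius_ge_1I) (auto intro!: eval_euler_fps(1))

text \<open>The positive reals accumulate at 0, so the identity theorem reduces equality of formal
  power series to real arguments.\<close>

lemma fps_eqI_real:
  fixes F G :: "complex fps"
  assumes F: "fps_conv_radius F \<ge> 1" and G: "fps_conv_radius G \<ge> 1"
    and eq: "\<And>r. 0 < r \<Longrightarrow> r < 1 \<Longrightarrow> eval_fps F (of_real r) = eval_fps G (of_real r)"
  shows "F = G"
proof -
  have rad: "ereal (norm z) < fps_conv_radius F" "ereal (norm z) < fps_conv_radius G" if "norm z < 1" for z :: complex
    by (rule less_le_trans[OF _ F], use that in simp) (rule less_le_trans[OF _ G], use that in simp)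
  have hol: "(\<lambda>z. eval_fps F z - eval_fps G z) holomorphic_on ball 0 1"
    by (intro holomorphic_on_diff holomorphic_on_eval_fps) (auto simp: rad)
  have "eval_fps F z - eval_fps G z = 0" if "z \<in> ball 0 1" for z
  proof (rule analytic_continuation[OF hol, of "of_real ` {0<..<1}" 0])
    show "(0::complex) islimpt of_real ` {0<..<1::real}"
      unfolding islimpt_approachable
    proof safe
      fix e :: real assume "e > 0"
      define r where "r = min (e / 2) (1 / 2)"
      have "0 < r" "r < 1" "r < e" using \<open>e > 0\<close> by (auto simp: r_def)
      thus "\<exists>x'\<in>of_real ` {0<..<1}. x' \<noteq> (0::complex) \<and> dist x' 0 < e"
        by (intro bexI[of _ "of_real r"]) auto
    qed
  qed (use that eq in auto)
  moreover have "eventually (\<lambda>z::complex. z \<in> ball 0 1) (nhds 0)"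
    by (intro eventually_nhds_in_open) auto
  ultimately have "eventually (\<lambda>z. eval_fps F z = eval_fps G z) (nhds 0)"
    by (auto elim: eventually_mono)
  thus ?thesis using F G by (intro eval_fps_eqD) (auto intro: less_le_trans[of _ 1])
qed

subsection \<open>The lattice sum of the Wronskian\<close>

definition energy :: "nat \<Rightarrow> nat \<Rightarrow> int \<Rightarrow> int" where
  "energy t i k = 2 * int t * k\<^sup>2 + (2 * int i + 1) * k"

text \<open>Twice the shifted exponent n + 1/2 at n = i + 2 * t * k. Its square is (2 * i + 1)^2 + 8
  * t * \<open>energy t i k\<close>.\<close>

definition abscissa :: "nat \<Rightarrow> nat \<Rightarrow> int \<Rightarrow> int" where
  "abscissa t i k = 2 * int i + 1 + 4 * int t * k"

text \<open>Bounds the charges by the energy: each energy level contains finitely many vectors, and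
  level 0 only the zero vector.\<close>

lemma energy_ge_abs:
  assumes "i < t"
  shows "\<bar>k\<bar> \<le> energy t i k"
proof (cases "k \<ge> 0")
  case True
  have "0 \<le> 2 * int t * k\<^sup>2 + 2 * int i * k" using True by simp
  thus ?thesis using True by (simp add: energy_def algebra_simps)
next
  case False
  define m where "m = - k"
  have m: "m \<ge> 1" using False by (simp add: m_def)
  have "(2 * int i + 2) * m \<le> 2 * int t * m" using assms m by (intro mult_right_mono) auto
  also have "\<dots> \<le> 2 * int t * m * m" using m mult_left_mono[of 1 m "2 * int t * m"] by simp
  finally show ?thesis using False by (simp add: energy_def m_def power2_eq_square algebra_simps)
qed

definition charge_lattice :: "nat \<Rightarrow> (nat \<Rightarrow> int) set" where
  "charge_lattice t = {..<t} \<rightarrow>\<^sub>E UNIV"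

definition total_energy :: "nat \<Rightarrow> (nat \<Rightarrow> int) \<Rightarrow> nat" where
  "total_energy t n = nat (\<Sum>i<t. energy t i (n i))"

lemma int_total_energy: "int (total_energy t n) = (\<Sum>i<t. energy t i (n i))"
proof -
  have "0 \<le> (\<Sum>i<t. energy t i (n i))"
    by (intro sum_nonneg) (auto intro: order_trans[OF abs_ge_zero energy_ge_abs])
  thus ?thesis by (simp add: total_energy_def)
qed

lemma finite_charge_lattice_fiber: "finite {n \<in> charge_lattice t. total_energy t n = m}"
proof (rule finite_subset)
  show "{n \<in> charge_lattice t. total_energy t n = m} \<subseteq> {..<t} \<rightarrow>\<^sub>E {- int m..int m}"
  proof (rule subsetI)
    fix n assume "n \<in> {n \<in> charge_lattice t. total_energy t n = m}"
    hence n: "n \<in> charge_lattice t" and m: "total_energy t n = m" by auto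
    show "n \<in> {..<t} \<rightarrow>\<^sub>E {- int m..int m}"
    proof (rule PiE_I)
      fix i assume i: "i \<in> {..<t}"
      have "\<bar>n i\<bar> \<le> energy t i (n i)" using i by (intro energy_ge_abs) auto
      also have "\<dots> \<le> (\<Sum>i<t. energy t i (n i))"
        using i by (intro member_le_sum) (auto intro: order_trans[OF abs_ge_zero energy_ge_abs])
      finally show "n i \<in> {- int m..int m}" unfolding int_total_energy[symmetric] m by auto
    qed (use n in \<open>auto simp: charge_lattice_def PiE_def extensional_def\<close>)
  qed
qed (intro finite_PiE, auto)

definition lattice_vandermonde :: "nat \<Rightarrow> (nat \<Rightarrow> int) \<Rightarrow> int" where
  "lattice_vandermonde t n = (\<Prod>j<t. \<Prod>i<j. (abscissa t j (n j))\<^sup>2 - (abscissa t i (n i))\<^sup>2)"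

definition wronskian_series :: "nat \<Rightarrow> complex fps" where
  "wronskian_series t = Abs_fps (\<lambda>m. \<Sum>n | n \<in> charge_lattice t \<and> total_energy t n = m. of_int (lattice_vandermonde t n))"

text \<open>The 2 comes from the indices n and - n - 1, whose shifted exponents are opposite and are
  raised to even powers; the factorials are those of Taylor coefficients; each pair contributes 1/4
  because \<open>abscissa\<close> is twice the shifted exponent.\<close>

definition wronskian_factor :: "nat \<Rightarrow> complex" where
  "wronskian_factor t = (\<Prod>l<t. 2 / fact (2 * l)) * (\<Prod>j<t. \<Prod>i<j. 1 / 4)"

lemma wronskian_factor_nonzero: "wronskian_factor t \<noteq> 0"
  by (simp add: wronskian_factor_def)

text \<open>The row is spread out over the residue class of i modulo 2 * t, where it satisfies a
  theta recurrence; its moments are then summable and can be restricted to the class.\<close>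

lemma abs_summable_row:
  fixes x :: complex
  assumes x: "x \<noteq> 0" "norm x < 1" and i: "i < t"
  shows "(\<lambda>k. x powi energy t i k * of_int (abscissa t i k) ^ p) abs_summable_on UNIV"
proof -
  define c where "c n = (if n mod (2 * int t) = int i then x powi energy t i (n div (2 * int t)) else 0)" for n
  have t: "t > 0" using i by simp
  have "rapid c"
  proof (rule quasi_rapid[OF x, where d = "2 * t" and e = "2 * int t + 1"])
    fix n
    define k where "k = n div (2 * int t)"
    have d: "(n + int (2 * t)) div (2 * int t) = k + 1" "(n + int (2 * t)) mod (2 * int t) = n mod (2 * int t)"
      using t by (simp_all add: k_def)
    show "c (n + int (2 * t)) = x powi (2 * n + (2 * int t + 1)) * c n"
    proof (cases "n mod (2 * int t) = int i")
      case True
      have "n = 2 * int t * k + int i" using True div_mult_mod_eq[of n "2 * int t"] by (simp add: k_def mult.commute)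
      hence "energy t i (k + 1) = (2 * n + (2 * int t + 1)) + energy t i k"
        by (simp add: energy_def power2_eq_square algebra_simps)
      thus ?thesis using True x unfolding c_def d k_def[symmetric] by (simp add: power_int_add)
    qed (simp add: c_def d)
  qed (use t in auto)
  hence "(\<lambda>n. c n * (of_int n + 1 / 2) ^ p) abs_summable_on UNIV"
    by (rule rapid_moment)
  hence "(\<lambda>n. c n * (of_int n + 1 / 2) ^ p) abs_summable_on range (\<lambda>k. int i + 2 * int t * k)"
    by (rule summable_on_subset_banach) auto
  moreover have "inj (\<lambda>k. int i + 2 * int t * k)" using t by (auto intro: injI)
  ultimately have "(\<lambda>k. norm (c (int i + 2 * int t * k) * (of_int (int i + 2 * int t * k) + 1 / 2) ^ p)) summable_on UNIV"
    by (subst (asm) summable_on_reindex) (auto simp: o_def)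
  hence "(\<lambda>k. norm (2 ^ p :: complex) * norm (c (int i + 2 * int t * k) * (of_int (int i + 2 * int t * k) + 1 / 2) ^ p)) summable_on UNIV"
    by (rule summable_on_cmult_right)
  also have "(\<lambda>k. norm (2 ^ p :: complex) * norm (c (int i + 2 * int t * k) * (of_int (int i + 2 * int t * k) + 1 / 2) ^ p))
     = (\<lambda>k. norm (x powi energy t i k * of_int (abscissa t i k) ^ p))"
  proof
    fix k
    have "c (int i + 2 * int t * k) = x powi energy t i k" using i t by (simp add: c_def)
    moreover have "(of_int (abscissa t i k) :: complex) = 2 * (of_int (int i + 2 * int t * k) + 1 / 2)"
      by (simp add: abscissa_def algebra_simps)
    ultimately show "norm (2 ^ p :: complex) * norm (c (int i + 2 * int t * k) * (of_int (int i + 2 * int t * k) + 1 / 2) ^ p)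
      = norm (x powi energy t i k * of_int (abscissa t i k) ^ p)"
      by (simp only: power_mult_distrib norm_mult[symmetric] mult_ac)
  qed
  finally show ?thesis .
qed

text \<open>The product formula for \<open>infsum\<close> gives a value but not summability. As
  \<open>infsum\<close> is 0 for a family that is not summable, a positive value proves summability;
  hence the strict positivity.\<close>

lemma summable_PiE_positive:
  fixes f :: "nat \<Rightarrow> int \<Rightarrow> real"
  assumes s: "\<And>i. i < t \<Longrightarrow> f i summable_on UNIV" and pos: "\<And>i k. i < t \<Longrightarrow> f i k > 0"
  shows "(\<lambda>n. \<Prod>i<t. f i (n i)) summable_on charge_lattice t"
proof (rule ccontr)
  assume "\<not> ?thesis"
  hence "infsum (\<lambda>n. \<Prod>i<t. f i (n i)) (charge_lattice t) = 0" by (rule infsum_not_exists)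
  moreover have "infsum (\<lambda>n. \<Prod>i<t. f i (n i)) (charge_lattice t) = (\<Prod>i<t. infsum (f i) UNIV)"
    unfolding charge_lattice_def
  proof (rule infsum_prod_PiE_abs)
    fix i assume "i \<in> {..<t}"
    hence "norm (f i k) = f i k" for k using pos[of i k] by simp
    thus "f i abs_summable_on UNIV" using s[of i] \<open>i \<in> {..<t}\<close> by simp
  qed auto
  moreover have "infsum (f i) UNIV > 0" if "i < t" for i
  proof -
    have "f i 0 \<le> infsum (f i) UNIV"
      using finite_sum_le_infsum[OF s[OF that], of "{0}"] pos[OF that] by (simp add: less_imp_le)
    thus ?thesis using pos[OF that, of 0] by linarith
  qed
  hence "(\<Prod>i<t. infsum (f i) UNIV) > 0" by (intro prod_pos) auto
  ultimately show False by linarith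
qed

text \<open>The determinant is multilinear in its rows and each row is a sum over one charge.
  Expanding gives a sum over all charge vectors of Vandermonde determinants in the squares of the
  abscissae.\<close>

lemma wronskian_sum:
  fixes x :: complex
  assumes x: "x \<noteq> 0" "norm x < 1"
  shows "wronskian x t = wronskian_factor t * infsum (\<lambda>n. x ^ total_energy t n * of_int (lattice_vandermonde t n)) (charge_lattice t)"
    and "(\<lambda>n. x ^ total_energy t n * of_int (lattice_vandermonde t n)) abs_summable_on charge_lattice t"
proof -
  define h where "h i l k = x powi energy t i k * (2 / fact (2 * l) * (of_int (abscissa t i k) / 2) ^ (2 * l))" for i l k
  have hs: "(\<lambda>k. h i l k) abs_summable_on UNIV" if "i < t" for i l
  proof -
    have "(\<lambda>k. norm (2 / fact (2 * l) / 2 ^ (2 * l) :: complex) * norm (x powi energy t i k * of_int (abscissa t i k) ^ (2 * l))) summable_on UNIV"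
      by (intro summable_on_cmult_right abs_summable_row x that)
    moreover have "norm (2 / fact (2 * l) / 2 ^ (2 * l) :: complex) * norm (x powi energy t i k * of_int (abscissa t i k) ^ (2 * l)) = norm (h i l k)" for k
      unfolding norm_mult[symmetric] h_def power_divide by (simp add: field_simps)
    ultimately show ?thesis by simp
  qed
  have entry: "class_sum x t i (\<lambda>n. (of_int n + 1 / 2) ^ (2 * l)) / fact (2 * l) = infsum (h i l) UNIV" for i l
  proof -
    have "class_sum x t i (\<lambda>n. (of_int n + 1 / 2) ^ (2 * l)) / fact (2 * l) = infsum (\<lambda>k. x powi energy t i k
         * ((of_int (int i + 2 * int t * k) + 1 / 2) ^ (2 * l) + (of_int (- (int i + 2 * int t * k) - 1) + 1 / 2) ^ (2 * l)) * inverse (fact (2 * l))) UNIV"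
      unfolding class_sum_def energy_def divide_inverse[of _ "fact (2 * l)"] infsum_cmult_left' ..
    also have "\<dots> = infsum (h i l) UNIV"
    proof (rule infsum_cong)
      fix k
      define u where "u = (of_int (abscissa t i k) :: complex) / 2"
      have u: "of_int (int i + 2 * int t * k) + 1 / 2 = u" "of_int (- (int i + 2 * int t * k) - 1) + 1 / 2 = - u"
        by (simp_all add: u_def abscissa_def field_simps)
      have "(- u) ^ (2 * l) = u ^ (2 * l)" by simp
      thus "x powi energy t i k * ((of_int (int i + 2 * int t * k) + 1 / 2) ^ (2 * l) + (of_int (- (int i + 2 * int t * k) - 1) + 1 / 2) ^ (2 * l)) * inverse (fact (2 * l)) = h i l k"
        unfolding u h_def u_def[symmetric] by (simp only:) (simp add: divide_inverse mult_ac)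
    qed
    finally show ?thesis .
  qed
  have xe: "(\<Prod>i<t. x powi energy t i (n i)) = x ^ total_energy t n" for n
  proof -
    have "(\<Prod>i<s. x powi energy t i (n i)) = x powi (\<Sum>i<s. energy t i (n i))" for s
      by (induction s) (use x in \<open>auto simp: power_int_add\<close>)
    thus ?thesis by (simp add: int_total_energy[symmetric])
  qed
  have vand: "Determinant.det (Matrix.mat t t (\<lambda>(i, l). 2 / fact (2 * l) * (of_int (abscissa t i (n i)) / 2) ^ (2 * l))) = wronskian_factor t * of_int (lattice_vandermonde t n)" for n
  proof -
    define \<tau> where "\<tau> i = ((of_int (abscissa t i (n i)) :: complex) / 2)\<^sup>2" for i
    define V where "V = Matrix.mat t t (\<lambda>(k, j). \<tau> j ^ k)"
    have V: "V \<in> carrier_mat t t" by (simp add: V_def)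
    have "Matrix.mat t t (\<lambda>(i, l). 2 / fact (2 * l) * (of_int (abscissa t i (n i)) / 2) ^ (2 * l))
      = Matrix.mat t t (\<lambda>(i, l). 2 / fact (2 * l) * transpose_mat V $$ (i, l))"
      by (rule eq_matI) (auto simp: V_def \<tau>_def power_mult)
    hence "Determinant.det (Matrix.mat t t (\<lambda>(i, l). 2 / fact (2 * l) * (of_int (abscissa t i (n i)) / 2) ^ (2 * l)))
      = (\<Prod>l<t. 2 / fact (2 * l)) * Determinant.det (transpose_mat V)"
      by (simp only:) (rule det_scale_columns, use V in simp)
    also have "Determinant.det (transpose_mat V) = Determinant.det V" by (rule det_transpose[OF V])
    also have "\<dots> = (\<Prod>j<t. \<Prod>i<j. \<tau> j - \<tau> i)" unfolding V_def by (rule det_vandermonde)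
    also have "\<dots> = (\<Prod>j<t. \<Prod>i<j. 1 / 4 * of_int ((abscissa t j (n j))\<^sup>2 - (abscissa t i (n i))\<^sup>2))"
      by (intro prod.cong refl) (simp add: \<tau>_def power_divide field_simps)
    also have "\<dots> = (\<Prod>j<t. \<Prod>i<j. 1 / 4) * of_int (lattice_vandermonde t n)"
      unfolding lattice_vandermonde_def of_int_prod prod.distrib ..
    finally show ?thesis by (simp only: wronskian_factor_def mult.assoc)
  qed
  have trm: "(\<Sum>p | p permutes {0..<t}. signof p * (\<Prod>i<t. h i (p i) (n i))) = wronskian_factor t * (x ^ total_energy t n * of_int (lattice_vandermonde t n))" for n
  proof -
    have perm: "p i < t" if "p permutes {0..<t}" "i < t" for p i
      using permutes_in_image[OF that(1), of i] that(2) by simp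
    have "(\<Sum>p | p permutes {0..<t}. signof p * (\<Prod>i<t. h i (p i) (n i)))
      = x ^ total_energy t n * (\<Sum>p | p permutes {0..<t}. signof p * (\<Prod>i<t. 2 / fact (2 * p i) * (of_int (abscissa t i (n i)) / 2) ^ (2 * p i)))"
      unfolding h_def prod.distrib[of "\<lambda>i. x powi _ i"] xe sum_distrib_left by (intro sum.cong refl) (simp only: mult_ac)
    also have "(\<Sum>p | p permutes {0..<t}. signof p * (\<Prod>i<t. 2 / fact (2 * p i) * (of_int (abscissa t i (n i)) / 2) ^ (2 * p i)))
      = Determinant.det (Matrix.mat t t (\<lambda>(i, l). 2 / fact (2 * l) * (of_int (abscissa t i (n i)) / 2) ^ (2 * l)))"
      by (subst det_def'[of _ t]) (auto intro!: sum.cong prod.cong simp: perm lessThan_atLeast0)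
    finally show ?thesis unfolding vand by (simp only: mult_ac)
  qed
  show sm: "(\<lambda>n. x ^ total_energy t n * of_int (lattice_vandermonde t n)) abs_summable_on charge_lattice t"
  proof (rule summable_on_comparison_test)
    \<comment> \<open>Each difference of squares is bounded by (1 + A) * (1 + B), and every index
      occurs in t - 1 pairs; this makes the majorant a product over the coordinates.\<close>
    define f where "f i k = norm (x powi energy t i k) * (1 + (of_int (abscissa t i k))\<^sup>2) ^ (t - 1)" for i k
    show "(\<lambda>n. \<Prod>i<t. f i (n i)) summable_on charge_lattice t"
    proof (rule summable_PiE_positive)
      fix i assume i: "i < t"
      have "(\<lambda>k. \<Sum>p\<le>t - 1. of_nat (t - 1 choose p) * norm (x powi energy t i k * of_int (abscissa t i k) ^ (2 * p))) summable_on UNIV"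
        by (intro infsum_finite_sum(1) summable_on_cmult_right abs_summable_row x i) auto
      moreover have "(\<Sum>p\<le>t - 1. of_nat (t - 1 choose p) * norm (x powi energy t i k * of_int (abscissa t i k) ^ (2 * p))) = f i k" for k
      proof -
        have "f i k = norm (x powi energy t i k) * (\<Sum>p\<le>t - 1. of_nat (t - 1 choose p) * ((of_int (abscissa t i k))\<^sup>2) ^ p * 1 ^ (t - 1 - p))"
          unfolding f_def by (subst add.commute) (simp only: binomial_ring)
        also have "\<dots> = (\<Sum>p\<le>t - 1. of_nat (t - 1 choose p) * norm (x powi energy t i k * of_int (abscissa t i k) ^ (2 * p)))"
          unfolding sum_distrib_left by (intro sum.cong refl) (simp add: norm_mult norm_power power_mult)
        finally show ?thesis by simp
      qed
      ultimately show "f i summable_on UNIV" by simp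
      show "f i k > 0" for k
      proof -
        have "(0::real) < 1 + (of_int (abscissa t i k))\<^sup>2" by (rule add_pos_nonneg) auto
        thus ?thesis using x by (simp add: f_def)
      qed
    qed
    show "norm (x ^ total_energy t n * of_int (lattice_vandermonde t n)) \<le> (\<Prod>i<t. f i (n i))" for n
    proof -
      define w where "w i = 1 + (real_of_int (abscissa t i (n i)))\<^sup>2" for i
      have "norm (of_int (lattice_vandermonde t n) :: complex) = \<bar>real_of_int (lattice_vandermonde t n)\<bar>" by (rule norm_of_int)
      also have "\<dots> = (\<Prod>j<t. \<Prod>i<j. \<bar>(real_of_int (abscissa t j (n j)))\<^sup>2 - (real_of_int (abscissa t i (n i)))\<^sup>2\<bar>)"
        unfolding lattice_vandermonde_def of_int_prod abs_prod of_int_diff of_int_power ..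
      also have "\<dots> \<le> (\<Prod>j<t. \<Prod>i<j. w i * w j)"
      proof (intro prod_mono conjI prod_nonneg ballI abs_ge_zero)
        fix i j
        define A B where "A = (real_of_int (abscissa t j (n j)))\<^sup>2" and "B = (real_of_int (abscissa t i (n i)))\<^sup>2"
        have "0 \<le> A" "0 \<le> B" by (auto simp: A_def B_def)
        moreover from this have "0 \<le> A * B" by (rule mult_nonneg_nonneg)
        moreover have "(1 + B) * (1 + A) = 1 + A + B + A * B" by (simp add: algebra_simps)
        ultimately have "\<bar>A - B\<bar> \<le> (1 + B) * (1 + A)" by linarith
        thus "\<bar>(real_of_int (abscissa t j (n j)))\<^sup>2 - (real_of_int (abscissa t i (n i)))\<^sup>2\<bar> \<le> w i * w j"
          by (simp only: A_def B_def w_def)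
      qed
      also have "\<dots> = (\<Prod>j<t. w j ^ (t - 1))" by (rule prod_pairs_commute)
      finally have "norm (x ^ total_energy t n * of_int (lattice_vandermonde t n)) \<le> (\<Prod>i<t. norm (x powi energy t i (n i))) * (\<Prod>j<t. w j ^ (t - 1))"
        unfolding norm_mult xe[symmetric] prod_norm[symmetric] by (intro mult_left_mono prod_nonneg) auto
      also have "\<dots> = (\<Prod>i<t. f i (n i))" by (simp only: f_def w_def prod.distrib)
      finally show ?thesis .
    qed
  qed auto
  have "wronskian x t = Determinant.det (Matrix.mat t t (\<lambda>(i, l). infsum (h i l) UNIV))"
    unfolding wronskian_def entry ..
  also have "\<dots> = (\<Sum>p | p permutes {0..<t}. signof p * (\<Prod>i<t. infsum (h i (p i)) UNIV))"
  proof -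
    have perm: "p i < t" if "p permutes {0..<t}" "i < t" for p i
      using permutes_in_image[OF that(1), of i] that(2) by simp
    show ?thesis
      by (subst det_def'[of _ t]) (auto intro!: sum.cong prod.cong simp: perm lessThan_atLeast0)
  qed
  also have "\<dots> = (\<Sum>p | p permutes {0..<t}. infsum (\<lambda>n. signof p * (\<Prod>i<t. h i (p i) (n i))) (charge_lattice t))"
    unfolding infsum_cmult_right' charge_lattice_def
    by (intro sum.cong refl arg_cong[of _ _ "\<lambda>y. _ * y"] infsum_prod_PiE_abs[symmetric] hs) auto
  also have "\<dots> = infsum (\<lambda>n. \<Sum>p | p permutes {0..<t}. signof p * (\<Prod>i<t. h i (p i) (n i))) (charge_lattice t)"
  proof (rule infsum_finite_sum(2)[symmetric])
    show "finite {p. p permutes {0..<t}}" by (intro finite_permutations) auto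
    fix p assume "p \<in> {p. p permutes {0..<t}}"
    have "(\<lambda>n. \<Prod>i<t. norm (h i (p i) (n i))) summable_on charge_lattice t"
    proof (rule summable_on_comparison_test)
      \<comment> \<open>The summand with exponent 0 never vanishes, which gives the strict
        positivity demanded by \<open>summable_PiE_positive\<close>.\<close>
      define g where "g i k = norm (h i (p i) k) + norm (h i 0 k)" for i k
      show "(\<lambda>n. \<Prod>i<t. g i (n i)) summable_on charge_lattice t"
      proof (rule summable_PiE_positive)
        show "g i summable_on UNIV" if "i < t" for i
          unfolding g_def[abs_def] by (intro summable_on_add hs that)
        show "g i k > 0" for i k
          using x by (simp add: g_def h_def add_nonneg_pos)
      qed
      show "(\<Prod>i<t. norm (h i (p i) (n i))) \<le> (\<Prod>i<t. g i (n i))" for n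
        by (intro prod_mono) (auto simp: g_def)
    qed (auto intro: prod_nonneg)
    hence "(\<lambda>n. \<Prod>i<t. h i (p i) (n i)) abs_summable_on charge_lattice t" by (simp add: prod_norm)
    thus "(\<lambda>n. signof p * (\<Prod>i<t. h i (p i) (n i))) summable_on charge_lattice t"
      by (rule summable_on_cmult_right[OF abs_summable_summable])
  qed
  also have "\<dots> = wronskian_factor t * infsum (\<lambda>n. x ^ total_energy t n * of_int (lattice_vandermonde t n)) (charge_lattice t)"
    unfolding trm infsum_cmult_right' ..
  finally show "wronskian x t = wronskian_factor t * infsum (\<lambda>n. x ^ total_energy t n * of_int (lattice_vandermonde t n)) (charge_lattice t)" .
qed

lemma wronskian_series_sums:
  fixes x :: complex
  assumes x: "x \<noteq> 0" "norm x < 1"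
  shows "(\<lambda>m. fps_nth (wronskian_series t) m * x ^ m) sums (wronskian x t / wronskian_factor t)"
proof -
  define f where "f n = x ^ total_energy t n * of_int (lattice_vandermonde t n)" for n
  have sf: "f summable_on charge_lattice t"
    unfolding f_def[abs_def] by (rule abs_summable_summable[OF wronskian_sum(2)[OF x]])
  have bij: "bij_betw snd (SIGMA m:UNIV. {n \<in> charge_lattice t. total_energy t n = m}) (charge_lattice t)"
    by (rule bij_betwI[of _ _ _ "\<lambda>n. (total_energy t n, n)"]) auto
  have s2: "(\<lambda>p. f (snd p)) summable_on (SIGMA m:UNIV. {n \<in> charge_lattice t. total_energy t n = m})"
    by (subst summable_on_reindex_bij_betw[OF bij]) (rule sf)
  have inner: "infsum (\<lambda>n. f (snd (m, n))) {n \<in> charge_lattice t. total_energy t n = m} = fps_nth (wronskian_series t) m * x ^ m" for m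
  proof -
    have "infsum (\<lambda>n. f (snd (m, n))) {n \<in> charge_lattice t. total_energy t n = m} = (\<Sum>n | n \<in> charge_lattice t \<and> total_energy t n = m. f n)"
      by (simp add: infsum_finite[OF finite_charge_lattice_fiber])
    also have "\<dots> = (\<Sum>n | n \<in> charge_lattice t \<and> total_energy t n = m. of_int (lattice_vandermonde t n) * x ^ m)"
      by (intro sum.cong refl) (auto simp: f_def)
    finally show ?thesis by (simp add: wronskian_series_def sum_distrib_right)
  qed
  have "infsum f (charge_lattice t) = infsum (\<lambda>m. infsum (\<lambda>n. f (snd (m, n))) {n \<in> charge_lattice t. total_energy t n = m}) UNIV"
    using infsum_Sigma_banach[OF s2] infsum_reindex_bij_betw[OF bij, of f] by simp
  also have "\<dots> = infsum (\<lambda>m. fps_nth (wronskian_series t) m * x ^ m) UNIV" unfolding inner ..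
  finally have 1: "infsum f (charge_lattice t) = infsum (\<lambda>m. fps_nth (wronskian_series t) m * x ^ m) UNIV" .
  have "(\<lambda>m. infsum (\<lambda>n. f (snd (m, n))) {n \<in> charge_lattice t. total_energy t n = m}) summable_on UNIV"
    by (rule summable_on_Sigma_banach[where f = "\<lambda>m n. f (snd (m, n))"]) (use s2 in \<open>simp add: case_prod_unfold\<close>)
  hence "(\<lambda>m. fps_nth (wronskian_series t) m * x ^ m) summable_on UNIV" unfolding inner .
  hence "((\<lambda>m. fps_nth (wronskian_series t) m * x ^ m) has_sum infsum f (charge_lattice t)) UNIV" unfolding 1 by simp
  hence "(\<lambda>m. fps_nth (wronskian_series t) m * x ^ m) sums infsum f (charge_lattice t)" by (rule has_sum_imp_sums)
  moreover have "infsum f (charge_lattice t) = wronskian x t / wronskian_factor t"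
    using wronskian_sum(1)[OF x, of t] wronskian_factor_nonzero[of t] by (simp add: f_def[abs_def])
  ultimately show ?thesis by simp
qed

lemma fps_const_square_cancel:
  fixes f g :: "complex fps"
  assumes "f ^ 2 = g ^ 2" "fps_nth f 0 = fps_nth g 0" "fps_nth f 0 \<noteq> 0"
  shows "f = g"
proof -
  have "(f - g) * (f + g) = 0" using assms(1) by (simp add: algebra_simps power2_eq_square)
  moreover have "f + g \<noteq> 0"
  proof
    assume "f + g = 0"
    hence "fps_nth (f + g) 0 = 0" by simp
    thus False using assms(2,3) by simp
  qed
  ultimately show ?thesis by simp
qed

definition base_vandermonde :: "nat \<Rightarrow> int" where
  "base_vandermonde t = (\<Prod>j<t. \<Prod>i<j. (2 * int j + 1)\<^sup>2 - (2 * int i + 1)\<^sup>2)"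

lemma base_vandermonde_nonzero: "base_vandermonde t \<noteq> 0"
proof -
  have "(2 * int j + 1)\<^sup>2 - (2 * int i + 1)\<^sup>2 \<noteq> 0" if "i < j" for i j
  proof -
    have "(2 * int i + 1)\<^sup>2 < (2 * int j + 1)\<^sup>2" using that by (intro power_strict_mono) auto
    thus ?thesis by linarith
  qed
  thus ?thesis by (auto simp: base_vandermonde_def)
qed

lemma wronskian_series_nth_0: "fps_nth (wronskian_series t) 0 = of_int (base_vandermonde t)"
proof -
  have "{n \<in> charge_lattice t. total_energy t n = 0} = {restrict (\<lambda>_. 0) {..<t}}"
  proof (intro equalityI subsetI)
    fix n assume "n \<in> {n \<in> charge_lattice t. total_energy t n = 0}"
    hence n: "n \<in> charge_lattice t" "(\<Sum>i<t. energy t i (n i)) = 0" using int_total_energy[of t n] by auto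
    have "n i = 0" if "i < t" for i
    proof -
      have "\<bar>n i\<bar> \<le> energy t i (n i)" using that by (rule energy_ge_abs)
      also have "\<dots> \<le> (\<Sum>i<t. energy t i (n i))"
        using that by (intro member_le_sum) (auto intro: order_trans[OF abs_ge_zero energy_ge_abs])
      finally show ?thesis using n by simp
    qed
    thus "n \<in> {restrict (\<lambda>_. 0) {..<t}}" using n(1)
      by (auto simp: charge_lattice_def PiE_def extensional_def fun_eq_iff restrict_def)
  next
    fix n assume "n \<in> {restrict (\<lambda>_. 0::int) {..<t}}"
    thus "n \<in> {n \<in> charge_lattice t. total_energy t n = 0}" by (auto simp: charge_lattice_def total_energy_def energy_def)
  qed
  thus ?thesis by (simp add: wronskian_series_def lattice_vandermonde_def abscissa_def base_vandermonde_def)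
qed

text \<open>The analytic argument only gives the square of this identity; the constant terms fix the sign.\<close>

theorem wronskian_series_product:
  assumes t: "t > 0"
  shows "wronskian_series t * euler_fps 1 ^ (2 * t - 1) = fps_const (of_int (base_vandermonde t)) * euler_fps 2 ^ ((2 * t - 1) * (t + 1))"
proof -
  define c where "c = antiroot_const t ^ 2 * wronskian_factor t ^ 2"
  define b where "b = antiroot_det t ^ 2 * 4 ^ t"
  have c: "c \<noteq> 0" using antiroot_const_nonzero wronskian_factor_nonzero by (simp add: c_def)
  have radW: "fps_conv_radius (wronskian_series t) \<ge> 1"
    by (rule conv_radius_ge_1I) (auto intro!: sums_summable[OF wronskian_series_sums])
  have rad1: "fps_conv_radius (euler_fps 1 :: complex fps) \<ge> 1" by (rule conv_radius_euler_fps) simp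
  have rad2: "fps_conv_radius (euler_fps 2 :: complex fps) \<ge> 1" by (rule conv_radius_euler_fps) simp
  note rad = radW rad1 rad2
  have pw: "fps_conv_radius (F ^ n) \<ge> 1" if "fps_conv_radius F \<ge> 1" for F :: "complex fps" and n
    by (rule order_trans[OF that fps_conv_radius_power])
  have ml: "fps_conv_radius (F * G) \<ge> 1" if "fps_conv_radius F \<ge> 1" "fps_conv_radius G \<ge> 1" for F G :: "complex fps"
    by (rule order_trans[OF _ fps_conv_radius_mult]) (use that in simp)
  have cr: "fps_conv_radius (fps_const a) \<ge> 1" for a :: complex by simp
  have "fps_const c * (wronskian_series t ^ 2 * euler_fps 1 ^ (4 * t - 2)) = fps_const b * euler_fps 2 ^ (2 * ((2 * t - 1) * (t + 1)))"
  proof (rule fps_eqI_real)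
    show "1 \<le> fps_conv_radius (fps_const c * (wronskian_series t ^ 2 * euler_fps 1 ^ (4 * t - 2)))"
      by (intro ml pw cr rad)
    show "1 \<le> fps_conv_radius (fps_const b * euler_fps 2 ^ (2 * ((2 * t - 1) * (t + 1))) :: complex fps)"
      by (intro ml pw cr rad)
    fix r :: real assume r: "0 < r" "r < 1"
    define x where "x = complex_of_real r"
    have x: "x \<noteq> 0" "norm x < 1" using r by (auto simp: x_def)
    have lt: "ereal (norm x) < fps_conv_radius F" if "fps_conv_radius F \<ge> 1" for F :: "complex fps"
      by (rule less_le_trans[OF _ that]) (use x in simp)
    have total_energy: "eval_fps (euler_fps d) x = euler (x ^ d)" if "d > 0" for d
    proof -
      have "norm (x ^ d) < 1" using x that by (simp add: norm_power power_less_one_iff)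
      hence "qpoch (x ^ d) \<longlonglongrightarrow> euler (x ^ d)" by (rule euler)
      moreover have "qpoch (x ^ d) \<longlonglongrightarrow> eval_fps (euler_fps d) x"
        using eval_euler_fps(2)[OF that x(2)] unfolding qpoch_def[abs_def] eval_fps_def .
      ultimately show ?thesis by (rule LIMSEQ_unique[symmetric])
    qed
    have ew: "eval_fps (wronskian_series t) x = wronskian x t / wronskian_factor t"
      using sums_unique[OF wronskian_series_sums[OF x]] by (simp add: eval_fps_def)
    have "eval_fps (fps_const c * (wronskian_series t ^ 2 * euler_fps 1 ^ (4 * t - 2))) x = c * ((wronskian x t / wronskian_factor t) ^ 2 * euler (x ^ 1) ^ (4 * t - 2))"
      by (simp only: eval_fps_mult[OF lt lt] eval_fps_power[OF lt] eval_fps_const ml pw cr rad total_energy ew zero_less_one)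
    also have "\<dots> = antiroot_const t ^ 2 * (wronskian x t ^ 2 * euler x ^ (4 * t - 2))"
      using wronskian_factor_nonzero[of t] by (simp add: c_def power_divide)
    also have "\<dots> = b * euler (x ^ 2) ^ (2 * ((2 * t - 1) * (t + 1)))"
      unfolding x_def b_def by (rule wronskian_euler[OF r t])
    also have "\<dots> = eval_fps (fps_const b * euler_fps 2 ^ (2 * ((2 * t - 1) * (t + 1)))) x"
      by (simp only: eval_fps_mult[OF lt lt] eval_fps_power[OF lt] eval_fps_const ml pw cr rad total_energy zero_less_numeral)
    finally show "eval_fps (fps_const c * (wronskian_series t ^ 2 * euler_fps 1 ^ (4 * t - 2))) (of_real r)
      = eval_fps (fps_const b * euler_fps 2 ^ (2 * ((2 * t - 1) * (t + 1)))) (of_real r)" by (simp only: x_def)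
  qed
  note main = this
  have e0: "fps_nth (euler_fps d ^ n :: complex fps) 0 = 1" for d n by (simp add: fps_power_zeroth)
  \<comment> \<open>Comparing constant terms expresses \<open>b\<close> through \<open>c\<close>, so
    the constants belonging to the roots of -1 disappear.\<close>
  have "c * of_int (base_vandermonde t) ^ 2 = b"
    using arg_cong[OF main, of "\<lambda>F. fps_nth F 0"] by (simp add: e0 wronskian_series_nth_0 fps_power_zeroth)
  hence "fps_const c * (wronskian_series t ^ 2 * euler_fps 1 ^ (4 * t - 2)) = fps_const c * (fps_const (of_int (base_vandermonde t) ^ 2) * euler_fps 2 ^ (2 * ((2 * t - 1) * (t + 1))))"
    unfolding main by (simp only: mult.assoc[symmetric] fps_const_mult)
  hence "wronskian_series t ^ 2 * euler_fps 1 ^ (4 * t - 2) = fps_const (of_int (base_vandermonde t) ^ 2) * euler_fps 2 ^ (2 * ((2 * t - 1) * (t + 1)))"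
    using c by simp
  moreover have "4 * t - 2 = (2 * t - 1) * 2" by simp
  ultimately have "(wronskian_series t * euler_fps 1 ^ (2 * t - 1)) ^ 2 = (fps_const (of_int (base_vandermonde t)) * euler_fps 2 ^ ((2 * t - 1) * (t + 1))) ^ 2"
    by (simp only: power_mult_distrib fps_const_power power_mult[symmetric] mult.commute[of 2])
  thus ?thesis
    by (rule fps_const_square_cancel) (simp_all add: e0 wronskian_series_nth_0 base_vandermonde_nonzero)
qed

subsection \<open>Hook products of cores\<close>

text \<open>The hook product of the self-conjugate partition whose diagonal boxes have arm lengths \<open>A\<close>. The
  three factors come from the diagonal boxes, from the pairs of mirror boxes in diagonal rows and
  columns, whose hook length is \<open>a + b + 1\<close>, and from the remaining pairs, where a row beyond the
  Durfee square corresponds to some \<open>b \<notin> A\<close> and the hook length is \<open>a - b\<close>.\<close>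

definition hook_product :: "complex \<Rightarrow> nat set \<Rightarrow> complex" where
  "hook_product z A = (\<Prod>a\<in>A. 1 - 2 * z / of_nat (2 * a + 1))
     * (\<Prod>a\<in>A. \<Prod>b\<in>A \<inter> {..<a}. 1 - (2 * z)\<^sup>2 / of_nat (a + b + 1) ^ 2)
     * (\<Prod>a\<in>A. \<Prod>b\<in>{..<a} - A. 1 - (2 * z)\<^sup>2 / of_nat (a - b) ^ 2)"

text \<open>The factors attached to an arm a involve only numbers below a, so a new largest arm
  leaves them unchanged.\<close>

lemma hook_product_insert_max:
  assumes A: "finite A" and p: "\<And>a. a \<in> A \<Longrightarrow> a < p"
  shows "hook_product z (insert p A) = hook_product z A * ((1 - 2 * z / of_nat (2 * p + 1))
     * (\<Prod>b\<in>A. 1 - (2 * z)\<^sup>2 / of_nat (p + b + 1) ^ 2) * (\<Prod>b\<in>{..<p} - A. 1 - (2 * z)\<^sup>2 / of_nat (p - b) ^ 2))"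
proof -
  have pA: "p \<notin> A" using p by blast
  have 1: "insert p A \<inter> {..<a} = A \<inter> {..<a}" "{..<a} - insert p A = {..<a} - A" if "a \<in> A" for a
    using p[OF that] by auto
  have 2: "insert p A \<inter> {..<p} = A" "{..<p} - insert p A = {..<p} - A" using p by auto
  show ?thesis
    unfolding hook_product_def prod.insert[OF A pA] 2 using 1 by (simp add: mult_ac)
qed

text \<open>An abacus with \<open>2 * t\<close> runners: the position \<open>r + 2 * t * m - t\<close> lies on runner \<open>r\<close> at level \<open>m\<close>, and
  runner \<open>r\<close> is filled up to its top level. Positions \<open>s\<close> and \<open>- 1 - s\<close> are mirror images, so the
  charges \<open>n\<close> of the first \<open>t\<close> runners determine the others.\<close>

definition top_level :: "nat \<Rightarrow> (nat \<Rightarrow> int) \<Rightarrow> nat \<Rightarrow> int" where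
  "top_level t n r = (if r < t then n r else - 1 - n (2 * t - 1 - r))"

definition bead :: "nat \<Rightarrow> (nat \<Rightarrow> int) \<Rightarrow> int \<Rightarrow> bool" where
  "bead t n s \<longleftrightarrow> (s + int t) div (2 * int t) \<le> top_level t n (nat ((s + int t) mod (2 * int t)))"

definition core :: "nat \<Rightarrow> (nat \<Rightarrow> int) \<Rightarrow> nat set" where
  "core t n = {a. bead t n (int a)}"

lemma top_level_sym: "r < 2 * t \<Longrightarrow> top_level t n (2 * t - 1 - r) = - 1 - top_level t n r"
  by (auto simp: top_level_def)

lemma bead_iff:
  assumes t: "t > 0" and r: "r < 2 * t"
  shows "bead t n (int r + 2 * int t * m - int t) \<longleftrightarrow> m \<le> top_level t n r"
proof -
  have "(int r + 2 * int t * m - int t + int t) div (2 * int t) = m"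
    "(int r + 2 * int t * m - int t + int t) mod (2 * int t) = int r"
    using t r by simp_all
  thus ?thesis by (simp add: bead_def)
qed

lemma residue_split:
  assumes t: "t > 0"
  obtains r m where "r < 2 * t" "s = int r + 2 * int t * m - int t"
proof
  show "nat ((s + int t) mod (2 * int t)) < 2 * t" using t by (simp add: nat_less_iff)
  show "s = int (nat ((s + int t) mod (2 * int t))) + 2 * int t * ((s + int t) div (2 * int t)) - int t"
    using t by simp
qed

lemma residue_unique:
  assumes t: "t > 0" and "r < 2 * t" "r' < 2 * t" "int r + 2 * int t * m = int r' + 2 * int t * m'"
  shows "r = r' \<and> m = m'"
proof -
  have "(int r + 2 * int t * m) mod (2 * int t) = int r" "(int r' + 2 * int t * m') mod (2 * int t) = int r'"
    using t assms(2,3) by simp_all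
  hence "r = r'" using assms(4) by simp
  thus ?thesis using assms by simp
qed

text \<open>The offset t in the numbering makes the reflection s -> - 1 - s send runner r at level m
  to runner 2 * t - 1 - r at level - m.\<close>

lemma bead_sym:
  assumes t: "t > 0"
  shows "bead t n (- 1 - s) \<longleftrightarrow> \<not> bead t n s"
proof -
  obtain r m where r: "r < 2 * t" and s: "s = int r + 2 * int t * m - int t"
    by (rule residue_split[OF t])
  have s': "- 1 - s = int (2 * t - 1 - r) + 2 * int t * (- m) - int t" using r by (simp add: s)
  have r': "2 * t - 1 - r < 2 * t" using r by simp
  show ?thesis unfolding s' bead_iff[OF t r'] top_level_sym[OF r] unfolding s bead_iff[OF t r] by linarith
qed

lemma bead_core:
  assumes "t > 0"
  shows "bead t n s \<longleftrightarrow> (if s \<ge> 0 then nat s \<in> core t n else nat (- 1 - s) \<notin> core t n)"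
  using bead_sym[OF assms, of n s] by (auto simp: core_def)

text \<open>If s is the top bead of a runner, then 2 * (s + t) + 1 is the abscissa of its charge for
  the first t runners, and the negative of the mirror runner's abscissa for the others.\<close>

lemma core_bound:
  assumes t: "t > 0" and a: "a \<in> core t n"
  shows "\<exists>j<t. 2 * int a + 1 + 2 * int t \<le> \<bar>abscissa t j (n j)\<bar>"
proof -
  obtain r m where r: "r < 2 * t" and s: "int a = int r + 2 * int t * m - int t"
    by (rule residue_split[OF t])
  have "m \<le> top_level t n r" using a bead_iff[OF t r] by (simp add: core_def s)
  hence "2 * int t * m \<le> 2 * int t * top_level t n r" by (intro mult_left_mono) auto
  hence le: "2 * int a + 1 + 2 * int t \<le> 2 * int r + 1 + 4 * int t * top_level t n r" by (simp add: s)
  show ?thesis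
  proof (cases "r < t")
    case True
    thus ?thesis using le by (intro exI[of _ r]) (auto simp: top_level_def abscissa_def)
  next
    case False
    define j where "j = 2 * t - 1 - r"
    have j: "j < t" "int r = 2 * int t - 1 - int j" using False r by (auto simp: j_def)
    have NNr: "top_level t n r = - 1 - n j" using False by (simp add: top_level_def j_def)
    have "2 * int r + 1 + 4 * int t * top_level t n r = - abscissa t j (n j)"
      unfolding NNr abscissa_def j(2) by (simp add: algebra_simps)
    thus ?thesis using le j by (intro exI[of _ j]) auto
  qed
qed

lemma finite_core:
  assumes t: "t > 0"
  shows "finite (core t n)"
proof (rule finite_subset)
  show "core t n \<subseteq> {..nat (\<Sum>j<t. \<bar>abscissa t j (n j)\<bar>)}"
  proof
    fix a assume "a \<in> core t n"
    then obtain j where j: "j < t" "2 * int a + 1 + 2 * int t \<le> \<bar>abscissa t j (n j)\<bar>" using core_bound[OF t] by blast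
    have "\<bar>abscissa t j (n j)\<bar> \<le> (\<Sum>j<t. \<bar>abscissa t j (n j)\<bar>)" using j by (intro member_le_sum) auto
    hence "int a \<le> (\<Sum>j<t. \<bar>abscissa t j (n j)\<bar>)" using j by linarith
    thus "a \<in> {..nat (\<Sum>j<t. \<bar>abscissa t j (n j)\<bar>)}" by simp
  qed
qed auto

text \<open>Each factor is (y - T) * (y + T) / y^2 at y = c + T * k, so neighbours cancel and one
  boundary quotient remains at either end.\<close>

lemma telescope_product:
  fixes c T :: complex
  assumes "\<And>k::nat. c + T * of_nat k \<noteq> 0" "c - T \<noteq> 0"
  shows "(\<Prod>k<K. 1 - T\<^sup>2 / (c + T * of_nat k)\<^sup>2) = (c + T * of_nat K) * (c - T) / ((c + T * (of_nat K - 1)) * c)"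
proof (induction K)
  case 0
  show ?case using assms(1)[of 0] assms(2) by simp
next
  case (Suc K)
  define y where "y = c + T * of_nat K"
  have y: "y \<noteq> 0" using assms(1) by (simp add: y_def)
  have z: "y - T \<noteq> 0"
  proof (cases K)
    case (Suc K')
    thus ?thesis using assms(1)[of K'] by (simp add: y_def algebra_simps)
  qed (use assms in \<open>simp add: y_def\<close>)
  have c: "c \<noteq> 0" using assms(1)[of 0] by simp
  have e: "c + T * of_nat (Suc K) = y + T" "c + T * (of_nat (Suc K) - 1) = y" "c + T * (of_nat K - 1) = y - T"
    by (simp_all add: y_def algebra_simps)
  have "(\<Prod>k<Suc K. 1 - T\<^sup>2 / (c + T * of_nat k)\<^sup>2) = (y * (c - T) / ((y - T) * c)) * (1 - T\<^sup>2 / y\<^sup>2)"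
    using Suc by (simp add: e y_def[symmetric])
  also have "1 - T\<^sup>2 / y\<^sup>2 = (y - T) * (y + T) / (y * y)" using y by (simp add: field_simps power2_eq_square)
  also have "(y * (c - T) / ((y - T) * c)) * ((y - T) * (y + T) / (y * y)) = (y + T) * (c - T) / (y * c)"
    using y z c by (simp add: field_simps)
  finally show ?case by (simp only: e)
qed

text \<open>The distances from one bead to the beads of one runner: an arithmetic progression from
  its least positive term c up to Y. If - 2 * t < Y < 0 the progression is empty, Y = c - 2 * t, and
  the two quotients cancel.\<close>

lemma class_product:
  fixes t :: nat and Y :: int
  assumes t: "t > 0" and Y: "Y > - 2 * int t" and nd: "\<not> 2 * int t dvd Y"
  defines "c \<equiv> Y mod (2 * int t)"
  shows "(\<Prod>y | 0 < y \<and> y \<le> Y \<and> y mod (2 * int t) = c. 1 - (2 * of_nat t)\<^sup>2 / (of_int y :: complex)\<^sup>2)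
    = ((of_int Y + 2 * of_nat t) / of_int Y) * ((of_int c - 2 * of_nat t) / of_int c)"
proof -
  define D where "D = Y div (2 * int t)"
  define K where "K = nat (D + 1)"
  have c: "0 < c" "c < 2 * int t" using t nd by (auto simp: c_def dvd_eq_mod_eq_0 order_neq_le_trans)
  have YD: "Y = c + 2 * int t * D" by (simp add: c_def D_def)
  have "D \<ge> -1"
  proof (rule ccontr)
    assume "\<not> D \<ge> -1"
    hence "2 * int t * D \<le> 2 * int t * (-2)" by (intro mult_left_mono) auto
    thus False using YD Y c by linarith
  qed
  hence K: "int K = D + 1" by (simp add: K_def)
  have set: "{y. 0 < y \<and> y \<le> Y \<and> y mod (2 * int t) = c} = (\<lambda>k. c + 2 * int t * int k) ` {..<K}"
  proof (intro equalityI subsetI)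
    fix y assume "y \<in> {y. 0 < y \<and> y \<le> Y \<and> y mod (2 * int t) = c}"
    hence y: "0 < y" "y \<le> Y" "y mod (2 * int t) = c" by auto
    define k where "k = y div (2 * int t)"
    have yk: "y = c + 2 * int t * k" using y(3) by (metis k_def mod_mult_div_eq)
    have "k \<ge> 0" using y t by (simp add: k_def pos_imp_zdiv_nonneg_iff)
    moreover have "k \<le> D" unfolding k_def D_def using y t by (intro zdiv_mono1) auto
    ultimately show "y \<in> (\<lambda>k. c + 2 * int t * int k) ` {..<K}"
      using K by (intro image_eqI[of _ _ "nat k"]) (auto simp: yk)
  next
    fix y assume "y \<in> (\<lambda>k. c + 2 * int t * int k) ` {..<K}"
    then obtain k where k: "k < K" "y = c + 2 * int t * int k" by auto
    have "int k \<le> D" using k K by linarith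
    hence "2 * int t * int k \<le> 2 * int t * D" by (intro mult_left_mono) auto
    moreover have "y mod (2 * int t) = c" using c by (simp add: k)
    moreover have "y > 0" unfolding k(2) using c by (intro add_pos_nonneg) auto
    ultimately show "y \<in> {y. 0 < y \<and> y \<le> Y \<and> y mod (2 * int t) = c}" by (simp add: k YD)
  qed
  have inj: "inj_on (\<lambda>k. c + 2 * int t * int k) {..<K}" using t by (auto intro: inj_onI)
  have "(\<Prod>y | 0 < y \<and> y \<le> Y \<and> y mod (2 * int t) = c. 1 - (2 * of_nat t)\<^sup>2 / (of_int y :: complex)\<^sup>2)
    = (\<Prod>k<K. 1 - (2 * of_nat t)\<^sup>2 / (of_int c + 2 * of_nat t * of_nat k :: complex)\<^sup>2)"
    unfolding set by (subst prod.reindex[OF inj]) simp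
  also have "\<dots> = (of_int c + 2 * of_nat t * of_nat K) * (of_int c - 2 * of_nat t) / ((of_int c + 2 * of_nat t * (of_nat K - 1)) * of_int c)"
  proof (rule telescope_product)
    fix k :: nat
    have "c + 2 * int t * int k > 0" using c by (intro add_pos_nonneg) auto
    hence "(of_int (c + 2 * int t * int k) :: complex) \<noteq> 0" by (subst of_int_eq_0_iff) simp
    thus "of_int c + 2 * of_nat t * of_nat k \<noteq> (0::complex)" by simp
    have "(of_int (c - 2 * int t) :: complex) \<noteq> 0" using c by (subst of_int_eq_0_iff) simp
    thus "of_int c - 2 * of_nat t \<noteq> (0::complex)" by simp
  qed
  also have "(of_int c + 2 * of_nat t * of_nat K :: complex) = of_int Y + 2 * of_nat t"
  proof -
    have "of_int (c + 2 * int t * int K) = (of_int (Y + 2 * int t) :: complex)" by (simp add: K YD algebra_simps)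
    thus ?thesis by simp
  qed
  also have "(of_int c + 2 * of_nat t * (of_nat K - 1) :: complex) = of_int Y"
  proof -
    have "of_int (c + 2 * int t * (int K - 1)) = (of_int Y :: complex)" by (simp add: K YD)
    thus ?thesis by simp
  qed
  finally show ?thesis by simp
qed

text \<open>The substitution c -> 2 * t - c turns the numerators into the negated denominators, and
  their number 2 * t - 1 is odd.\<close>

lemma residue_ratio_product:
  assumes t: "t > 0"
  shows "(\<Prod>c\<in>{0<..<2 * int t}. (of_int c - 2 * of_nat t) / (of_int c :: complex)) = -1"
proof -
  have "(\<Prod>c\<in>{0<..<2 * int t}. (of_int c - 2 * of_nat t :: complex)) = (\<Prod>c\<in>{0<..<2 * int t}. - of_int c)"
    by (rule prod.reindex_bij_witness[of _ "\<lambda>c. 2 * int t - c" "\<lambda>c. 2 * int t - c"]) auto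
  also have "\<dots> = (-1) ^ card {0<..<2 * int t} * (\<Prod>c\<in>{0<..<2 * int t}. of_int c)"
    by (rule prod_uminus)
  also have "(-1::complex) ^ card {0<..<2 * int t} = -1"
  proof -
    have "card {0<..<2 * int t} = 2 * (t - 1) + 1" using t by simp
    thus ?thesis by simp
  qed
  finally have "(\<Prod>c\<in>{0<..<2 * int t}. (of_int c - 2 * of_nat t :: complex)) = - (\<Prod>c\<in>{0<..<2 * int t}. of_int c)" by simp
  moreover have "(\<Prod>c\<in>{0<..<2 * int t}. (of_int c :: complex)) \<noteq> 0" by auto
  ultimately show ?thesis by (simp add: prod_dividef)
qed

text \<open>The outermost bead moves down its runner by one step. Its interactions with the beads of any
  other runner telescope, leaving two boundary terms per runner.\<close>

lemma core_step:
  assumes t: "t > 0" and i: "i < t" and ni: "n i \<noteq> 0"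
    and mx: "\<And>j. j < t \<Longrightarrow> \<bar>abscissa t j (n j)\<bar> \<le> \<bar>abscissa t i (n i)\<bar>"
  defines "n' \<equiv> n(i := n i - sgn (n i))"
  shows "\<exists>p. core t n = insert p (core t n') \<and> (\<forall>a\<in>core t n'. a < p)
     \<and> energy t i (n i) = energy t i (n' i) + int (2 * p + 1)
     \<and> hook_product (of_nat t) (core t n) = - hook_product (of_nat t) (core t n')
        * (\<Prod>j\<in>{..<t} - {i}. (of_int (abscissa t i (n i)) ^ 2 - of_int (abscissa t j (n j)) ^ 2) / (of_int (abscissa t i (n' i)) ^ 2 - of_int (abscissa t j (n j)) ^ 2))"
proof -
  \<comment> \<open>Of the two mirror runners belonging to i, \<open>rp\<close> is the one whose top
    bead \<open>P\<close> is nonnegative.\<close>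
  define rp where "rp = (if n i > 0 then i else 2 * t - 1 - i)"
  define rs where "rs = 2 * t - 1 - rp"
  have rp: "rp < 2 * t" "rs < 2 * t" "rp \<noteq> rs" using i by (auto simp: rp_def rs_def)
  define P where "P = int rp + 2 * int t * top_level t n rp - int t"
  have NNp: "top_level t n rp = (if n i > 0 then n i else - 1 - n i)"
    using i ni by (auto simp: top_level_def rp_def)
  have PT: "P = int i + 2 * int t * n i - int t" if "n i > 0"
    unfolding P_def NNp using that by (simp add: rp_def)
  have PF: "P = (2 * int t - 1 - int i) + 2 * int t * (- 1 - n i) - int t" if "\<not> n i > 0"
    unfolding P_def NNp using that i by (simp add: rp_def of_nat_diff)
  have absV: "\<bar>abscissa t i (n i)\<bar> = 2 * P + 1 + 2 * int t"
  proof (cases "n i > 0")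
    case True
    hence "abscissa t i (n i) > 0" by (simp add: abscissa_def add_pos_nonneg)
    thus ?thesis using PT[OF True] by (simp add: abscissa_def)
  next
    case False
    hence "4 * int t * n i \<le> 4 * int t * (-1)" using ni by (intro mult_left_mono) auto
    hence "abscissa t i (n i) < 0" using i by (simp add: abscissa_def)
    thus ?thesis using PF[OF False] by (simp add: abscissa_def algebra_simps)
  qed
  have Vi': "\<bar>abscissa t i (n' i)\<bar> = \<bar>2 * P + 1 - 2 * int t\<bar>"
  proof (cases "n i > 0")
    case True
    thus ?thesis using PT[OF True] True by (simp add: abscissa_def n'_def algebra_simps)
  next
    case False
    hence "sgn (n i) = -1" using ni by simp
    moreover have "2 * P + 1 - 2 * int t = - abscissa t i (n i + 1)"
      using PF[OF False] by (simp add: abscissa_def algebra_simps)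
    ultimately show ?thesis by (simp add: n'_def)
  qed
  have P0: "P \<ge> 0"
  proof (cases "n i > 0")
    case True
    hence "2 * int t * 1 \<le> 2 * int t * n i" by (intro mult_left_mono) auto
    thus ?thesis using PT[OF True] by simp
  next
    case False
    hence "0 \<le> 2 * int t * (- 1 - n i)" using ni by (intro mult_nonneg_nonneg) auto
    thus ?thesis using PF[OF False] i by simp
  qed
  define p where "p = nat P"
  have p: "int p = P" using P0 by (simp add: p_def)
  \<comment> \<open>The bead moves down on \<open>rp\<close>; by symmetry a bead moves up on
    \<open>rs\<close>.\<close>
  have NN': "top_level t n' r = top_level t n r - (if r = rp then 1 else 0) + (if r = rs then 1 else 0)" if "r < 2 * t" for r
  proof -
    have "r < t \<Longrightarrow> r \<noteq> 2 * t - 1 - i" "\<not> r < t \<Longrightarrow> 2 * t - 1 - r = i \<longleftrightarrow> r = 2 * t - 1 - i" "2 * t - 1 - (2 * t - 1 - i) = i"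
      using i that by auto
    thus ?thesis using ni i unfolding top_level_def n'_def rp_def rs_def by (cases "n i > 0") auto
  qed
  have mem: "a \<in> core t n \<longleftrightarrow> a \<in> core t n' \<or> a = p" and pn: "p \<notin> core t n'" for a
  proof -
    have Prs: "- 1 - P = int rs + 2 * int t * (- top_level t n rp) - int t"
      using rp by (simp add: P_def rs_def of_nat_diff)
    have *: "bead t n s \<longleftrightarrow> bead t n' s \<or> s = P" if s: "s \<ge> 0" for s
    proof -
      obtain r m where r: "r < 2 * t" and sr: "s = int r + 2 * int t * m - int t"
        using residue_split[OF t, of s] by blast
      have sP: "s = P \<longleftrightarrow> r = rp \<and> m = top_level t n rp"
        unfolding sr P_def using residue_unique[OF t r rp(1), of m "top_level t n rp"] by auto
      have sPs: "r = rs \<Longrightarrow> m \<noteq> - top_level t n rp"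
        using Prs s P0 unfolding sr by auto
      have Ns: "top_level t n rs = - 1 - top_level t n rp" unfolding rs_def by (rule top_level_sym[OF rp(1)])
      show ?thesis unfolding sP unfolding sr bead_iff[OF t r] NN'[OF r]
        using sPs Ns rp(3) by auto
    qed
    show "a \<in> core t n \<longleftrightarrow> a \<in> core t n' \<or> a = p"
      using *[of "int a"] p by (auto simp: core_def)
    have "\<not> bead t n' P" unfolding P_def bead_iff[OF t rp(1)] NN'[OF rp(1)] using rp(3) by simp
    thus "p \<notin> core t n'" by (simp add: core_def p)
  qed
  have less: "a < p" if a: "a \<in> core t n'" for a
  proof -
    obtain j where j: "j < t" "2 * int a + 1 + 2 * int t \<le> \<bar>abscissa t j (n' j)\<bar>" using core_bound[OF t a] by blast
    have "\<bar>abscissa t j (n' j)\<bar> \<le> 2 * P + 1 + 2 * int t"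
    proof (cases "j = i")
      case True
      thus ?thesis using Vi' P0 t by auto
    next
      case False
      thus ?thesis using mx[OF j(1)] absV by (simp add: n'_def)
    qed
    hence "a \<le> p" using j p by linarith
    thus ?thesis using pn a by (metis le_neq_implies_less)
  qed
  have exs: "energy t i (n i) = energy t i (n' i) + int (2 * p + 1)"
  proof (cases "n i > 0")
    case True
    thus ?thesis using PT[OF True] True by (simp add: energy_def n'_def p power2_eq_square algebra_simps)
  next
    case False
    hence "sgn (n i) = -1" using ni by simp
    thus ?thesis using PF[OF False] by (simp add: energy_def n'_def p power2_eq_square algebra_simps)
  qed
  \<comment> \<open>The position of the top bead of runner r, measured from - 1 - P.\<close>
  define Y where "Y r = int r + 2 * int t * top_level t n' r - int t + P + 1" for r
  define g where "g y = 1 - (2 * of_nat t)\<^sup>2 / (of_int y :: complex)\<^sup>2" for y :: int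
  \<comment> \<open>An arm b enters with the distance P + b + 1, a gap b with P - b. In both cases
    there is a bead at y - P - 1, so the two kinds of factors merge into one product over distances
    y.\<close>
  define U where "U = {y. 0 < y \<and> bead t n' (y - P - 1)}"
  define U1 where "U1 = (\<lambda>b. P + int b + 1) ` core t n'"
  define U2 where "U2 = (\<lambda>b. P - int b) ` ({..<p} - core t n')"
  have fin: "finite (core t n')" by (rule finite_core[OF t])
  have Ueq: "U = U1 \<union> U2"
  proof (intro equalityI subsetI)
    fix y assume "y \<in> U"
    hence y: "0 < y" "bead t n' (y - P - 1)" by (auto simp: U_def)
    show "y \<in> U1 \<union> U2"
    proof (cases "y - P - 1 \<ge> 0")
      case True
      hence "nat (y - P - 1) \<in> core t n'" using y(2) bead_core[OF t] by simp
      thus ?thesis using True by (auto simp: U1_def intro!: image_eqI[of _ _ "nat (y - P - 1)"])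
    next
      case False
      hence "nat (- 1 - (y - P - 1)) \<notin> core t n'" using y(2) bead_core[OF t, of n' "y - P - 1"] by simp
      moreover have "- 1 - (y - P - 1) = P - y" by simp
      ultimately have "nat (P - y) \<in> {..<p} - core t n'" using y(1) False p by auto
      thus ?thesis using False by (intro UnI2) (auto simp: U2_def intro!: image_eqI[of _ _ "nat (P - y)"])
    qed
  next
    fix y assume "y \<in> U1 \<union> U2"
    thus "y \<in> U"
    proof
      assume "y \<in> U1"
      thus ?thesis using P0 by (auto simp: U1_def U_def core_def)
    next
      assume "y \<in> U2"
      then obtain b where b: "b < p" "b \<notin> core t n'" "y = P - int b" by (auto simp: U2_def)
      have "y - P - 1 = - 1 - int b" using b by simp
      hence "bead t n' (y - P - 1)" using b(2) bead_sym[OF t, of n' "int b"] by (simp only: core_def mem_Collect_eq simp_thms)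
      thus ?thesis using b p by (simp add: U_def)
    qed
  qed
  have finU: "finite U" unfolding Ueq U1_def U2_def using fin by auto
  have hp: "hook_product (of_nat t) (core t n) = hook_product (of_nat t) (core t n') * ((1 - 2 * of_nat t / of_nat (2 * p + 1)) * (\<Prod>y\<in>U. g y))"
  proof -
    have "core t n = insert p (core t n')" using mem by blast
    moreover have "(\<Prod>y\<in>U. g y) = (\<Prod>b\<in>core t n'. 1 - (2 * of_nat t)\<^sup>2 / of_nat (p + b + 1) ^ 2) * (\<Prod>b\<in>{..<p} - core t n'. 1 - (2 * of_nat t)\<^sup>2 / of_nat (p - b) ^ 2)"
    proof -
      have "(\<Prod>y\<in>U. g y) = (\<Prod>y\<in>U1. g y) * (\<Prod>y\<in>U2. g y)"
        unfolding Ueq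
      proof (rule prod.union_disjoint)
        show "U1 \<inter> U2 = {}" by (auto simp: U1_def U2_def)
      qed (auto simp: U1_def U2_def fin)
      also have "(\<Prod>y\<in>U1. g y) = (\<Prod>b\<in>core t n'. 1 - (2 * of_nat t)\<^sup>2 / of_nat (p + b + 1) ^ 2)"
        unfolding U1_def
      proof (subst prod.reindex)
        have "P + int b + 1 = int (p + b + 1)" for b using p by simp
        thus "prod (g \<circ> (\<lambda>b. P + int b + 1)) (core t n') = (\<Prod>b\<in>core t n'. 1 - (2 * of_nat t)\<^sup>2 / of_nat (p + b + 1) ^ 2)"
          by (simp only: o_def g_def of_int_of_nat_eq)
      qed (auto intro: inj_onI)
      also have "(\<Prod>y\<in>U2. g y) = (\<Prod>b\<in>{..<p} - core t n'. 1 - (2 * of_nat t)\<^sup>2 / of_nat (p - b) ^ 2)"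
        unfolding U2_def
      proof (subst prod.reindex)
        have "P - int b = int (p - b)" if "b < p" for b using p that by simp
        hence "g (P - int b) = 1 - (2 * of_nat t)\<^sup>2 / of_nat (p - b) ^ 2" if "b < p" for b
          using that by (simp only: g_def of_int_of_nat_eq)
        thus "prod (g \<circ> (\<lambda>b. P - int b)) ({..<p} - core t n') = (\<Prod>b\<in>{..<p} - core t n'. 1 - (2 * of_nat t)\<^sup>2 / of_nat (p - b) ^ 2)"
          by (intro prod.cong refl) auto
      qed (auto intro: inj_onI)
      finally show ?thesis .
    qed
    ultimately show ?thesis
      using hook_product_insert_max[OF fin less, of "of_nat t"] by (simp only: mult.assoc)
  qed
  have cls: "{y \<in> U. nat ((y - P - 1 + int t) mod (2 * int t)) = r} = {y. 0 < y \<and> y \<le> Y r \<and> y mod (2 * int t) = Y r mod (2 * int t)}"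
    if r: "r < 2 * t" for r
  proof (intro equalityI subsetI)
    fix y assume "y \<in> {y \<in> U. nat ((y - P - 1 + int t) mod (2 * int t)) = r}"
    hence y: "0 < y" "bead t n' (y - P - 1)" "nat ((y - P - 1 + int t) mod (2 * int t)) = r" by (auto simp: U_def)
    define m where "m = (y - P - 1 + int t) div (2 * int t)"
    have "(y - P - 1 + int t) mod (2 * int t) \<ge> 0" using t by simp
    hence yr: "y - P - 1 = int r + 2 * int t * m - int t"
      using y(3) mult_div_mod_eq[of "2 * int t" "y - P - 1 + int t"] unfolding m_def by linarith
    have m: "m \<le> top_level t n' r" using y(2) unfolding yr bead_iff[OF t r] .
    have Yy: "y = Y r + 2 * int t * (m - top_level t n' r)" using yr by (simp add: Y_def algebra_simps)
    have "2 * int t * (m - top_level t n' r) \<le> 0" using m by (intro mult_nonneg_nonpos) auto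
    thus "y \<in> {y. 0 < y \<and> y \<le> Y r \<and> y mod (2 * int t) = Y r mod (2 * int t)}"
      using y(1) Yy by simp
  next
    fix y assume "y \<in> {y. 0 < y \<and> y \<le> Y r \<and> y mod (2 * int t) = Y r mod (2 * int t)}"
    hence y: "0 < y" "y \<le> Y r" "y mod (2 * int t) = Y r mod (2 * int t)" by auto
    define D where "D = Y r div (2 * int t) - y div (2 * int t)"
    have D0: "D \<ge> 0" unfolding D_def using y t zdiv_mono1[of y "Y r" "2 * int t"] by simp
    have "y = Y r - 2 * int t * D"
      using y(3) mult_div_mod_eq[of "2 * int t" y] mult_div_mod_eq[of "2 * int t" "Y r"] by (simp add: D_def algebra_simps)
    hence yr: "y - P - 1 = int r + 2 * int t * (top_level t n' r - D) - int t" by (simp add: Y_def algebra_simps)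
    have "bead t n' (y - P - 1)" unfolding yr bead_iff[OF t r] using D0 by simp
    moreover have "nat ((y - P - 1 + int t) mod (2 * int t)) = r" unfolding yr using t r by simp
    ultimately show "y \<in> {y \<in> U. nat ((y - P - 1 + int t) mod (2 * int t)) = r}" using y by (simp add: U_def)
  qed
  \<comment> \<open>All positions from - 1 - P downwards are occupied, since every arm of the
    smaller core is below p. So the top bead of any runner lies above - 1 - P - 2 * t.\<close>
  have Ybound: "Y r > - 2 * int t" if r: "r < 2 * t" for r
  proof -
    define s where "s = int r + 2 * int t * ((- P - 1 - int r + int t) div (2 * int t)) - int t"
    have "(- P - 1 - int r + int t) mod (2 * int t) = - P - 1 - s"
      using mult_div_mod_eq[of "2 * int t" "- P - 1 - int r + int t"] unfolding s_def by linarith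
    moreover have "(- P - 1 - int r + int t) mod (2 * int t) \<ge> 0" "(- P - 1 - int r + int t) mod (2 * int t) < 2 * int t"
      using t by simp_all
    ultimately have s: "s \<le> - P - 1" "s > - P - 1 - 2 * int t" by auto
    have "nat (- 1 - s) \<notin> core t n'" using less[of "nat (- 1 - s)"] s p by auto
    hence "bead t n' s" using s P0 bead_core[OF t, of n' s] by simp
    hence "(- P - 1 - int r + int t) div (2 * int t) \<le> top_level t n' r"
      unfolding s_def bead_iff[OF t r] .
    hence "2 * int t * ((- P - 1 - int r + int t) div (2 * int t)) \<le> 2 * int t * top_level t n' r" by (intro mult_left_mono) auto
    thus ?thesis using s(2) unfolding s_def Y_def by linarith
  qed
  \<comment> \<open>The mirror runner now ends exactly at - 1 - P and contributes no positive
    distance.\<close>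
  have Yrs: "Y rs = 0"
  proof -
    have "top_level t n' rs = - top_level t n rp" using NN'[OF rp(2)] rp(3) top_level_sym[OF rp(1)] by (simp add: rs_def)
    thus ?thesis using rp by (simp add: Y_def P_def rs_def of_nat_diff)
  qed
  have Yrp: "Y rp = 2 * P + 1 - 2 * int t"
    unfolding Y_def NN'[OF rp(1)] using rp(3) by (simp add: P_def algebra_simps)
  have nd: "\<not> 2 * int t dvd Y r" if r: "r < 2 * t" "r \<noteq> rs" for r
  proof
    assume "2 * int t dvd Y r"
    hence "2 * int t dvd Y r - Y rs" using Yrs by simp
    moreover have "Y r - Y rs = (int r - int rs) + 2 * int t * (top_level t n' r - top_level t n' rs)" by (simp add: Y_def algebra_simps)
    ultimately have "2 * int t dvd int r - int rs" by (metis dvd_add_left_iff dvd_triv_left)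
    moreover have "\<bar>int r - int rs\<bar> < 2 * int t" using r rp by auto
    ultimately have "int r - int rs = 0" by (meson dvd_imp_le_int linorder_not_le abs_of_nat zdvd_not_zless zero_less_abs_iff dvd_abs_iff)
    thus False using r by simp
  qed
  \<comment> \<open>The runners have distinct residues and \<open>rs\<close> has residue 0, so the
    others run once through all nonzero residues; the lower boundary quotients thus multiply to
    -1.\<close>
  have cbij: "bij_betw (\<lambda>r. Y r mod (2 * int t)) ({..<2 * t} - {rs}) {0<..<2 * int t}"
  proof -
    have inj: "inj_on (\<lambda>r. Y r mod (2 * int t)) ({..<2 * t} - {rs})"
    proof (rule inj_onI)
      fix r r' assume rr: "r \<in> {..<2 * t} - {rs}" "r' \<in> {..<2 * t} - {rs}" "Y r mod (2 * int t) = Y r' mod (2 * int t)"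
      hence "2 * int t dvd Y r - Y r'" by (simp add: mod_eq_dvd_iff)
      moreover have "Y r - Y r' = (int r - int r') + 2 * int t * (top_level t n' r - top_level t n' r')" by (simp add: Y_def algebra_simps)
      ultimately have "2 * int t dvd int r - int r'" by (metis dvd_add_left_iff dvd_triv_left)
      hence "int r mod (2 * int t) = int r' mod (2 * int t)" by (simp add: mod_eq_dvd_iff)
      thus "r = r'" using rr by simp
    qed
    moreover have "(\<lambda>r. Y r mod (2 * int t)) ` ({..<2 * t} - {rs}) = {0<..<2 * int t}"
    proof (rule card_subset_eq)
      show "(\<lambda>r. Y r mod (2 * int t)) ` ({..<2 * t} - {rs}) \<subseteq> {0<..<2 * int t}"
      proof (rule image_subsetI)
        fix r assume "r \<in> {..<2 * t} - {rs}"
        hence "Y r mod (2 * int t) \<noteq> 0" using nd[of r] by (auto simp: dvd_eq_mod_eq_0)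
        moreover have "Y r mod (2 * int t) \<ge> 0" "Y r mod (2 * int t) < 2 * int t" using t by simp_all
        ultimately show "Y r mod (2 * int t) \<in> {0<..<2 * int t}" by simp
      qed
      show "card ((\<lambda>r. Y r mod (2 * int t)) ` ({..<2 * t} - {rs})) = card {0<..<2 * int t}"
        unfolding card_image[OF inj] using rp by (simp add: nat_diff_distrib nat_mult_distrib)
    qed auto
    ultimately show ?thesis by (simp add: bij_betw_def)
  qed
  \<comment> \<open>The upper boundary quotient. That of \<open>rp\<close> is kept apart; the value
    1 at \<open>rp\<close> and \<open>rs\<close> lets the product be arranged in mirror pairs from
    which the pair of i drops out.\<close>
  define f where "f r = (if r = rs \<or> r = rp then 1 else (of_int (Y r) + 2 * of_nat t) / (of_int (Y r) :: complex))" for r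
  have Yne: "(of_int (Y r) :: complex) \<noteq> 0" if "r < 2 * t" "r \<noteq> rs" for r
    using nd[OF that] by auto
  have "(\<Prod>y\<in>U. g y) = (\<Prod>r<2*t. \<Prod>y\<in>{y \<in> U. nat ((y - P - 1 + int t) mod (2 * int t)) = r}. g y)"
    by (rule prod.group[symmetric]) (use finU t in \<open>auto simp: nat_less_iff\<close>)
  also have "\<dots> = (\<Prod>r<2*t. \<Prod>y | 0 < y \<and> y \<le> Y r \<and> y mod (2 * int t) = Y r mod (2 * int t). g y)"
    by (intro prod.cong) (simp_all add: cls)
  also have "\<dots> = (\<Prod>r\<in>{..<2*t} - {rs}. \<Prod>y | 0 < y \<and> y \<le> Y r \<and> y mod (2 * int t) = Y r mod (2 * int t). g y)"
  proof (rule prod.mono_neutral_right)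
    have "{y. 0 < y \<and> y \<le> Y rs \<and> y mod (2 * int t) = Y rs mod (2 * int t)} = {}" using Yrs by auto
    show "\<forall>r\<in>{..<2*t} - ({..<2*t} - {rs}). (\<Prod>y | 0 < y \<and> y \<le> Y r \<and> y mod (2 * int t) = Y r mod (2 * int t). g y) = 1"
    proof
      fix r assume "r \<in> {..<2*t} - ({..<2*t} - {rs})"
      hence "r = rs" by auto
      thus "(\<Prod>y | 0 < y \<and> y \<le> Y r \<and> y mod (2 * int t) = Y r mod (2 * int t). g y) = 1"
        using \<open>{y. 0 < y \<and> y \<le> Y rs \<and> y mod (2 * int t) = Y rs mod (2 * int t)} = {}\<close> by (simp only: prod.empty)
    qed
  qed auto
  also have "\<dots> = (\<Prod>r\<in>{..<2*t} - {rs}. ((of_int (Y r) + 2 * of_nat t) / of_int (Y r)) * ((of_int (Y r mod (2 * int t)) - 2 * of_nat t) / of_int (Y r mod (2 * int t))))"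
    unfolding g_def by (intro prod.cong refl class_product t Ybound nd) auto
  also have "\<dots> = (\<Prod>r\<in>{..<2*t} - {rs}. (of_int (Y r) + 2 * of_nat t) / of_int (Y r)) * (\<Prod>r\<in>{..<2*t} - {rs}. (of_int (Y r mod (2 * int t)) - 2 * of_nat t) / of_int (Y r mod (2 * int t)))"
    by (rule prod.distrib)
  also have "(\<Prod>r\<in>{..<2*t} - {rs}. (of_int (Y r mod (2 * int t)) - 2 * of_nat t) / (of_int (Y r mod (2 * int t)) :: complex)) = -1"
    using prod.reindex_bij_betw[OF cbij, of "\<lambda>c. (of_int c - 2 * of_nat t) / (of_int c :: complex)"] residue_ratio_product[OF t] by simp
  also have "(\<Prod>r\<in>{..<2*t} - {rs}. (of_int (Y r) + 2 * of_nat t) / (of_int (Y r) :: complex)) = ((of_int (Y rp) + 2 * of_nat t) / of_int (Y rp)) * (\<Prod>r\<in>{..<2*t} - {rs}. f r)"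
  proof -
    have rpin: "rp \<in> {..<2*t} - {rs}" using rp by auto
    have "(\<Prod>r\<in>{..<2*t} - {rs} - {rp}. (of_int (Y r) + 2 * of_nat t) / (of_int (Y r) :: complex)) = (\<Prod>r\<in>{..<2*t} - {rs} - {rp}. f r)"
      by (intro prod.cong refl) (auto simp: f_def)
    moreover have "f rp = 1" by (simp add: f_def)
    ultimately show ?thesis
      by (simp add: prod.remove[OF _ rpin])
  qed
  also have "(\<Prod>r\<in>{..<2*t} - {rs}. f r) = (\<Prod>r<2*t. f r)"
    by (rule prod.mono_neutral_left) (auto simp: f_def)
  also have "(\<Prod>r<2*t. f r) = (\<Prod>j<t. f j * f (2 * t - 1 - j))"
  proof -
    have "(\<Prod>r<2*t. f r) = (\<Prod>j<t. f j) * (\<Prod>j<t. f (t + j))" unfolding mult_2 by (rule prod_lessThan_add)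
    also have "(\<Prod>j<t. f (t + j)) = (\<Prod>j<t. f (t + (t - Suc j)))" by (rule prod.nat_diff_reindex[symmetric])
    also have "\<dots> = (\<Prod>j<t. f (2 * t - 1 - j))" by (intro prod.cong refl arg_cong[of _ _ f]) auto
    finally show ?thesis by (simp only: prod.distrib)
  qed
  also have "\<dots> = (\<Prod>j\<in>{..<t} - {i}. f j * f (2 * t - 1 - j))"
  proof (rule prod.mono_neutral_right)
    have "i = rs \<or> i = rp" "2 * t - 1 - i = rs \<or> 2 * t - 1 - i = rp" using i by (auto simp: rs_def rp_def)
    thus "\<forall>j\<in>{..<t} - ({..<t} - {i}). f j * f (2 * t - 1 - j) = 1" by (auto simp: f_def)
  qed auto
  also have "\<dots> = (\<Prod>j\<in>{..<t} - {i}. (of_int (abscissa t i (n i)) ^ 2 - of_int (abscissa t j (n j)) ^ 2) / (of_int (abscissa t i (n' i)) ^ 2 - of_int (abscissa t j (n j)) ^ 2))"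
  proof (intro prod.cong refl)
    fix j assume "j \<in> {..<t} - {i}"
    hence j: "j < t" "j \<noteq> i" by auto
    define j' where "j' = 2 * t - 1 - j"
    have ne: "j \<noteq> rs" "j \<noteq> rp" "j' \<noteq> rs" "j' \<noteq> rp" and j'2: "j' < 2 * t" using i j by (auto simp: rs_def rp_def j'_def split: if_splits)
    define a b V where "a = (of_int (Y j) :: complex)" and "b = (of_int (Y j') :: complex)" and "V = (of_int (abscissa t j (n j)) :: complex)"
    define W where "W = (of_int (2 * P + 1 - 2 * int t) :: complex)"
    have NNj: "top_level t n' j = n j" "top_level t n' j' = - 1 - n j"
      using j i by (auto simp: top_level_def n'_def j'_def)
    \<comment> \<open>For a mirror pair of runners, the doubled distances are W + V and W - V, so
      their boundary quotients combine to a quotient of differences of squares.\<close>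
    have "2 * Y j = abscissa t j (n j) + (2 * P + 1 - 2 * int t)"
      unfolding Y_def NNj abscissa_def by (simp add: algebra_simps)
    hence "of_int (2 * Y j) = (of_int (abscissa t j (n j) + (2 * P + 1 - 2 * int t)) :: complex)" by (simp only:)
    hence a: "2 * a = V + W" by (simp add: a_def V_def W_def)
    have "int j' = 2 * int t - 1 - int j" using j by (simp add: j'_def)
    hence "2 * Y j' = - abscissa t j (n j) + (2 * P + 1 - 2 * int t)"
      unfolding Y_def NNj abscissa_def by (simp add: algebra_simps)
    hence "of_int (2 * Y j') = (of_int (- abscissa t j (n j) + (2 * P + 1 - 2 * int t)) :: complex)" by (simp only:)
    hence b: "2 * b = W - V" by (simp add: b_def V_def W_def)
    have nz: "a \<noteq> 0" "b \<noteq> 0" unfolding a_def b_def using Yne ne j j'2 by auto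
    have Wn: "of_int (abscissa t i (n i)) ^ 2 = (W + 4 * of_nat t) ^ 2"
    proof -
      have "(abscissa t i (n i))\<^sup>2 = (2 * P + 1 - 2 * int t + 4 * int t)\<^sup>2"
        using arg_cong[OF absV, of "\<lambda>x. x\<^sup>2"] by (simp add: algebra_simps)
      hence "of_int ((abscissa t i (n i))\<^sup>2) = (of_int ((2 * P + 1 - 2 * int t + 4 * int t)\<^sup>2) :: complex)" by (simp only:)
      thus ?thesis by (simp add: W_def)
    qed
    have Wo: "of_int (abscissa t i (n' i)) ^ 2 = W ^ 2"
    proof -
      have "(abscissa t i (n' i))\<^sup>2 = (2 * P + 1 - 2 * int t)\<^sup>2" using Vi' by (metis power2_abs)
      hence "of_int ((abscissa t i (n' i))\<^sup>2) = (of_int ((2 * P + 1 - 2 * int t)\<^sup>2) :: complex)" by (simp only:)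
      thus ?thesis by (simp add: W_def)
    qed
    have "f j * f (2 * t - 1 - j) = ((a + 2 * of_nat t) / a) * ((b + 2 * of_nat t) / b)"
      using ne by (simp add: f_def a_def b_def j'_def)
    also have "\<dots> = ((2 * (a + 2 * of_nat t)) * (2 * (b + 2 * of_nat t))) / ((2 * a) * (2 * b))"
      using nz by (simp add: field_simps)
    also have "2 * (a + 2 * of_nat t) = V + (W + 4 * of_nat t)" unfolding distrib_left a by simp
    also have "2 * (b + 2 * of_nat t) = (W + 4 * of_nat t) - V" unfolding distrib_left b by simp
    also have "(V + (W + 4 * of_nat t)) * ((W + 4 * of_nat t) - V) / ((2 * a) * (2 * b)) = ((W + 4 * of_nat t) ^ 2 - V ^ 2) / (W ^ 2 - V ^ 2)"
      unfolding a b by (simp add: power2_eq_square algebra_simps)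
    finally show "f j * f (2 * t - 1 - j) = (of_int (abscissa t i (n i)) ^ 2 - of_int (abscissa t j (n j)) ^ 2) / (of_int (abscissa t i (n' i)) ^ 2 - of_int (abscissa t j (n j)) ^ 2)"
      unfolding Wn Wo V_def .
  qed
  finally have prodU: "(\<Prod>y\<in>U. g y) = (of_int (Y rp) + 2 * of_nat t) / of_int (Y rp)
     * (\<Prod>j\<in>{..<t} - {i}. (of_int (abscissa t i (n i)) ^ 2 - of_int (abscissa t j (n j)) ^ 2) / (of_int (abscissa t i (n' i)) ^ 2 - of_int (abscissa t j (n j)) ^ 2)) * - 1" .
  \<comment> \<open>The boundary quotient of \<open>rp\<close> has numerator 2 * p + 1 and is
    inverse to the diagonal factor of the new arm p.\<close>
  have cancel: "(1 - 2 * of_nat t / of_nat (2 * p + 1)) * ((of_int (Y rp) + 2 * of_nat t) / (of_int (Y rp) :: complex)) = 1"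
  proof -
    define q where "q = (of_nat (2 * p + 1) :: complex)"
    have "of_int (Y rp) = (of_int (2 * int p + 1 - 2 * int t) :: complex)" unfolding Yrp p ..
    hence y: "of_int (Y rp) = q - 2 * of_nat t" by (simp add: q_def)
    have "q \<noteq> 0" unfolding q_def by (subst of_nat_eq_0_iff) simp
    moreover have "q - 2 * of_nat t \<noteq> 0" using Yne[OF rp(1) rp(3)] unfolding y .
    ultimately show ?thesis unfolding y q_def[symmetric] by (simp add: field_simps)
  qed
  have "hook_product (of_nat t) (core t n) = hook_product (of_nat t) (core t n') * (((1 - 2 * of_nat t / of_nat (2 * p + 1)) * ((of_int (Y rp) + 2 * of_nat t) / (of_int (Y rp) :: complex)))
     * (\<Prod>j\<in>{..<t} - {i}. (of_int (abscissa t i (n i)) ^ 2 - of_int (abscissa t j (n j)) ^ 2) / (of_int (abscissa t i (n' i)) ^ 2 - of_int (abscissa t j (n j)) ^ 2)) * - 1)"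
    unfolding hp prodU by (simp only: mult.assoc)
  also have "\<dots> = - hook_product (of_nat t) (core t n') * (\<Prod>j\<in>{..<t} - {i}. (of_int (abscissa t i (n i)) ^ 2 - of_int (abscissa t j (n j)) ^ 2) / (of_int (abscissa t i (n' i)) ^ 2 - of_int (abscissa t j (n j)) ^ 2))"
    unfolding cancel by simp
  finally show ?thesis
    using mem less exs by (intro exI[of _ p]) blast
qed

text \<open>Only the pairs containing i change, and they are oriented alike for \<open>f\<close> and
  \<open>g\<close>, so the orientation signs agree. The cross-multiplied form suits the induction,
  as it involves no division.\<close>

lemma vandermonde_update:
  fixes f g :: "nat \<Rightarrow> 'a :: comm_ring_1"
  assumes "i < t" and "\<And>j. j < t \<Longrightarrow> j \<noteq> i \<Longrightarrow> g j = f j"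
  shows "(\<Prod>b<t. \<Prod>a<b. g b - g a) * (\<Prod>j\<in>{..<t} - {i}. f i - f j) = (\<Prod>b<t. \<Prod>a<b. f b - f a) * (\<Prod>j\<in>{..<t} - {i}. g i - g j)"
  using assms
proof (induction t)
  case 0
  thus ?case by simp
next
  case (Suc t)
  show ?case
  proof (cases "i = t")
    case True
    have gf: "g j = f j" if "j < t" for j using Suc.prems(2)[of j] True that by simp
    have "(\<Prod>b<t. \<Prod>a<b. g b - g a) = (\<Prod>b<t. \<Prod>a<b. f b - f a)"
      by (intro prod.cong refl) (auto simp: gf)
    moreover have "{..<Suc t} - {i} = {..<t}" using True by auto
    moreover have "(\<Prod>a<t. g t - g a) = (\<Prod>a<t. g t - f a)" by (intro prod.cong refl) (auto simp: gf)
    ultimately show ?thesis using True by (simp add: mult_ac)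
  next
    case False
    hence it: "i < t" using Suc.prems(1) by simp
    have IH: "(\<Prod>b<t. \<Prod>a<b. g b - g a) * (\<Prod>j\<in>{..<t} - {i}. f i - f j) = (\<Prod>b<t. \<Prod>a<b. f b - f a) * (\<Prod>j\<in>{..<t} - {i}. g i - g j)"
      using Suc.prems(2) by (intro Suc.IH it) auto
    have gt: "g t = f t" using Suc.prems(2)[of t] it by simp
    define R where "R = (\<Prod>a\<in>{..<t} - {i}. f t - f a)"
    have "(\<Prod>a<t. g t - g a) = (g t - g i) * (\<Prod>a\<in>{..<t} - {i}. g t - g a)"
      using it by (subst prod.remove[of _ i]) auto
    also have "(\<Prod>a\<in>{..<t} - {i}. g t - g a) = R"
      unfolding R_def gt using Suc.prems(2) by (intro prod.cong refl) auto
    finally have 1: "(\<Prod>a<t. g t - g a) = (f t - g i) * R" by (simp only: gt)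
    have 2: "(\<Prod>a<t. f t - f a) = (f t - f i) * R"
      unfolding R_def using it by (subst prod.remove[of _ i]) auto
    have set: "{..<Suc t} - {i} = insert t ({..<t} - {i})" using it by auto
    have 3: "(\<Prod>j\<in>{..<Suc t} - {i}. f i - f j) = (f i - f t) * (\<Prod>j\<in>{..<t} - {i}. f i - f j)"
      "(\<Prod>j\<in>{..<Suc t} - {i}. g i - g j) = (g i - f t) * (\<Prod>j\<in>{..<t} - {i}. g i - g j)"
      unfolding set by (simp_all add: gt)
    define a b c d where "a = (\<Prod>b<t. \<Prod>a<b. g b - g a)" and "b = (\<Prod>j\<in>{..<t} - {i}. f i - f j)"
      and "c = (\<Prod>b<t. \<Prod>a<b. f b - f a)" and "d = (\<Prod>j\<in>{..<t} - {i}. g i - g j)"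
    have ab: "a * b = c * d" unfolding a_def b_def c_def d_def by (rule IH)
    have "(a * ((f t - g i) * R)) * ((f i - f t) * b) = (a * b) * (((f t - g i) * R) * (f i - f t))" by (simp only: mult_ac)
    also have "\<dots> = (c * ((f t - f i) * R)) * ((g i - f t) * d)" unfolding ab by (simp add: algebra_simps)
    finally show ?thesis unfolding 3 prod.lessThan_Suc 1 2 a_def b_def c_def d_def .
  qed
qed

text \<open>Equality up to sign would make 2 * t divide i - j or i + j + 1, but both are nonzero and
  smaller than 2 * t in absolute value.\<close>

lemma abscissa_square_neq:
  assumes "i < t" "j < t" "i \<noteq> j"
  shows "(abscissa t i k)\<^sup>2 \<noteq> (abscissa t j l)\<^sup>2"
proof
  assume "(abscissa t i k)\<^sup>2 = (abscissa t j l)\<^sup>2"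
  hence "abscissa t i k = abscissa t j l \<or> abscissa t i k = - abscissa t j l" by (simp add: power2_eq_iff)
  thus False
  proof
    assume "abscissa t i k = abscissa t j l"
    hence "int i - int j = 2 * int t * (l - k)" by (simp add: abscissa_def algebra_simps)
    hence "2 * int t dvd int i - int j" by simp
    hence "int i mod (2 * int t) = int j mod (2 * int t)" by (simp add: mod_eq_dvd_iff)
    thus False using assms by simp
  next
    assume "abscissa t i k = - abscissa t j l"
    hence "int i + int j + 1 = 2 * int t * (- l - k)" by (simp add: abscissa_def algebra_simps)
    hence "2 * int t dvd int i + int j + 1" by simp
    hence "2 * int t \<le> int i + int j + 1" by (rule zdvd_imp_le) simp
    thus False using assms by linarith
  qed
qed

lemma lattice_vandermonde_nonzero: "lattice_vandermonde t n \<noteq> 0"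
proof -
  have "(\<Prod>i<j. (abscissa t j (n j))\<^sup>2 - (abscissa t i (n i))\<^sup>2) \<noteq> 0" if "j < t" for j
  proof -
    have "(abscissa t j (n j))\<^sup>2 - (abscissa t i (n i))\<^sup>2 \<noteq> 0" if "i < j" for i
      using abscissa_square_neq[of j t i "n j" "n i"] \<open>j < t\<close> that by simp
    thus ?thesis by simp
  qed
  thus ?thesis by (simp add: lattice_vandermonde_def)
qed

text \<open>Induction on the total absolute charge, lowering one bead at a time. By
  \<open>core_step\<close> a step replaces one node of the Vandermonde product and adds 2 * p + 1 to
  the weight; its minus sign is that of the changed cardinality. For zero charges the core is
  empty.\<close>

lemma core_evaluation:
  assumes t: "t > 0"
  shows "(-1) ^ card (core t n) * hook_product (of_nat t) (core t n) * of_int (base_vandermonde t) = of_int (lattice_vandermonde t n)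
    \<and> (\<Sum>a\<in>core t n. 2 * a + 1) = total_energy t n"
proof (induction "\<Sum>i<t. nat \<bar>n i\<bar>" arbitrary: n rule: less_induct)
  case less
  show ?case
  proof (cases "\<forall>i<t. n i = 0")
    case True
    have "core t n = {}"
    proof (rule equals0I)
      fix a assume "a \<in> core t n"
      then obtain j where "j < t" "2 * int a + 1 + 2 * int t \<le> \<bar>abscissa t j (n j)\<bar>" using core_bound[OF t] by blast
      thus False using True by (simp add: abscissa_def)
    qed
    moreover have "lattice_vandermonde t n = base_vandermonde t" using True by (simp add: lattice_vandermonde_def base_vandermonde_def abscissa_def)
    moreover have "total_energy t n = 0" using True by (simp add: total_energy_def energy_def)
    ultimately show ?thesis by (simp add: hook_product_def)
  next
    case False
    then obtain l where l: "l < t" "n l \<noteq> 0" by blast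
    \<comment> \<open>The largest absolute abscissa marks the outermost bead, the one that
      \<open>core_step\<close> moves.\<close>
    define i where "i = (ARG_MAX (\<lambda>j. nat \<bar>abscissa t j (n j)\<bar>) j. j < t)"
    have "i < t \<and> (\<forall>j<t. nat \<bar>abscissa t j (n j)\<bar> \<le> nat \<bar>abscissa t i (n i)\<bar>)"
      unfolding i_def
    proof (rule arg_max_nat_lemma)
      show "0 < t" by fact
      show "\<forall>j. j < t \<longrightarrow> nat \<bar>abscissa t j (n j)\<bar> < Suc (\<Sum>j<t. nat \<bar>abscissa t j (n j)\<bar>)"
        by (auto simp: less_Suc_eq_le intro!: member_le_sum[of _ "{..<t}" "\<lambda>j. nat \<bar>abscissa t j (n j)\<bar>"])
    qed
    hence i: "i < t" and mx: "\<And>j. j < t \<Longrightarrow> \<bar>abscissa t j (n j)\<bar> \<le> \<bar>abscissa t i (n i)\<bar>" by auto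
    have ni: "n i \<noteq> 0"
    \<comment> \<open>Charge 0 gives an absolute abscissa below 2 * t, any other charge one above 2
      * t.\<close>
    proof
      assume "n i = 0"
      hence le: "\<bar>abscissa t l (n l)\<bar> < 2 * int t" using mx[OF l(1)] i by (simp add: abscissa_def)
      have "4 * int t * 1 \<le> 4 * int t * \<bar>n l\<bar>" using l by (intro mult_left_mono) auto
      hence "4 * int t \<le> \<bar>4 * int t * n l\<bar>" by (simp add: abs_mult)
      thus False using le l(1) unfolding abscissa_def by linarith
    qed
    define n' where "n' = n(i := n i - sgn (n i))"
    from core_step[OF t i ni mx] obtain p where
      co: "core t n = insert p (core t n')" and p: "\<forall>a\<in>core t n'. a < p"
      and exs: "energy t i (n i) = energy t i (n' i) + int (2 * p + 1)"
      and hp: "hook_product (of_nat t) (core t n) = - hook_product (of_nat t) (core t n')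
        * (\<Prod>j\<in>{..<t} - {i}. (of_int (abscissa t i (n i)) ^ 2 - of_int (abscissa t j (n j)) ^ 2) / (of_int (abscissa t i (n' i)) ^ 2 - of_int (abscissa t j (n j)) ^ 2))"
      unfolding n'_def by blast
    have off: "n' j = n j" if "j \<noteq> i" for j using that by (simp add: n'_def)
    have "(\<Sum>j<t. nat \<bar>n' j\<bar>) < (\<Sum>j<t. nat \<bar>n j\<bar>)"
    proof (rule sum_strict_mono_ex1)
      have "nat \<bar>n' i\<bar> < nat \<bar>n i\<bar>" using ni by (auto simp: n'_def sgn_if)
      thus "\<exists>j\<in>{..<t}. nat \<bar>n' j\<bar> < nat \<bar>n j\<bar>" "\<forall>j\<in>{..<t}. nat \<bar>n' j\<bar> \<le> nat \<bar>n j\<bar>"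
        using i off by (auto, metis less_imp_le_nat order_refl)
    qed auto
    from less[OF this] have IH: "(-1) ^ card (core t n') * hook_product (of_nat t) (core t n') * of_int (base_vandermonde t) = of_int (lattice_vandermonde t n')"
      "(\<Sum>a\<in>core t n'. 2 * a + 1) = total_energy t n'" by auto
    have pn: "p \<notin> core t n'" using p by blast
    have fin: "finite (core t n')" by (rule finite_core[OF t])
    define f g where "f j = (of_int (abscissa t j (n j)) ^ 2 :: complex)" and "g j = (of_int (abscissa t j (n' j)) ^ 2 :: complex)" for j
    have gf: "g j = f j" if "j < t" "j \<noteq> i" for j using off[OF that(2)] by (simp add: f_def g_def)
    have vdf: "of_int (lattice_vandermonde t n) = (\<Prod>b<t. \<Prod>a<b. f b - f a)" "of_int (lattice_vandermonde t n') = (\<Prod>b<t. \<Prod>a<b. g b - g a)"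
      by (simp_all add: lattice_vandermonde_def f_def g_def)
    have nz: "g i - g j \<noteq> 0" if "j \<in> {..<t} - {i}" for j
    proof -
      have "(of_int ((abscissa t i (n' i))\<^sup>2 - (abscissa t j (n' j))\<^sup>2) :: complex) \<noteq> 0"
        using abscissa_square_neq[of i t j "n' i" "n' j"] that i by (subst of_int_eq_0_iff) auto
      thus ?thesis by (simp add: g_def)
    qed
    have "of_int (lattice_vandermonde t n') * (\<Prod>j\<in>{..<t} - {i}. f i - f j) = of_int (lattice_vandermonde t n) * (\<Prod>j\<in>{..<t} - {i}. g i - g j)"
      unfolding vdf by (rule vandermonde_update[OF i gf])
    moreover have "(\<Prod>j\<in>{..<t} - {i}. g i - g j) \<noteq> 0" using nz by simp
    ultimately have "of_int (lattice_vandermonde t n) = of_int (lattice_vandermonde t n') * ((\<Prod>j\<in>{..<t} - {i}. f i - f j) / (\<Prod>j\<in>{..<t} - {i}. g i - g j))"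
      by (simp add: field_simps)
    also have "(\<Prod>j\<in>{..<t} - {i}. f i - f j) / (\<Prod>j\<in>{..<t} - {i}. g i - g j) = (\<Prod>j\<in>{..<t} - {i}. (f i - f j) / (g i - g j))"
      by (rule prod_dividef[symmetric])
    also have "\<dots> = (\<Prod>j\<in>{..<t} - {i}. (f i - f j) / (g i - f j))"
      by (intro prod.cong refl) (auto simp: gf)
    also have "of_int (lattice_vandermonde t n') * \<dots> = ((-1) ^ card (core t n') * hook_product (of_nat t) (core t n') * of_int (base_vandermonde t)) * \<dots>"
      by (simp only: IH)
    also have "\<dots> = (-1) ^ card (core t n) * (- hook_product (of_nat t) (core t n') * (\<Prod>j\<in>{..<t} - {i}. (f i - f j) / (g i - f j))) * of_int (base_vandermonde t)"
      unfolding co card_insert_disjoint[OF fin pn] by simp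
    also have "\<dots> = (-1) ^ card (core t n) * hook_product (of_nat t) (core t n) * of_int (base_vandermonde t)"
      unfolding hp by (simp add: f_def g_def)
    finally have A: "(-1) ^ card (core t n) * hook_product (of_nat t) (core t n) * of_int (base_vandermonde t) = of_int (lattice_vandermonde t n)" ..
    have "int (total_energy t n) = int (total_energy t n') + int (2 * p + 1)"
    proof -
      have "(\<Sum>j\<in>{..<t} - {i}. energy t j (n' j)) = (\<Sum>j\<in>{..<t} - {i}. energy t j (n j))"
        by (intro sum.cong refl) (auto simp: off)
      thus ?thesis unfolding int_total_energy using i exs by (simp add: sum.remove[of "{..<t}" i])
    qed
    moreover have "(\<Sum>a\<in>core t n. 2 * a + 1) = (2 * p + 1) + total_energy t n'"
      unfolding co sum.insert[OF fin pn] IH ..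
    ultimately have "(\<Sum>a\<in>core t n. 2 * a + 1) = total_energy t n" by linarith
    with A show ?thesis by blast
  qed
qed

section \<open>Arm sets with nonzero hook product\<close>

lemma down_closed_int:
  fixes P :: "int \<Rightarrow> bool"
  assumes down: "\<And>m. P m \<Longrightarrow> P (m - 1)" and lo: "P lo" and hi: "\<not> P hi"
  shows "\<exists>N. \<forall>m. P m \<longleftrightarrow> m \<le> N"
proof -
  have down': "P m' \<Longrightarrow> m \<le> m' \<Longrightarrow> P m" for m m'
  proof (induction "nat (m' - m)" arbitrary: m')
    case 0
    thus ?case by simp
  next
    case (Suc k)
    show ?case by (rule Suc.hyps(1)[of "m' - 1"]) (use Suc down in auto)
  qed
  define M where "M = {m. P m \<and> lo \<le> m}"
  have "m \<le> hi" if "P m" for m using down'[OF that, of hi] hi by (meson linear)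
  hence "M \<subseteq> {lo..hi}" by (auto simp: M_def)
  hence fin: "finite M" by (rule finite_subset) simp
  have M: "Max M \<in> M" using fin lo by (intro Max_in) (auto simp: M_def)
  have "P m \<longleftrightarrow> m \<le> Max M" for m
  proof
    assume "P m"
    show "m \<le> Max M"
    proof (cases "lo \<le> m")
      case True
      thus ?thesis using fin \<open>P m\<close> by (intro Max_ge) (auto simp: M_def)
    next
      case False
      thus ?thesis using M by (auto simp: M_def)
    qed
  next
    assume "m \<le> Max M"
    thus "P m" using down' M by (auto simp: M_def)
  qed
  thus ?thesis by blast
qed

lemma hook_product_nonzeroD:
  assumes A: "finite A" and nz: "hook_product (of_nat t) A \<noteq> 0"
  shows "a \<in> A \<Longrightarrow> 2 * a + 1 \<noteq> 2 * t"
    and "a \<in> A \<Longrightarrow> b \<in> A \<Longrightarrow> b < a \<Longrightarrow> a + b + 1 \<noteq> 2 * t"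
    and "a \<in> A \<Longrightarrow> b \<notin> A \<Longrightarrow> b < a \<Longrightarrow> a - b \<noteq> 2 * t"
proof -
  have sq: "1 - (2 * of_nat t)\<^sup>2 / of_nat k ^ 2 = (0::complex)" if "k = 2 * t" "k > 0" for k
    using that by simp
  from nz have n1: "(\<Prod>a\<in>A. 1 - 2 * of_nat t / of_nat (2 * a + 1) :: complex) \<noteq> 0"
    and n2: "(\<Prod>a\<in>A. \<Prod>b\<in>A \<inter> {..<a}. 1 - (2 * of_nat t)\<^sup>2 / of_nat (a + b + 1) ^ 2 :: complex) \<noteq> 0"
    and n3: "(\<Prod>a\<in>A. \<Prod>b\<in>{..<a} - A. 1 - (2 * of_nat t)\<^sup>2 / of_nat (a - b) ^ 2 :: complex) \<noteq> 0"
    unfolding hook_product_def by auto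
  show "2 * a + 1 \<noteq> 2 * t" if "a \<in> A" by presburger
  show "a + b + 1 \<noteq> 2 * t" if "a \<in> A" "b \<in> A" "b < a"
  proof
    assume e: "a + b + 1 = 2 * t"
    have "(\<Prod>b\<in>A \<inter> {..<a}. 1 - (2 * of_nat t)\<^sup>2 / of_nat (a + b + 1) ^ 2 :: complex) \<noteq> 0"
      using n2 A that by (simp only: prod_zero_iff simp_thms) blast
    hence "1 - (2 * of_nat t)\<^sup>2 / of_nat (a + b + 1) ^ 2 \<noteq> (0 :: complex)"
      using A that by (simp only: prod_zero_iff finite_Int simp_thms) blast
    thus False using sq[OF e] by simp
  qed
  show "a - b \<noteq> 2 * t" if "a \<in> A" "b \<notin> A" "b < a"
  proof
    assume e: "a - b = 2 * t"
    have "(\<Prod>b\<in>{..<a} - A. 1 - (2 * of_nat t)\<^sup>2 / of_nat (a - b) ^ 2 :: complex) \<noteq> 0"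
      using n3 A that by (simp only: prod_zero_iff simp_thms) blast
    hence "1 - (2 * of_nat t)\<^sup>2 / of_nat (a - b) ^ 2 \<noteq> (0 :: complex)"
      using that by (simp only: prod_zero_iff finite_Diff finite_lessThan simp_thms) blast
    thus False using sq[OF e] that by simp
  qed
qed

text \<open>A nonzero hook product has no hook of length \<open>2 * t\<close>, so the bead set is closed under subtracting
  \<open>2 * t\<close> and each runner is filled up to some level.\<close>

lemma hook_product_nonzero_core:
  assumes t: "t > 0" and A: "finite A" and nz: "hook_product (of_nat t) A \<noteq> 0"
  shows "\<exists>n\<in>charge_lattice t. core t n = A"
proof -
  define S where "S s = (if s \<ge> 0 then nat s \<in> A else nat (- 1 - s) \<notin> A)" for s :: int
  have Ssym: "S (- 1 - s) \<longleftrightarrow> \<not> S s" for s by (auto simp: S_def)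
  have down: "S (s - 2 * int t)" if "S s" for s
  proof (rule ccontr)
    assume n: "\<not> S (s - 2 * int t)"
    \<comment> \<open>Both positions nonnegative, on different sides of 0, or both negative. A
      missing bead would give an arm and a gap with difference 2 * t, two arms with a + b + 1 = 2 *
      t, or, after reflection, again an arm and a gap.\<close>
    consider "s \<ge> 2 * int t" | "0 \<le> s" "s < 2 * int t" | "s < 0" by linarith
    thus False
    proof cases
      case 1
      hence "nat s \<in> A" "nat (s - 2 * int t) \<notin> A" using n that by (auto simp: S_def)
      thus False using hook_product_nonzeroD(3)[OF A nz, of "nat s" "nat (s - 2 * int t)"] 1 t by auto
    next
      case 2
      define a b where "a = nat s" and "b = nat (2 * int t - 1 - s)"
      have "a \<in> A" "b \<in> A" using 2 n that by (auto simp: S_def a_def b_def algebra_simps)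
      moreover have "a + b + 1 = 2 * t" using 2 by (auto simp: a_def b_def)
      moreover have "a \<noteq> b" using \<open>a + b + 1 = 2 * t\<close> by presburger
      ultimately show False
        using hook_product_nonzeroD(2)[OF A nz, of a b] hook_product_nonzeroD(2)[OF A nz, of b a] by (metis add.commute linorder_neqE_nat)
    next
      case 3
      define a b where "a = nat (2 * int t - 1 - s)" and "b = nat (- 1 - s)"
      have "a \<in> A" "b \<notin> A" using 3 n that by (auto simp: S_def a_def b_def algebra_simps)
      moreover have "b < a" "a - b = 2 * t" using 3 t by (auto simp: a_def b_def)
      ultimately show False using hook_product_nonzeroD(3)[OF A nz, of a b] by blast
    qed
  qed
  have "\<exists>N. \<forall>m. S (int r + 2 * int t * m - int t) \<longleftrightarrow> m \<le> N" for r :: nat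
  proof (rule down_closed_int)
    \<comment> \<open>Larger than every arm; on the runner of r the position at level
      \<open>B\<close> is at least \<open>B\<close>, hence vacant. The reflected estimate with
      \<open>C\<close> gives an occupied level.\<close>
    define B where "B = int (Max (insert 0 A)) + 1 + int r + int t"
    have Bge: "int a < B" if "a \<in> A" for a
    proof -
      have "a \<le> Max (insert 0 A)" using A that by (intro Max_ge) auto
      thus ?thesis by (simp add: B_def)
    qed
    have B0: "B > 0" by (simp add: B_def)
    have BB: "2 * int t * B \<ge> B + int t"
    proof -
      have "0 \<le> (int t - 1) * B" "int t * 1 \<le> int t * B" using t B0 by (intro mult_nonneg_nonneg mult_left_mono; simp)+
      thus ?thesis by (simp add: algebra_simps)
    qed
    have "int r + 2 * int t * B - int t \<ge> B" using BB by simp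
    hence "nat (int r + 2 * int t * B - int t) \<notin> A" using Bge B0 by (metis dual_order.strict_trans1 int_nat_eq less_le_not_le linorder_not_less order_less_imp_le)
    thus "\<not> S (int r + 2 * int t * B - int t)" using BB B0 by (simp add: S_def)
    define C where "C = int r + B"
    have CC: "2 * int t * C \<ge> C + int t"
    proof -
      have "0 \<le> (int t - 1) * C" "int t * 1 \<le> int t * C" using t B0 by (intro mult_nonneg_nonneg mult_left_mono; simp add: C_def)+
      thus ?thesis by (simp add: algebra_simps)
    qed
    have lt: "int r + 2 * int t * (- C - 1) - int t < 0" using CC B0 unfolding C_def by (simp add: algebra_simps)
    have "B \<le> - 1 - (int r + 2 * int t * (- C - 1) - int t)" using CC t unfolding C_def by (simp add: algebra_simps)
    hence "nat (- 1 - (int r + 2 * int t * (- C - 1) - int t)) \<notin> A"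
      using Bge B0 by (metis dual_order.strict_trans1 int_nat_eq less_le_not_le linorder_not_less order_less_imp_le)
    thus "S (int r + 2 * int t * (- C - 1) - int t)" using lt by (simp only: S_def if_False linorder_not_le[symmetric] simp_thms)
  next
    fix m assume "S (int r + 2 * int t * m - int t)"
    from down[OF this] show "S (int r + 2 * int t * (m - 1) - int t)" by (simp add: algebra_simps)
  qed
  then obtain N where N: "\<And>r m. S (int r + 2 * int t * m - int t) \<longleftrightarrow> m \<le> N r" by metis
  define n where "n = restrict N {..<t}"
  have "n \<in> charge_lattice t" by (auto simp: n_def charge_lattice_def)
  moreover have "core t n = A"
  proof (rule Set.set_eqI)
    fix a
    obtain r m where r: "r < 2 * t" and s: "int a = int r + 2 * int t * m - int t"
      using residue_split[OF t, of "int a"] by blast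
    have "a \<in> core t n \<longleftrightarrow> m \<le> top_level t n r" using bead_iff[OF t r] by (simp add: core_def s)
    also have "\<dots> \<longleftrightarrow> S (int a)"
    proof (cases "r < t")
      case True
      thus ?thesis using N[of r m] by (simp add: top_level_def n_def s)
    next
      case False
      define r' where "r' = 2 * t - 1 - r"
      have r': "r' < t" using False r by (auto simp: r'_def)
      have "- 1 - int a = int r' + 2 * int t * (- m) - int t" using r by (simp add: s r'_def of_nat_diff)
      hence "S (int a) \<longleftrightarrow> \<not> - m \<le> N r'" using Ssym[of "int a"] N[of r' "- m"] by auto
      moreover have "top_level t n r = - 1 - N r'" using False r' by (simp add: top_level_def n_def r'_def)
      ultimately show ?thesis by linarith
    qed
    also have "\<dots> \<longleftrightarrow> a \<in> A" by (simp add: S_def)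
    finally show "a \<in> core t n \<longleftrightarrow> a \<in> A" .
  qed
  ultimately show ?thesis by blast
qed

lemma inj_core:
  assumes t: "t > 0"
  shows "inj_on (core t) (charge_lattice t)"
proof (rule inj_onI)
  fix n n' assume n: "n \<in> charge_lattice t" "n' \<in> charge_lattice t" and eq: "core t n = core t n'"
  have "n i = n' i" if "i < t" for i
  proof -
    have "m \<le> n i \<longleftrightarrow> m \<le> n' i" for m
    proof -
      have i: "i < 2 * t" using that by simp
      have "m \<le> n i \<longleftrightarrow> bead t n (int i + 2 * int t * m - int t)" unfolding bead_iff[OF t i] using that by (simp add: top_level_def)
      also have "\<dots> \<longleftrightarrow> bead t n' (int i + 2 * int t * m - int t)" unfolding bead_core[OF t] eq ..
      also have "\<dots> \<longleftrightarrow> m \<le> n' i" unfolding bead_iff[OF t i] using that by (simp add: top_level_def)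
      finally show ?thesis .
    qed
    thus ?thesis by (meson order_antisym order_refl)
  qed
  thus "n = n'" using n unfolding charge_lattice_def by (intro PiE_ext) auto
qed

lemma finite_weight_sets: "finite {A. finite A \<and> (\<Sum>a\<in>A. 2 * a + 1 :: nat) = m}"
proof (rule finite_subset)
  show "{A. finite A \<and> (\<Sum>a\<in>A. 2 * a + 1 :: nat) = m} \<subseteq> Pow {..m}"
  proof (intro subsetI PowI)
    fix A :: "nat set" and a assume A: "A \<in> {A. finite A \<and> (\<Sum>a\<in>A. 2 * a + 1 :: nat) = m}" and a: "a \<in> A"
    hence "2 * a + 1 \<le> (\<Sum>a\<in>A. 2 * a + 1)" by (intro member_le_sum[of a A "\<lambda>a. 2 * a + 1"]) auto
    thus "a \<in> {..m}" using A by simp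
  qed
qed simp

text \<open>Arm sets that are not cores have hook product 0, so the sum over all arm sets of weight
  m collapses to the lattice points of energy m.\<close>

lemma core_sum:
  assumes t: "t > 0"
  shows "(\<Sum>A | finite A \<and> (\<Sum>a\<in>A. 2 * a + 1) = m. (-1) ^ card A * hook_product (of_nat t) A) * of_int (base_vandermonde t) = fps_nth (wronskian_series t) m"
proof -
  have nz: "hook_product (of_nat t) (core t n) \<noteq> 0" for n
  proof
    assume "hook_product (of_nat t) (core t n) = 0"
    hence "(of_int (lattice_vandermonde t n) :: complex) = 0" using core_evaluation[OF t, of n] by simp
    thus False using lattice_vandermonde_nonzero[of t n] by simp
  qed
  have "(\<Sum>A | finite A \<and> (\<Sum>a\<in>A. 2 * a + 1) = m. (-1) ^ card A * hook_product (of_nat t) A * of_int (base_vandermonde t))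
      = (\<Sum>A\<in>core t ` {n \<in> charge_lattice t. total_energy t n = m}. (-1) ^ card A * hook_product (of_nat t) A * of_int (base_vandermonde t))"
  proof (rule sum.mono_neutral_right[OF finite_weight_sets])
    show "core t ` {n \<in> charge_lattice t. total_energy t n = m} \<subseteq> {A. finite A \<and> (\<Sum>a\<in>A. 2 * a + 1) = m}"
      using finite_core[OF t] core_evaluation[OF t] by auto
    show "\<forall>A\<in>{A. finite A \<and> (\<Sum>a\<in>A. 2 * a + 1) = m} - core t ` {n \<in> charge_lattice t. total_energy t n = m}. (-1) ^ card A * hook_product (of_nat t) A * of_int (base_vandermonde t) = 0"
    proof
      fix A assume A: "A \<in> {A. finite A \<and> (\<Sum>a\<in>A. 2 * a + 1) = m} - core t ` {n \<in> charge_lattice t. total_energy t n = m}"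
      have "hook_product (of_nat t) A = 0"
      proof (rule ccontr)
        assume "hook_product (of_nat t) A \<noteq> 0"
        then obtain n where "n \<in> charge_lattice t" "core t n = A" using hook_product_nonzero_core[OF t, of A] A by auto
        thus False using A core_evaluation[OF t, of n] by auto
      qed
      thus "(-1) ^ card A * hook_product (of_nat t) A * of_int (base_vandermonde t) = 0" by simp
    qed
  qed
  also have "\<dots> = (\<Sum>n | n \<in> charge_lattice t \<and> total_energy t n = m. of_int (lattice_vandermonde t n))"
    using core_evaluation[OF t] by (subst sum.reindex) (auto intro: inj_on_subset[OF inj_core[OF t]])
  finally show ?thesis by (simp add: wronskian_series_def sum_distrib_right)
qed

lemma core_series:
  assumes t: "t > 0"
  shows "Abs_fps (\<lambda>m. \<Sum>A | finite A \<and> (\<Sum>a\<in>A. 2 * a + 1) = m. (-1) ^ card A * hook_product (of_nat t) A) * euler_fps 1 ^ (2 * t - 1)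
    = euler_fps 2 ^ ((2 * t - 1) * (t + 1))"
proof -
  define C where "C = Abs_fps (\<lambda>m. \<Sum>A | finite A \<and> (\<Sum>a\<in>A. 2 * a + 1) = m. (-1) ^ card A * hook_product (of_nat t) A)"
  define c where "c = (fps_const (of_int (base_vandermonde t)) :: complex fps)"
  have "c * C = wronskian_series t"
    by (rule fps_ext) (simp add: c_def C_def core_sum[OF t, symmetric] mult.commute)
  hence "c * (C * euler_fps 1 ^ (2 * t - 1)) = c * euler_fps 2 ^ ((2 * t - 1) * (t + 1))"
    using wronskian_series_product[OF t] by (simp only: c_def mult.assoc[symmetric])
  moreover have "c \<noteq> 0" using base_vandermonde_nonzero[of t] by (simp add: c_def)
  ultimately show ?thesis unfolding C_def by simp
qed

subsection \<open>Self-conjugate partitions\<close>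

text \<open>Row lengths counted from 0 and continued by zeros; (i, j) is a box iff j < R i. The case
  j = 0 of \<open>mirror\<close> shows that R vanishes from R 0 on.\<close>

locale symmetric_shape =
  fixes R :: "nat \<Rightarrow> nat"
  assumes anti: "i \<le> j \<Longrightarrow> R j \<le> R i"
    and mirror: "j < R i \<longleftrightarrow> i < R j"
begin

definition diag :: "nat set" where "diag = {i. i < R i}"

definition frob_set :: "nat set" where "frob_set = (\<lambda>i. R i - i - 1) ` diag"

definition boxes :: "(nat \<times> nat) set" where "boxes = {(i, j). j < R i}"

lemma finite_diag: "finite diag"
proof (rule finite_subset)
  show "diag \<subseteq> {..<R 0}" using anti[of 0] by (auto simp: diag_def intro: order.strict_trans2)
qed simp

lemma frob_set_decreasing: "j \<in> diag \<Longrightarrow> i < j \<Longrightarrow> R j - j - 1 < R i - i - 1"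
  using anti[of i j] by (auto simp: diag_def)

lemma inj_frob_set: "inj_on (\<lambda>i. R i - i - 1) diag"
  by (rule linorder_inj_onI) (use frob_set_decreasing in \<open>auto simp: order_less_imp_not_eq2\<close>)

lemma finite_frob_set: "finite frob_set" and card_frob_set: "card frob_set = card diag"
  using finite_diag card_image[OF inj_frob_set] by (simp_all add: frob_set_def)

text \<open>The boundary path as a bead sequence: its steps of one kind sit at R i - i - 1, those of
  the other kind, by symmetry, at j - R j. Each position carries exactly one step.\<close>

lemma frob_set_complement: "n \<notin> frob_set \<longleftrightarrow> (\<exists>j. R j \<le> j \<and> n = j - R j)"
proof
  assume "\<exists>j. R j \<le> j \<and> n = j - R j"
  then obtain j where j: "R j \<le> j" "n = j - R j" by blast
  show "n \<notin> frob_set"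
  proof
    assume "n \<in> frob_set"
    then obtain i where i: "i < R i" "n = R i - i - 1" by (auto simp: frob_set_def diag_def)
    show False
    proof (cases "j < R i")
      case True
      thus False using mirror[of j i] i j by linarith
    next
      case False
      thus False using mirror[of j i] i j by linarith
    qed
  qed
next
  assume n: "n \<notin> frob_set"
  \<comment> \<open>The first place where R j has dropped to j - n. If it dropped further, row i =
    j' - n would have length exactly Suc j', making n an arm length.\<close>
  define j where "j = (LEAST j. n + R j \<le> j)"
  have "n + R (n + R 0) \<le> n + R 0" using anti[of 0] by simp
  hence j: "n + R j \<le> j" unfolding j_def by (rule LeastI)
  have "n + R j = j"
  proof (rule ccontr)
    assume "n + R j \<noteq> j"
    hence lt: "n + R j < j" using j by simp
    then obtain j' where j': "j = Suc j'" by (cases j) auto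
    have "\<not> n + R j' \<le> j'" using not_less_Least[of j' "\<lambda>j. n + R j \<le> j"] j' by (simp add: j_def)
    define i where "i = j' - n"
    have "R (Suc j') \<le> i" "i < R j'" using lt \<open>\<not> n + R j' \<le> j'\<close> by (auto simp: i_def j')
    hence Ri: "R i = Suc j'" using mirror[of i "Suc j'"] mirror[of i j'] by linarith
    have "n \<le> j'" using lt j' by simp
    hence "i \<in> diag" "n = R i - i - 1" unfolding diag_def mem_Collect_eq Ri by (simp_all add: i_def)
    thus False using n by (auto simp: frob_set_def)
  qed
  thus "\<exists>j. R j \<le> j \<and> n = j - R j" by (intro exI[of _ j]) auto
qed

lemma boxes_split:
  "boxes = (\<lambda>i. (i, i)) ` diag \<union> (Sigma diag (\<lambda>i. {i<..<R i}) \<union> prod.swap ` Sigma diag (\<lambda>i. {i<..<R i}))"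
proof (intro equalityI subsetI)
  fix x assume "x \<in> boxes"
  then obtain i j where x: "x = (i, j)" "j < R i" by (auto simp: boxes_def)
  have "i < R j" using x mirror by blast
  consider "i = j" | "i < j" | "j < i" by linarith
  thus "x \<in> (\<lambda>i. (i, i)) ` diag \<union> (Sigma diag (\<lambda>i. {i<..<R i}) \<union> prod.swap ` Sigma diag (\<lambda>i. {i<..<R i}))"
  proof cases
    case 1
    thus ?thesis using x by (auto simp: diag_def)
  next
    case 2
    thus ?thesis using x by (auto simp: diag_def)
  next
    case 3
    hence "(j, i) \<in> Sigma diag (\<lambda>i. {i<..<R i})" using \<open>i < R j\<close> by (auto simp: diag_def)
    thus ?thesis using x by (auto intro!: image_eqI[of _ _ "(j, i)"])
  qed
qed (use mirror in \<open>auto simp: boxes_def diag_def\<close>)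

lemma prod_boxes:
  fixes F :: "nat \<times> nat \<Rightarrow> 'a :: comm_monoid_mult"
  shows "(\<Prod>x\<in>boxes. F x) = (\<Prod>i\<in>diag. F (i, i)) * (\<Prod>i\<in>diag. \<Prod>j\<in>{i<..<R i}. F (i, j) * F (j, i))"
proof -
  define U where "U = Sigma diag (\<lambda>i. {i<..<R i})"
  have fU: "finite U" unfolding U_def using finite_diag by auto
  have "(\<Prod>x\<in>boxes. F x) = (\<Prod>x\<in>(\<lambda>i. (i, i)) ` diag. F x) * ((\<Prod>x\<in>U. F x) * (\<Prod>x\<in>prod.swap ` U. F x))"
    unfolding boxes_split U_def[symmetric] using finite_diag fU
    by (subst prod.union_disjoint; (subst prod.union_disjoint)?) (auto simp: U_def)
  also have "(\<Prod>x\<in>(\<lambda>i. (i, i)) ` diag. F x) = (\<Prod>i\<in>diag. F (i, i))"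
    by (subst prod.reindex) (auto intro: inj_onI)
  also have "(\<Prod>x\<in>prod.swap ` U. F x) = (\<Prod>x\<in>U. F (prod.swap x))"
    by (subst prod.reindex) auto
  also have "(\<Prod>x\<in>U. F x) * (\<Prod>x\<in>U. F (prod.swap x)) = (\<Prod>x\<in>U. F x * F (prod.swap x))"
    by (rule prod.distrib[symmetric])
  also have "\<dots> = (\<Prod>i\<in>diag. \<Prod>j\<in>{i<..<R i}. F (i, j) * F (j, i))"
    unfolding U_def by (subst prod.Sigma) (auto simp: finite_diag intro!: prod.cong)
  finally show ?thesis .
qed

lemma card_boxes: "card boxes = (\<Sum>a\<in>frob_set. 2 * a + 1)"
proof -
  define U where "U = Sigma diag (\<lambda>i. {i<..<R i})"
  have fU: "finite U" unfolding U_def using finite_diag by auto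
  have "card boxes = card ((\<lambda>i. (i, i)) ` diag) + (card U + card (prod.swap ` U))"
    unfolding boxes_split U_def[symmetric] using finite_diag fU
    by (subst card_Un_disjoint; (subst card_Un_disjoint)?) (auto simp: U_def)
  also have "card ((\<lambda>i. (i, i)) ` diag) = card diag" by (rule card_image) (auto intro: inj_onI)
  also have "card (prod.swap ` U) = card U" by (rule card_image) auto
  also have "card U = (\<Sum>i\<in>diag. R i - i - 1)"
    unfolding U_def using finite_diag by (subst card_SigmaI) auto
  also have "card diag + ((\<Sum>i\<in>diag. R i - i - 1) + (\<Sum>i\<in>diag. R i - i - 1)) = (\<Sum>i\<in>diag. 2 * (R i - i - 1) + 1)"
    by (simp only: mult_2 sum.distrib card_eq_sum add_ac)
  also have "\<dots> = (\<Sum>a\<in>frob_set. 2 * a + 1)"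
    unfolding frob_set_def by (subst sum.reindex[OF inj_frob_set]) simp
  finally show ?thesis .
qed

text \<open>Mirror boxes have equal hook length and opposite sign, so their two factors multiply to
  1 - (2 * z)^2 / h^2. It remains to express h by arms and gaps, according to whether column j meets
  the diagonal.\<close>

lemma prod_hooks:
  fixes z :: complex
  shows "(\<Prod>(i, j)\<in>boxes. 1 - 2 * z / (of_nat (R i - j + (R j - i) - 1) * (if j < i then -1 else 1))) = hook_product z frob_set"
proof -
  define h where "h i j = (of_nat (R i - j + (R j - i) - 1) :: complex)" for i j
  have hs: "h j i = h i j" for i j by (simp add: h_def add.commute)
  define g where "g i j = 1 - (2 * z)\<^sup>2 / (h i j)\<^sup>2" for i j
  have "(\<Prod>(i, j)\<in>boxes. 1 - 2 * z / (h i j * (if j < i then -1 else 1)))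
    = (\<Prod>i\<in>diag. 1 - 2 * z / h i i) * (\<Prod>i\<in>diag. \<Prod>j\<in>{i<..<R i}. (1 - 2 * z / h i j) * (1 + 2 * z / h i j))"
    unfolding prod_boxes by (intro arg_cong2[of _ _ _ _ "(*)"] prod.cong refl) (auto simp: hs)
  also have "(\<Prod>i\<in>diag. \<Prod>j\<in>{i<..<R i}. (1 - 2 * z / h i j) * (1 + 2 * z / h i j)) = (\<Prod>i\<in>diag. \<Prod>j\<in>{i<..<R i}. g i j)"
    by (intro prod.cong refl) (simp add: g_def power2_eq_square algebra_simps)
  also have "(\<Prod>i\<in>diag. 1 - 2 * z / h i i) = (\<Prod>a\<in>frob_set. 1 - 2 * z / of_nat (2 * a + 1))"
    unfolding frob_set_def
  proof (subst prod.reindex[OF inj_frob_set], rule prod.cong)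
    fix i assume "i \<in> diag"
    hence "R i - i + (R i - i) - 1 = 2 * (R i - i - 1) + 1" by (auto simp: diag_def)
    thus "1 - 2 * z / h i i = ((\<lambda>a. 1 - 2 * z / of_nat (2 * a + 1)) \<circ> (\<lambda>i. R i - i - 1)) i"
      by (simp only: h_def o_def)
  qed simp
  also have "(\<Prod>i\<in>diag. \<Prod>j\<in>{i<..<R i}. g i j) = (\<Prod>i\<in>diag. (\<Prod>j\<in>{i<..<R i} \<inter> diag. g i j) * (\<Prod>j\<in>{i<..<R i} - diag. g i j))"
    by (intro prod.cong refl prod.Int_Diff) auto
  also have "\<dots> = (\<Prod>i\<in>diag. (\<Prod>b\<in>frob_set \<inter> {..<R i - i - 1}. 1 - (2 * z)\<^sup>2 / of_nat ((R i - i - 1) + b + 1) ^ 2)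
       * (\<Prod>b\<in>{..<R i - i - 1} - frob_set. 1 - (2 * z)\<^sup>2 / of_nat ((R i - i - 1) - b) ^ 2))"
  proof (rule prod.cong[OF refl], rule arg_cong2[of _ _ _ _ "(*)"])
    fix i assume i: "i \<in> diag"
    have iR: "i < R i" using i by (simp add: diag_def)
    have bij: "bij_betw (\<lambda>j. R j - j - 1) ({i<..<R i} \<inter> diag) (frob_set \<inter> {..<R i - i - 1})"
    proof (rule bij_betwI')
      fix x y assume "x \<in> {i<..<R i} \<inter> diag" "y \<in> {i<..<R i} \<inter> diag"
      thus "(R x - x - 1 = R y - y - 1) = (x = y)" using inj_frob_set by (auto simp: inj_on_def)
    next
      fix x assume "x \<in> {i<..<R i} \<inter> diag"
      thus "R x - x - 1 \<in> frob_set \<inter> {..<R i - i - 1}" using frob_set_decreasing[of x i] by (auto simp: frob_set_def)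
    next
      fix b assume "b \<in> frob_set \<inter> {..<R i - i - 1}"
      then obtain j where j: "j \<in> diag" "b = R j - j - 1" "b < R i - i - 1" by (auto simp: frob_set_def)
      have "i < j" using j frob_set_decreasing[OF i, of j] by (cases i j rule: linorder_cases) auto
      moreover have "j < R i" using anti[of i j] \<open>i < j\<close> j by (simp add: diag_def)
      ultimately show "\<exists>j\<in>{i<..<R i} \<inter> diag. b = R j - j - 1" using j by auto
    qed
    have gi: "g i j = 1 - (2 * z)\<^sup>2 / of_nat ((R i - i - 1) + (R j - j - 1) + 1) ^ 2" if "j \<in> {i<..<R i} \<inter> diag" for j
    proof -
      have "(R i - i - 1) + (R j - j - 1) + 1 = R i - j + (R j - i) - 1" using that iR by (auto simp: diag_def)
      thus ?thesis by (simp only: g_def h_def)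
    qed
    have "(\<Prod>j\<in>{i<..<R i} \<inter> diag. g i j) = (\<Prod>j\<in>{i<..<R i} \<inter> diag. 1 - (2 * z)\<^sup>2 / of_nat ((R i - i - 1) + (R j - j - 1) + 1) ^ 2)"
      by (rule prod.cong[OF refl gi])
    also have "\<dots> = (\<Prod>b\<in>frob_set \<inter> {..<R i - i - 1}. 1 - (2 * z)\<^sup>2 / of_nat ((R i - i - 1) + b + 1) ^ 2)"
      by (rule prod.reindex_bij_betw[OF bij, of "\<lambda>b. 1 - (2 * z)\<^sup>2 / of_nat ((R i - i - 1) + b + 1) ^ 2"])
    finally show "(\<Prod>j\<in>{i<..<R i} \<inter> diag. g i j) = (\<Prod>b\<in>frob_set \<inter> {..<R i - i - 1}. 1 - (2 * z)\<^sup>2 / of_nat ((R i - i - 1) + b + 1) ^ 2)" .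
    have bij: "bij_betw (\<lambda>j. j - R j) ({i<..<R i} - diag) ({..<R i - i - 1} - frob_set)"
    proof (rule bij_betwI')
      fix x y assume "x \<in> {i<..<R i} - diag" "y \<in> {i<..<R i} - diag"
      hence xy: "R x \<le> x" "R y \<le> y" by (auto simp: diag_def)
      show "(x - R x = y - R y) = (x = y)"
        using xy anti[of x y] anti[of y x] by (cases x y rule: linorder_cases) auto
    next
      fix x assume x: "x \<in> {i<..<R i} - diag"
      hence "R x \<le> x" "i < R x" using mirror by (auto simp: diag_def)
      thus "x - R x \<in> {..<R i - i - 1} - frob_set" using x frob_set_complement by auto
    next
      fix b assume b: "b \<in> {..<R i - i - 1} - frob_set"
      then obtain j where j: "R j \<le> j" "b = j - R j" using frob_set_complement by blast
      have "j < R i"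
      proof (rule ccontr)
        assume "\<not> j < R i"
        hence "\<not> i < R j" using mirror by blast
        thus False using \<open>\<not> j < R i\<close> b j by auto
      qed
      moreover have "i < j" using \<open>j < R i\<close> mirror[of j i] j by simp
      ultimately show "\<exists>j\<in>{i<..<R i} - diag. b = j - R j" using j by (intro bexI[of _ j]) (auto simp: diag_def)
    qed
    have gi: "g i j = 1 - (2 * z)\<^sup>2 / of_nat ((R i - i - 1) - (j - R j)) ^ 2" if j: "j \<in> {i<..<R i} - diag" for j
    proof -
      have "R j \<le> j" "i < R j" "j < R i" using j mirror by (auto simp: diag_def)
      hence "(R i - i - 1) - (j - R j) = R i - j + (R j - i) - 1" by auto
      thus ?thesis by (simp only: g_def h_def)
    qed
    have "(\<Prod>j\<in>{i<..<R i} - diag. g i j) = (\<Prod>j\<in>{i<..<R i} - diag. 1 - (2 * z)\<^sup>2 / of_nat ((R i - i - 1) - (j - R j)) ^ 2)"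
      by (rule prod.cong[OF refl gi])
    also have "\<dots> = (\<Prod>b\<in>{..<R i - i - 1} - frob_set. 1 - (2 * z)\<^sup>2 / of_nat ((R i - i - 1) - b) ^ 2)"
      by (rule prod.reindex_bij_betw[OF bij, of "\<lambda>b. 1 - (2 * z)\<^sup>2 / of_nat ((R i - i - 1) - b) ^ 2"])
    finally show "(\<Prod>j\<in>{i<..<R i} - diag. g i j) = (\<Prod>b\<in>{..<R i - i - 1} - frob_set. 1 - (2 * z)\<^sup>2 / of_nat ((R i - i - 1) - b) ^ 2)" .
  qed
  also have "\<dots> = (\<Prod>a\<in>frob_set. (\<Prod>b\<in>frob_set \<inter> {..<a}. 1 - (2 * z)\<^sup>2 / of_nat (a + b + 1) ^ 2) * (\<Prod>b\<in>{..<a} - frob_set. 1 - (2 * z)\<^sup>2 / of_nat (a - b) ^ 2))"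
  proof -
    have "bij_betw (\<lambda>i. R i - i - 1) diag frob_set" using inj_frob_set by (simp add: bij_betw_def frob_set_def)
    from prod.reindex_bij_betw[OF this, of "\<lambda>a. (\<Prod>b\<in>frob_set \<inter> {..<a}. 1 - (2 * z)\<^sup>2 / of_nat (a + b + 1) ^ 2) * (\<Prod>b\<in>{..<a} - frob_set. 1 - (2 * z)\<^sup>2 / of_nat (a - b) ^ 2)"]
    show ?thesis .
  qed
  finally show ?thesis unfolding h_def hook_product_def prod.distrib by (simp only: mult.assoc)
qed

end

lemma strictly_decreasing_unique:
  fixes f g :: "nat \<Rightarrow> int"
  assumes f: "\<And>i j. i < j \<Longrightarrow> f j < f i" and g: "\<And>i j. i < j \<Longrightarrow> g j < g i" and r: "range f = range g"
  shows "f = g"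
proof
  fix i
  show "f i = g i"
  proof (induction i rule: less_induct)
    case (less i)
    obtain k where k: "f i = g k" using r by blast
    obtain l where l: "g i = f l" using r by (metis rangeI rangeE)
    have "\<not> k < i" using less[of k] f[of k i] k by auto
    hence "f i \<le> g i" using g[of i k] k by (cases "k = i") auto
    moreover have "\<not> l < i" using less[of l] g[of l i] l by auto
    hence "g i \<le> f i" using f[of i l] l by (cases "l = i") auto
    ultimately show ?case by simp
  qed
qed

text \<open>The numbers \<open>R i - i - 1\<close> form a strictly decreasing sequence whose range is determined by the
  diagonal arm lengths.\<close>

lemma symmetric_shape_unique:
  assumes "symmetric_shape R" "symmetric_shape R'" "symmetric_shape.frob_set R = symmetric_shape.frob_set R'"
  shows "R = R'"
proof -
  interpret r: symmetric_shape R by fact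
  interpret r': symmetric_shape R' by fact
  have *: "range (\<lambda>i. int (Q i) - int i - 1) = {s. if s \<ge> 0 then nat s \<in> symmetric_shape.frob_set Q else nat (- 1 - s) \<notin> symmetric_shape.frob_set Q}"
    if "symmetric_shape Q" for Q
  proof -
    interpret q: symmetric_shape Q by fact
    have 1: "s \<in> range (\<lambda>i. int (Q i) - int i - 1) \<longleftrightarrow> nat s \<in> q.frob_set" if "s \<ge> 0" for s
    proof
      assume "s \<in> range (\<lambda>i. int (Q i) - int i - 1)"
      then obtain i where "s = int (Q i) - int i - 1" by blast
      hence "i \<in> q.diag" "nat s = Q i - i - 1" using that by (auto simp: q.diag_def)
      thus "nat s \<in> q.frob_set" by (auto simp: q.frob_set_def)
    next
      assume "nat s \<in> q.frob_set"
      then obtain i where "i < Q i" "nat s = Q i - i - 1" by (auto simp: q.frob_set_def q.diag_def)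
      hence "s = int (Q i) - int i - 1" using that by linarith
      thus "s \<in> range (\<lambda>i. int (Q i) - int i - 1)" by blast
    qed
    have 2: "s \<in> range (\<lambda>i. int (Q i) - int i - 1) \<longleftrightarrow> nat (- 1 - s) \<notin> q.frob_set" if "s < 0" for s
    proof -
      have "s = int (Q j) - int j - 1 \<longleftrightarrow> Q j \<le> j \<and> nat (- 1 - s) = j - Q j" for j using that by linarith
      thus ?thesis unfolding q.frob_set_complement by blast
    qed
    show ?thesis
    proof (rule Set.set_eqI)
      fix s
      show "s \<in> range (\<lambda>i. int (Q i) - int i - 1) \<longleftrightarrow> s \<in> {s. if s \<ge> 0 then nat s \<in> q.frob_set else nat (- 1 - s) \<notin> q.frob_set}"
      proof (cases "s \<ge> 0")
        case True
        thus ?thesis using 1 by (simp only: mem_Collect_eq if_True)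
      next
        case False
        thus ?thesis unfolding mem_Collect_eq if_not_P[OF False] by (intro 2) simp
      qed
    qed
  qed
  have "(\<lambda>i. int (R i) - int i - 1) = (\<lambda>i. int (R' i) - int i - 1)"
  proof (rule strictly_decreasing_unique)
    show "int (R j) - int j - 1 < int (R i) - int i - 1" if "i < j" for i j using r.anti[of i j] that by simp
    show "int (R' j) - int j - 1 < int (R' i) - int i - 1" if "i < j" for i j using r'.anti[of i j] that by simp
    show "range (\<lambda>i. int (R i) - int i - 1) = range (\<lambda>i. int (R' i) - int i - 1)"
      unfolding *[OF assms(1)] *[OF assms(2)] assms(3) ..
  qed
  thus ?thesis by (auto simp: fun_eq_iff)
qed

text \<open>Listing the arms in decreasing order prescribes the first d rows, \<open>e k\<close> = a
  k + k + 1. The others are forced by symmetry: row i beyond them counts the k with i < e k.\<close>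

lemma symmetric_shape_exists:
  assumes A: "finite A"
  shows "\<exists>R. symmetric_shape R \<and> symmetric_shape.frob_set R = A"
proof -
  define d where "d = card A"
  define a where "a k = rev (sorted_list_of_set A) ! k" for k
  have len: "length (rev (sorted_list_of_set A)) = d" by (simp add: d_def)
  have "sorted_wrt (>) (rev (sorted_list_of_set A))"
    unfolding sorted_wrt_rev using strict_sorted_list_of_set[of A] by simp
  hence dec: "a l < a k" if "k < l" "l < d" for k l
    using that len by (auto simp: a_def sorted_wrt_iff_nth_less)
  have img: "a ` {..<d} = A"
  proof -
    have "a ` {..<d} = set (rev (sorted_list_of_set A))"
      unfolding set_conv_nth len a_def by auto
    thus ?thesis using A by simp
  qed
  define e where "e k = a k + k + 1" for k
  have eanti: "e l \<le> e k" if "k \<le> l" "l < d" for k l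
    using that
  proof (induction l)
    case 0
    thus ?case by simp
  next
    case (Suc l)
    have "e (Suc l) \<le> e l" using dec[of l "Suc l"] Suc.prems by (simp add: e_def)
    thus ?case using Suc by (cases "k = Suc l") auto
  qed
  \<comment> \<open>The d by d square fits inside these rows.\<close>
  have ed: "d \<le> e k" if "k < d" for k
  proof -
    have "e (d - 1) \<le> e k" using that by (intro eanti) auto
    thus ?thesis using that by (simp add: e_def)
  qed
  define c where "c i = card {k. k < d \<and> i < e k}" for i
  have cset: "{k. k < d \<and> i < e k} = {..<c i}" for i
  proof -
    define S where "S = {k. k < d \<and> i < e k}"
    have down: "k \<in> S" if "l \<in> S" "k \<le> l" for k l
      using that eanti[of k l] by (auto simp: S_def)
    have fin: "finite S" by (simp add: S_def)
    have "S = {..<card S}"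
    proof (cases "S = {}")
      case False
      hence "S = {..Max S}" using fin down[OF Max_in[OF fin False]] by (auto intro: Max_ge)
      thus ?thesis by (metis card_atMost lessThan_Suc_atMost)
    qed simp
    thus ?thesis by (simp add: S_def c_def)
  qed
  have cle: "c i \<le> d" for i
  proof -
    have "{..<c i} \<subseteq> {..<d}" unfolding cset[symmetric] by auto
    thus ?thesis by simp
  qed
  have canti: "c j \<le> c i" if "i \<le> j" for i j
  proof -
    have "{..<c j} \<subseteq> {..<c i}" unfolding cset[symmetric] using that by auto
    thus ?thesis by simp
  qed
  have cl: "k < c i \<longleftrightarrow> k < d \<and> i < e k" for i k using cset[of i] by auto
  define R where "R i = (if i < d then e i else c i)" for i
  interpret symmetric_shape R
  proof
    fix i j :: nat
    show "R j \<le> R i" if "i \<le> j"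
      using that eanti[of i j] canti[of i j] cle[of j] ed[of i] by (auto simp: R_def intro: order_trans)
    show "j < R i \<longleftrightarrow> i < R j"
      using cl[of i j] cl[of j i] ed[of i] ed[of j] cle[of i] cle[of j] by (auto simp: R_def)
  qed
  have "diag = {..<d}"
  proof (intro equalityI subsetI)
    fix i assume "i \<in> diag"
    thus "i \<in> {..<d}" using cle[of i] by (auto simp: diag_def R_def split: if_splits)
  next
    fix i assume "i \<in> {..<d}"
    thus "i \<in> diag" by (auto simp: diag_def R_def e_def)
  qed
  hence "frob_set = A" unfolding frob_set_def img[symmetric] by (auto simp: R_def e_def intro!: image_cong)
  thus ?thesis using symmetric_shape_axioms by blast
qed

section \<open>Transfer from shapes to partitions as lists\<close>

definition row :: "nat list \<Rightarrow> nat \<Rightarrow> nat" where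
  "row \<nu> i = (if i < length \<nu> then \<nu> ! i else 0)"

lemma ferrers_row_iff: "(Suc i, Suc j) \<in> ferrers \<nu> \<longleftrightarrow> j < row \<nu> i"
  by (auto simp: ferrers_def row_def)

lemma ferrers_eq: "ferrers \<nu> = (\<lambda>(i, j). (Suc i, Suc j)) ` {(i, j). j < row \<nu> i}"
proof (intro equalityI subsetI)
  fix v assume v: "v \<in> ferrers \<nu>"
  then obtain i j where "v = (Suc i, Suc j)" by (auto simp: ferrers_def gr0_conv_Suc Suc_le_eq)
  thus "v \<in> (\<lambda>(i, j). (Suc i, Suc j)) ` {(i, j). j < row \<nu> i}" using v by (auto simp: ferrers_row_iff)
qed (auto simp: ferrers_row_iff)

lemma row_antimono:
  assumes "\<nu> \<in> partitions" "i \<le> j"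
  shows "row \<nu> j \<le> row \<nu> i"
  using assms by (cases "i = j") (auto simp: row_def partitions_def sorted_wrt_iff_nth_less)

lemma self_conjugate_iff:
  "\<nu> \<in> self_conjugate_partitions \<longleftrightarrow> \<nu> \<in> partitions \<and> symmetric_shape (row \<nu>)"
proof -
  have "prod.swap ` ferrers \<nu> = ferrers \<nu> \<longleftrightarrow> (\<forall>i j. j < row \<nu> i \<longleftrightarrow> i < row \<nu> j)"
  proof
    assume eq: "prod.swap ` ferrers \<nu> = ferrers \<nu>"
    show "\<forall>i j. j < row \<nu> i \<longleftrightarrow> i < row \<nu> j"
    proof (intro allI)
      fix i j
      have "j < row \<nu> i \<longleftrightarrow> (Suc i, Suc j) \<in> prod.swap ` ferrers \<nu>" unfolding eq ferrers_row_iff ..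
      also have "\<dots> \<longleftrightarrow> (Suc j, Suc i) \<in> ferrers \<nu>" by force
      finally show "j < row \<nu> i \<longleftrightarrow> i < row \<nu> j" unfolding ferrers_row_iff .
    qed
  next
    assume "\<forall>i j. j < row \<nu> i \<longleftrightarrow> i < row \<nu> j"
    thus "prod.swap ` ferrers \<nu> = ferrers \<nu>" unfolding ferrers_eq by (force simp: image_iff)
  qed
  thus ?thesis using row_antimono by (auto simp: self_conjugate_partitions_def symmetric_shape_def)
qed

lemma row_inject:
  assumes "\<nu> \<in> partitions" "\<mu> \<in> partitions" "row \<nu> = row \<mu>"
  shows "\<nu> = \<mu>"
  using inj_onD[OF inj_on_ferrers, of \<nu> \<mu>] assms by (simp add: ferrers_eq)

lemma row_surject:
  assumes "symmetric_shape R"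
  shows "\<exists>\<nu>\<in>partitions. row \<nu> = R"
proof
  interpret symmetric_shape R by fact
  have pos: "i < R 0 \<longleftrightarrow> 0 < R i" for i by (rule mirror)
  show "map R [0..<R 0] \<in> partitions"
  proof -
    have "sorted_wrt (\<ge>) (map R [0..<R 0])"
      unfolding sorted_wrt_iff_nth_less using anti by simp
    moreover have "\<forall>p\<in>set (map R [0..<R 0]). p > 0" using pos by auto
    ultimately show ?thesis by (simp add: partitions_def)
  qed
  show "row (map R [0..<R 0]) = R" using pos by (auto simp: row_def fun_eq_iff)
qed

definition frobenius :: "nat list \<Rightarrow> nat set" where
  "frobenius \<nu> = symmetric_shape.frob_set (row \<nu>)"

lemma bij_betw_frobenius: "bij_betw frobenius self_conjugate_partitions {A. finite A}"
proof (rule bij_betwI')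
  fix x y assume "x \<in> self_conjugate_partitions" "y \<in> self_conjugate_partitions"
  thus "frobenius x = frobenius y \<longleftrightarrow> x = y"
    using symmetric_shape_unique[of "row x" "row y"] row_inject[of x y] by (auto simp: self_conjugate_iff frobenius_def)
next
  fix x assume "x \<in> self_conjugate_partitions"
  thus "frobenius x \<in> {A. finite A}"
    by (simp add: self_conjugate_iff frobenius_def symmetric_shape.finite_frob_set)
next
  fix A :: "nat set" assume "A \<in> {A. finite A}"
  then obtain R where R: "symmetric_shape R" "symmetric_shape.frob_set R = A" using symmetric_shape_exists by blast
  obtain \<nu> where "\<nu> \<in> partitions" "row \<nu> = R" using row_surject[OF R(1)] by blast
  thus "\<exists>\<nu>\<in>self_conjugate_partitions. A = frobenius \<nu>"
    using R by (intro bexI[of _ \<nu>]) (auto simp: self_conjugate_iff frobenius_def)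
qed

lemma card_ferrers: "card (ferrers \<nu>) = sum_list \<nu>"
proof -
  have "{(i, j). j < row \<nu> i} = Sigma {..<length \<nu>} (\<lambda>i. {..<row \<nu> i})"
    by (auto simp: row_def split: if_splits)
  moreover have "inj_on (\<lambda>(i, j). (Suc i, Suc j)) {(i, j). j < row \<nu> i}" by (auto intro: inj_onI)
  ultimately have "card (ferrers \<nu>) = (\<Sum>i<length \<nu>. row \<nu> i)"
    unfolding ferrers_eq by (simp add: card_image)
  also have "\<dots> = (\<Sum>i<length \<nu>. \<nu> ! i)" by (intro sum.cong refl) (auto simp: row_def)
  also have "\<dots> = sum_list \<nu>" by (simp add: sum_list_sum_nth lessThan_atLeast0)
  finally show ?thesis .
qed

lemma sum_list_frobenius:
  assumes "\<nu> \<in> self_conjugate_partitions"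
  shows "sum_list \<nu> = (\<Sum>a\<in>frobenius \<nu>. 2 * a + 1)"
proof -
  interpret symmetric_shape "row \<nu>" using assms by (simp add: self_conjugate_iff)
  have "inj_on (\<lambda>(i, j). (Suc i, Suc j)) boxes" by (auto intro: inj_onI)
  hence "card (ferrers \<nu>) = card boxes"
    unfolding ferrers_eq boxes_def[symmetric] by (rule card_image)
  thus ?thesis by (simp add: card_ferrers card_boxes frobenius_def)
qed

lemma durfee_frobenius:
  assumes "\<nu> \<in> self_conjugate_partitions"
  shows "durfee \<nu> = card (frobenius \<nu>)"
proof -
  interpret symmetric_shape "row \<nu>" using assms by (simp add: self_conjugate_iff)
  have down: "i \<in> diag" if "j \<in> diag" "i \<le> j" for i j
    using anti[OF that(2)] that by (auto simp: diag_def)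
  define D where "D = card diag"
  have dg: "diag = {..<D}"
  proof (cases "diag = {}")
    case False
    hence "diag = {..Max diag}"
      using finite_diag down[OF Max_in[OF finite_diag False]] by (auto intro: Max_ge)
    thus ?thesis unfolding D_def by (metis card_atMost lessThan_Suc_atMost)
  qed (simp add: D_def)
  have "{d. \<exists>a b. {a<..a + d} \<times> {b<..b + d} \<subseteq> ferrers \<nu>} = {..D}"
  proof (intro equalityI subsetI)
    fix d assume "d \<in> {d. \<exists>a b. {a<..a + d} \<times> {b<..b + d} \<subseteq> ferrers \<nu>}"
    then obtain a b where ab: "{a<..a + d} \<times> {b<..b + d} \<subseteq> ferrers \<nu>" by blast
    show "d \<in> {..D}"
    proof (cases d)
      case (Suc e)
      hence "(Suc (a + e), Suc (b + e)) \<in> ferrers \<nu>" using ab by auto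
      hence "b + e < row \<nu> (a + e)" by (simp only: ferrers_row_iff)
      also have "\<dots> \<le> row \<nu> e" by (rule anti) simp
      finally have "e \<in> diag" by (simp add: diag_def)
      thus ?thesis using dg Suc by auto
    qed simp
  next
    fix d assume "d \<in> {..D}"
    hence d: "d \<le> D" by simp
    have "{0<..0 + d} \<times> {0<..0 + d} \<subseteq> ferrers \<nu>"
    proof safe
      fix i j assume ij: "i \<in> {0<..0 + d}" "j \<in> {0<..0 + d}"
      then obtain i' j' where e: "i = Suc i'" "j = Suc j'" by (auto simp: gr0_conv_Suc)
      have "d - 1 \<in> diag" using ij d unfolding dg by auto
      moreover have "row \<nu> (d - 1) \<le> row \<nu> i'" using ij e by (intro anti) auto
      ultimately have "j' < row \<nu> i'" using ij e by (auto simp: diag_def)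
      thus "(i, j) \<in> ferrers \<nu>" by (simp only: e ferrers_row_iff)
    qed
    thus "d \<in> {d. \<exists>a b. {a<..a + d} \<times> {b<..b + d} \<subseteq> ferrers \<nu>}" by blast
  qed
  moreover have "Max {..D} = D" by (intro Max_eqI) auto
  ultimately have "durfee \<nu> = D" unfolding durfee_def by simp
  thus ?thesis by (simp add: D_def frobenius_def card_frob_set)
qed

lemma hook_length_row:
  assumes "\<nu> \<in> self_conjugate_partitions" "j < row \<nu> i"
  shows "hook_length \<nu> (Suc i, Suc j) = row \<nu> i - j + (row \<nu> j - i) - 1"
proof -
  interpret symmetric_shape "row \<nu>" using assms by (simp add: self_conjugate_iff)
  have ij: "i < row \<nu> j" using assms mirror by blast
  have "hook \<nu> (Suc i, Suc j) = (\<lambda>k. (Suc i, Suc k)) ` {j..<row \<nu> i} \<union> (\<lambda>k. (Suc k, Suc j)) ` {i<..<row \<nu> j}" (is "_ = ?A \<union> ?B")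
  proof (intro equalityI subsetI)
    fix w assume w: "w \<in> hook \<nu> (Suc i, Suc j)"
    then obtain k l where kl: "w = (Suc k, Suc l)" "l < row \<nu> k" unfolding hook_def ferrers_eq by auto
    thus "w \<in> ?A \<union> ?B" using w mirror[of l k] by (auto simp: hook_def image_iff)
  next
    fix w assume "w \<in> ?A \<union> ?B"
    thus "w \<in> hook \<nu> (Suc i, Suc j)" using mirror by (auto simp: hook_def ferrers_row_iff)
  qed
  moreover have "card (?A \<union> ?B) = card ?A + card ?B" by (rule card_Un_disjoint) auto
  moreover have "card ?A = row \<nu> i - j" by (subst card_image) (auto intro: inj_onI)
  moreover have "card ?B = row \<nu> j - i - 1" by (subst card_image) (auto intro: inj_onI)
  ultimately show ?thesis using ij by (simp add: hook_length_def)
qed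

lemma hook_product_frobenius:
  assumes "\<nu> \<in> self_conjugate_partitions"
  shows "(\<Prod>v\<in>ferrers \<nu>. 1 - 2 * z / (of_nat (hook_length \<nu> v) * of_int (hook_sign v))) = hook_product z (frobenius \<nu>)"
proof -
  interpret symmetric_shape "row \<nu>" using assms by (simp add: self_conjugate_iff)
  have inj: "inj_on (\<lambda>(i, j). (Suc i, Suc j)) boxes" by (auto intro: inj_onI)
  have "(\<Prod>v\<in>ferrers \<nu>. 1 - 2 * z / (of_nat (hook_length \<nu> v) * of_int (hook_sign v)))
      = (\<Prod>(i, j)\<in>boxes. 1 - 2 * z / (of_nat (row \<nu> i - j + (row \<nu> j - i) - 1) * (if j < i then -1 else 1)))"
    unfolding ferrers_eq boxes_def[symmetric] prod.reindex[OF inj]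
  proof (intro prod.cong refl)
    fix x assume x: "x \<in> boxes"
    obtain i j where ij: "x = (i, j)" by fastforce
    have "j < row \<nu> i" using x ij by (simp add: boxes_def)
    moreover have "(of_int (hook_sign (Suc i, Suc j)) :: complex) = (if j < i then -1 else 1)" by (simp add: hook_sign_def)
    ultimately show "((\<lambda>v. 1 - 2 * z / (of_nat (hook_length \<nu> v) * of_int (hook_sign v))) \<circ> (\<lambda>(i, j). (Suc i, Suc j))) x
      = (case x of (i, j) \<Rightarrow> 1 - 2 * z / (of_nat (row \<nu> i - j + (row \<nu> j - i) - 1) * (if j < i then -1 else 1)))"
      unfolding ij o_def prod.case hook_length_row[OF assms \<open>j < row \<nu> i\<close>] by (simp only:)
  qed
  thus ?thesis by (simp only: prod_hooks frobenius_def)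
qed

subsection \<open>Complex powers of power series\<close>

definition fps_log :: "complex fps \<Rightarrow> complex fps" where
  "fps_log F = fps_ln 1 oo (F - 1)"

lemma fps_cpow_log: "fps_cpow F a = fps_exp 1 oo (fps_const a * fps_log F)"
  by (simp add: fps_cpow_def fps_log_def)

lemma fps_log_nth_0 [simp]: "fps_nth (fps_log F) 0 = 0"
  by (simp add: fps_log_def)

lemma fps_exp_log:
  assumes "fps_nth F 0 = 1"
  shows "fps_exp 1 oo fps_log F = F"
proof -
  have *: "(fps_exp 1 - 1) oo fps_ln 1 = (fps_X :: complex fps)"
    by (simp add: fps_ln_fps_exp_inv fps_inv_right)
  have "fps_exp 1 oo fps_log F = (fps_exp 1 oo fps_ln 1) oo (F - 1)"
    unfolding fps_log_def by (rule fps_compose_assoc) (use assms in simp_all)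
  also have "fps_exp 1 oo fps_ln 1 = 1 + (fps_X :: complex fps)"
    using * by (simp add: fps_compose_sub_distrib algebra_simps)
  also have "(1 + fps_X) oo (F - 1) = F"
    using assms by (simp add: fps_compose_add_distrib)
  finally show ?thesis .
qed

lemma fps_log_exp:
  assumes "fps_nth u 0 = 0"
  shows "fps_log (fps_exp 1 oo u) = u"
proof -
  have "fps_log (fps_exp 1 oo u) = fps_ln 1 oo ((fps_exp 1 - 1) oo u)"
    by (simp add: fps_log_def fps_compose_sub_distrib)
  also have "\<dots> = (fps_ln 1 oo (fps_exp 1 - 1)) oo u"
    by (rule fps_compose_assoc) (use assms in simp_all)
  also have "fps_ln 1 oo (fps_exp 1 - 1) = (fps_X :: complex fps)"
    by (simp add: fps_ln_fps_exp_inv fps_inv)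
  also have "fps_X oo u = u" using assms by simp
  finally show ?thesis .
qed

text \<open>Both sides have constant term 0 and, by the product rule for logarithmic derivatives,
  the same derivative.\<close>

lemma fps_log_mult:
  assumes F: "fps_nth F 0 = 1" and G: "fps_nth G 0 = 1"
  shows "fps_log (F * G) = fps_log F + fps_log G"
proof -
  have d: "fps_deriv (fps_log H) * H = fps_deriv H" if "fps_nth H 0 = 1" for H
  proof -
    have "fps_deriv (fps_log H) = (inverse (1 + fps_X) oo (H - 1)) * fps_deriv H"
      unfolding fps_log_def using that by (subst fps_compose_deriv) (simp_all add: fps_ln_deriv)
    also have "inverse (1 + fps_X) oo (H - 1) = inverse H"
      using that by (subst fps_inverse_compose) (simp_all add: fps_compose_add_distrib)
    finally show ?thesis using that by (simp add: inverse_mult_eq_1' mult.commute mult.left_commute)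
  qed
  have FG: "fps_nth (F * G) 0 = 1" using F G by simp
  have "fps_deriv (fps_log (F * G)) * (F * G) = fps_deriv (fps_log F + fps_log G) * (F * G)"
  proof -
    have "fps_deriv (fps_log F + fps_log G) * (F * G) = (fps_deriv (fps_log F) * F) * G + F * (fps_deriv (fps_log G) * G)"
      by (simp add: algebra_simps)
    thus ?thesis unfolding d[OF FG] d[OF F] d[OF G] by (simp add: algebra_simps)
  qed
  moreover have "F * G \<noteq> 0" using FG by auto
  ultimately have "fps_deriv (fps_log (F * G)) = fps_deriv (fps_log F + fps_log G)" by simp
  thus ?thesis unfolding fps_deriv_eq_iff by simp
qed

text \<open>Obtained from \<open>fps_log_mult\<close>, because \<open>fps_log\<close> inverts the
  exponential on series with constant term 0.\<close>

lemma fps_exp_compose_add: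
  assumes "fps_nth u 0 = 0" "fps_nth v 0 = 0"
  shows "fps_exp 1 oo (u + v) = (fps_exp 1 oo u) * (fps_exp 1 oo v :: complex fps)"
proof -
  have "fps_log ((fps_exp 1 oo u) * (fps_exp 1 oo v)) = u + v"
    using assms by (subst fps_log_mult) (simp_all add: fps_log_exp)
  moreover have "fps_exp 1 oo fps_log ((fps_exp 1 oo u) * (fps_exp 1 oo v)) = (fps_exp 1 oo u) * (fps_exp 1 oo v)"
    by (rule fps_exp_log) simp
  ultimately show ?thesis by simp
qed

lemma fps_log_prod:
  assumes "\<And>i. i \<in> I \<Longrightarrow> fps_nth (F i) 0 = 1"
  shows "fps_log (\<Prod>i\<in>I. F i) = (\<Sum>i\<in>I. fps_log (F i)) \<and> fps_nth (\<Prod>i\<in>I. F i) 0 = 1"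
  using assms
proof (induction I rule: infinite_finite_induct)
  case (insert i I)
  thus ?case by (simp add: fps_log_mult)
qed (simp_all add: fps_log_def)

lemma fps_log_divide:
  assumes "fps_nth F 0 = 1" "fps_nth G 0 = 1"
  shows "fps_log (F / G) = fps_log F - fps_log G" "fps_nth (F / G) 0 = 1"
proof -
  have FG: "F / G * G = F" using assms by (simp add: fps_divide_unit inverse_mult_eq_1 mult.assoc)
  show 1: "fps_nth (F / G) 0 = 1" using assms by (simp add: fps_divide_unit)
  have "fps_log F = fps_log (F / G) + fps_log G"
    using fps_log_mult[OF 1 assms(2)] unfolding FG .
  thus "fps_log (F / G) = fps_log F - fps_log G" by simp
qed

lemma fps_exp_compose_of_nat:
  assumes "fps_nth F 0 = 1"
  shows "fps_exp 1 oo (of_nat n * fps_log F) = F ^ n"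
proof -
  have "fps_log (\<Prod>i<n. F) = of_nat n * fps_log F" "fps_nth (\<Prod>i<n. F) 0 = 1"
    using fps_log_prod[of "{..<n}" "\<lambda>_. F"] assms by auto
  thus ?thesis using fps_exp_log[of "F ^ n"] by simp
qed

text \<open>Congruence modulo X^(m + 1); products and substitution into a fixed series respect
  it.\<close>

definition fps_agree :: "nat \<Rightarrow> 'a fps \<Rightarrow> 'a fps \<Rightarrow> bool" where
  "fps_agree m F G \<longleftrightarrow> (\<forall>k\<le>m. fps_nth F k = fps_nth G k)"

lemma fps_agree_mult:
  assumes "fps_agree m F F'" "fps_agree m G G'"
  shows "fps_agree m (F * G) (F' * G' :: complex fps)"
  using assms unfolding fps_agree_def by (auto simp: fps_mult_nth intro!: sum.cong)

lemma fps_agree_power: "fps_agree m F G \<Longrightarrow> fps_agree m (F ^ n) (G ^ n :: complex fps)"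
proof (induction n)
  case 0
  show ?case by (simp add: fps_agree_def)
next
  case (Suc n)
  thus ?case by (simp add: fps_agree_mult)
qed

lemma fps_agree_compose:
  assumes "fps_agree m F G"
  shows "fps_agree m (H oo F) (H oo G :: complex fps)"
  using fps_agree_power[OF assms] unfolding fps_agree_def by (auto simp: fps_compose_nth intro!: sum.cong)

lemma fps_agree_euler_partial:
  assumes "d > 0" "m \<le> N"
  shows "fps_agree m (euler_partial d N) (euler_fps d :: complex fps)"
  unfolding fps_agree_def by (intro allI impI fps_nth_euler_partial_stable) (use assms in auto)

lemma fps_agree_log_euler_partial:
  assumes "d > 0" "m \<le> N"
  shows "fps_agree m (fps_log (euler_partial d N)) (fps_log (euler_fps d))"
  unfolding fps_log_def using fps_agree_euler_partial[OF assms]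
  by (intro fps_agree_compose) (simp add: fps_agree_def)

text \<open>Logarithms turn the partial products into combinations of logarithms of
  \<open>euler_partial\<close>, each coefficient of which is eventually constant. This is
  convergence for formal power series.\<close>

lemma euler_prodinf:
  fixes z :: complex
  defines "T \<equiv> \<lambda>k. fps_cpow (1 - fps_X ^ (2 * Suc k)) (z + 1) / (1 - fps_X ^ Suc k)"
  defines "L \<equiv> fps_const (z + 1) * fps_log (euler_fps 2) - fps_log (euler_fps 1)"
  shows "convergent_prod T" and "prodinf T = fps_exp 1 oo L"
proof -
  have lin0: "fps_nth (1 - fps_X ^ (d * Suc k) :: complex fps) 0 = 1" if "d > 0" for d k
    using that by simp
  have T: "fps_log (T k) = fps_const (z + 1) * fps_log (1 - fps_X ^ (2 * Suc k)) - fps_log (1 - fps_X ^ (1 * Suc k))"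
    "fps_nth (T k) 0 = 1" for k
  proof -
    have c: "fps_nth (fps_cpow (1 - fps_X ^ (2 * Suc k)) (z + 1)) 0 = 1" by (simp add: fps_cpow_def)
    have l: "fps_log (fps_cpow (1 - fps_X ^ (2 * Suc k)) (z + 1)) = fps_const (z + 1) * fps_log (1 - fps_X ^ (2 * Suc k))"
      unfolding fps_cpow_log by (rule fps_log_exp) simp
    have T1: "T k = fps_cpow (1 - fps_X ^ (2 * Suc k)) (z + 1) / (1 - fps_X ^ (1 * Suc k))" by (simp only: T_def mult_1)
    have l1: "fps_nth (1 - fps_X ^ (1 * Suc k) :: complex fps) 0 = 1" by (rule lin0) simp
    show "fps_log (T k) = fps_const (z + 1) * fps_log (1 - fps_X ^ (2 * Suc k)) - fps_log (1 - fps_X ^ (1 * Suc k))"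
      unfolding T1 fps_log_divide(1)[OF c l1] l ..
    show "fps_nth (T k) 0 = 1" unfolding T1 by (rule fps_log_divide(2)[OF c l1])
  qed
  have lg: "(\<Sum>k<N. fps_log (1 - fps_X ^ (d * Suc k))) = fps_log (euler_partial d N)" if "d > 0" for d N
    unfolding euler_partial_def using fps_log_prod[of "{..<N}" "\<lambda>k. 1 - fps_X ^ (d * Suc k)"] lin0[OF that] by auto
  have part: "(\<Prod>k<N. T k) = fps_exp 1 oo (fps_const (z + 1) * fps_log (euler_partial 2 N) - fps_log (euler_partial 1 N))" for N
  proof -
    have "(\<Prod>k<N. T k) = fps_exp 1 oo fps_log (\<Prod>k<N. T k)"
      using fps_log_prod[of "{..<N}" T] T(2) by (intro fps_exp_log[symmetric]) auto
    also have "fps_log (\<Prod>k<N. T k) = (\<Sum>k<N. fps_log (T k))" using fps_log_prod[of "{..<N}" T] T(2) by auto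
    also have "\<dots> = fps_const (z + 1) * (\<Sum>k<N. fps_log (1 - fps_X ^ (2 * Suc k))) - (\<Sum>k<N. fps_log (1 - fps_X ^ (1 * Suc k)))"
      unfolding T(1) sum_subtractf sum_distrib_left ..
    also have "\<dots> = fps_const (z + 1) * fps_log (euler_partial 2 N) - fps_log (euler_partial 1 N)"
      by (simp only: lg zero_less_numeral zero_less_one)
    finally show ?thesis .
  qed
  have "(\<lambda>n. \<Prod>k\<le>n. T (k + 0)) \<longlonglongrightarrow> (fps_exp 1 oo L)"
  proof (rule tendsto_fpsI)
    fix m
    show "\<forall>\<^sub>F n in sequentially. fps_nth (\<Prod>k\<le>n. T (k + 0)) m = fps_nth (fps_exp 1 oo L) m"
      using eventually_ge_at_top[of m]
    proof eventually_elim
      case (elim n)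
      have "fps_agree m (fps_const (z + 1) * fps_log (euler_partial 2 (Suc n)) - fps_log (euler_partial 1 (Suc n))) L"
        using fps_agree_log_euler_partial[of 2 m "Suc n"] fps_agree_log_euler_partial[of 1 m "Suc n"] elim by (simp add: fps_agree_def L_def)
      from fps_agree_compose[OF this, of "fps_exp 1"]
      show ?case by (simp add: lessThan_Suc_atMost[symmetric] part fps_agree_def del: prod.lessThan_Suc)
    qed
  qed
  moreover have "fps_exp 1 oo L \<noteq> 0" by (metis fps_compose_nth_0 fps_exp_nth fps_zero_nth fact_0 div_by_1 of_nat_1 power_0 zero_neq_one)
  \<comment> \<open>The constant term 1 makes the limit nonzero, as \<open>raw_has_prod\<close>
    demands.\<close>
  ultimately have raw: "raw_has_prod T 0 (fps_exp 1 oo L)" by (simp add: raw_has_prod_def)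
  thus "convergent_prod T" unfolding convergent_prod_def by blast
  have "T has_prod (fps_exp 1 oo L)" using raw by (simp add: has_prod_def)
  thus "prodinf T = fps_exp 1 oo L" by (rule has_prod_unique[symmetric])
qed

subsection \<open>Interpolation in z\<close>

definition polyfun :: "(complex \<Rightarrow> complex) \<Rightarrow> bool" where
  "polyfun f \<longleftrightarrow> (\<exists>p. \<forall>z. f z = poly p z)"

lemma polyfun_const [intro]: "polyfun (\<lambda>_. c)"
  unfolding polyfun_def by (rule exI[of _ "[:c:]"]) simp

lemma polyfun_id [intro]: "polyfun (\<lambda>z. z)"
  unfolding polyfun_def by (rule exI[of _ "[:0, 1:]"]) simp

lemma polyfun_add [intro]: "polyfun f \<Longrightarrow> polyfun g \<Longrightarrow> polyfun (\<lambda>z. f z + g z)"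
  unfolding polyfun_def by (metis poly_add)

lemma polyfun_diff [intro]: "polyfun f \<Longrightarrow> polyfun g \<Longrightarrow> polyfun (\<lambda>z. f z - g z)"
  unfolding polyfun_def by (metis poly_diff)

lemma polyfun_mult [intro]: "polyfun f \<Longrightarrow> polyfun g \<Longrightarrow> polyfun (\<lambda>z. f z * g z)"
  unfolding polyfun_def by (metis poly_mult)

lemma polyfun_divide [intro]: "polyfun f \<Longrightarrow> polyfun (\<lambda>z. f z / c)"
  using polyfun_mult[OF _ polyfun_const, of f "inverse c"] by (simp add: divide_inverse)

lemma polyfun_power [intro]: "polyfun f \<Longrightarrow> polyfun (\<lambda>z. f z ^ n)"
  by (induction n) auto

lemma polyfun_sum [intro]: "(\<And>i. i \<in> I \<Longrightarrow> polyfun (f i)) \<Longrightarrow> polyfun (\<lambda>z. \<Sum>i\<in>I. f i z)"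
  by (induction I rule: infinite_finite_induct) auto

lemma polyfun_prod [intro]: "(\<And>i. i \<in> I \<Longrightarrow> polyfun (f i)) \<Longrightarrow> polyfun (\<lambda>z. \<Prod>i\<in>I. f i z)"
  by (induction I rule: infinite_finite_induct) auto

lemma polyfun_fps_power:
  assumes "\<And>m. polyfun (\<lambda>z. fps_nth (u z) m)"
  shows "polyfun (\<lambda>z. fps_nth (u z ^ n) m)"
proof (induction n arbitrary: m)
  case 0
  show ?case by (simp add: polyfun_const)
next
  case (Suc n)
  show ?case unfolding power_Suc fps_mult_nth by (intro polyfun_sum polyfun_mult assms Suc)
qed

lemma polyfun_fps_compose:
  assumes "\<And>m. polyfun (\<lambda>z. fps_nth (u z) m)"
  shows "polyfun (\<lambda>z. fps_nth (H oo u z) m)"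
  unfolding fps_compose_nth by (intro polyfun_sum polyfun_mult polyfun_const polyfun_fps_power assms)

lemma polyfun_eqI:
  assumes "polyfun f" "polyfun g" "\<And>t. t > 0 \<Longrightarrow> f (of_nat t) = g (of_nat t)"
  shows "f z = g z"
proof -
  obtain p q where p: "\<And>z. f z = poly p z" and q: "\<And>z. g z = poly q z" using assms unfolding polyfun_def by blast
  have "p - q = 0"
  proof (rule ccontr)
    assume "p - q \<noteq> 0"
    hence "finite {z. poly (p - q) z = 0}" by (rule poly_roots_finite)
    moreover have "of_nat ` {0<..} \<subseteq> {z. poly (p - q) z = 0}" using assms(3) p q by auto
    ultimately have "finite (of_nat ` {0<..} :: complex set)" by (rule finite_subset[rotated])
    hence "finite {0::nat<..}" by (rule finite_imageD) (auto intro: inj_onI)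
    thus False using infinite_Ioi by blast
  qed
  thus ?thesis using p q by simp
qed

lemma polyfun_hook_product: "polyfun (\<lambda>z. hook_product z A)"
  unfolding hook_product_def by (intro polyfun_mult polyfun_prod polyfun_diff polyfun_divide polyfun_power polyfun_const polyfun_id)

text \<open>For fixed m both sides are polynomials in z. At a positive integer t the multipliers 2 *
  t - 1 and t + 1 are natural numbers, so the exponential becomes the quotient of ordinary powers in
  \<open>core_series\<close>.\<close>

lemma frobenius_sum_coeff:
  "fps_nth (fps_exp 1 oo (fps_const (2 * z - 1) * (fps_const (z + 1) * fps_log (euler_fps 2) - fps_log (euler_fps 1)))) m
    = (\<Sum>A | finite A \<and> (\<Sum>a\<in>A. 2 * a + 1) = m. (-1) ^ card A * hook_product z A)"
proof (rule polyfun_eqI[of _ _ z])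
  show "polyfun (\<lambda>z. fps_nth (fps_exp 1 oo (fps_const (2 * z - 1) * (fps_const (z + 1) * fps_log (euler_fps 2) - fps_log (euler_fps 1)))) m)"
    by (intro polyfun_fps_compose, unfold fps_mult_left_const_nth fps_sub_nth, intro polyfun_mult polyfun_diff polyfun_add polyfun_const polyfun_id)
  show "polyfun (\<lambda>z. \<Sum>A | finite A \<and> (\<Sum>a\<in>A. 2 * a + 1) = m. (-1) ^ card A * hook_product z A)"
    by (intro polyfun_sum polyfun_mult polyfun_const polyfun_hook_product)
next
  fix t :: nat assume t: "t > 0"
  define L1 L2 where "L1 = fps_log (euler_fps 1)" and "L2 = fps_log (euler_fps 2)"
  define u where "u = fps_const (2 * of_nat t - 1) * (fps_const (of_nat t + 1) * L2 - L1)"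
  define C where "C = Abs_fps (\<lambda>m. \<Sum>A | finite A \<and> (\<Sum>a\<in>A. 2 * a + 1) = m. (-1) ^ card A * hook_product (of_nat t) A)"
  have e: "fps_const (2 * of_nat t - 1 :: complex) = of_nat (2 * t - 1)" "fps_const (of_nat t + 1 :: complex) = of_nat (t + 1)"
  proof -
    have "2 * of_nat t - 1 = (of_nat (2 * t - 1) :: complex)" "of_nat t + 1 = (of_nat (t + 1) :: complex)" using t by (simp_all add: of_nat_diff)
    thus "fps_const (2 * of_nat t - 1 :: complex) = of_nat (2 * t - 1)" "fps_const (of_nat t + 1 :: complex) = of_nat (t + 1)"
      by (simp_all only: fps_of_nat)
  qed
  have "(fps_exp 1 oo u) * euler_fps 1 ^ (2 * t - 1) = (fps_exp 1 oo u) * (fps_exp 1 oo (of_nat (2 * t - 1) * L1))"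
    unfolding L1_def by (simp only: fps_exp_compose_of_nat euler_fps_nth_0)
  also have "\<dots> = fps_exp 1 oo (u + of_nat (2 * t - 1) * L1)"
    by (rule fps_exp_compose_add[symmetric]) (simp_all add: u_def L1_def L2_def)
  also have "u + of_nat (2 * t - 1) * L1 = of_nat ((2 * t - 1) * (t + 1)) * L2"
    unfolding u_def e of_nat_mult by (simp only: right_diff_distrib mult.assoc diff_add_cancel)
  also have "fps_exp 1 oo \<dots> = euler_fps 2 ^ ((2 * t - 1) * (t + 1))"
    unfolding L2_def by (rule fps_exp_compose_of_nat) simp
  also have "\<dots> = C * euler_fps 1 ^ (2 * t - 1)" unfolding C_def by (rule core_series[OF t, symmetric])
  finally have "(fps_exp 1 oo u) * euler_fps 1 ^ (2 * t - 1) = C * euler_fps 1 ^ (2 * t - 1)" .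
  moreover have "(euler_fps 1 :: complex fps) \<noteq> 0" by (metis euler_fps_nth_0 fps_zero_nth zero_neq_one)
  ultimately have "fps_exp 1 oo u = C" by simp
  thus "fps_nth (fps_exp 1 oo (fps_const (2 * of_nat t - 1) * (fps_const (of_nat t + 1) * fps_log (euler_fps 2) - fps_log (euler_fps 1)))) m
    = (\<Sum>A | finite A \<and> (\<Sum>a\<in>A. 2 * a + 1) = m. (-1) ^ card A * hook_product (of_nat t) A)"
    by (simp add: u_def C_def L1_def L2_def)
qed

lemma bij_betw_frobenius_weight:
  "bij_betw frobenius {\<nu> \<in> self_conjugate_partitions. sum_list \<nu> = m} {A. finite A \<and> (\<Sum>a\<in>A. 2 * a + 1) = m}"
proof -
  have inj: "inj_on frobenius self_conjugate_partitions" and im: "frobenius ` self_conjugate_partitions = {A. finite A}"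
    using bij_betw_frobenius by (auto simp: bij_betw_def)
  have "frobenius ` {\<nu> \<in> self_conjugate_partitions. sum_list \<nu> = m} = {A. finite A \<and> (\<Sum>a\<in>A. 2 * a + 1) = m}"
  proof (intro equalityI subsetI)
    fix A assume A: "A \<in> {A. finite A \<and> (\<Sum>a\<in>A. 2 * a + 1) = m}"
    hence "A \<in> frobenius ` self_conjugate_partitions" unfolding im by simp
    then obtain \<nu> where "\<nu> \<in> self_conjugate_partitions" "frobenius \<nu> = A" by blast
    with A show "A \<in> frobenius ` {\<nu> \<in> self_conjugate_partitions. sum_list \<nu> = m}"
      using sum_list_frobenius[of \<nu>] by auto
  qed (use im sum_list_frobenius in auto)
  thus ?thesis using inj_on_subset[OF inj] by (auto simp: bij_betw_def)
qed

theorem theorem1p1: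
  fixes z :: complex
  shows "convergent_prod (\<lambda>k. fps_cpow (1 - fps_X ^ (2 * Suc k)) (z + 1) / (1 - fps_X ^ Suc k)) \<and>
    ((\<lambda>\<nu>. fps_const ((- 1) ^ durfee \<nu>) * fps_X ^ sum_list \<nu> *
          fps_const (\<Prod>v\<in>ferrers \<nu>. 1 - 2 * z / (of_nat (hook_length \<nu> v) * of_int (hook_sign v))))
      has_sum
        fps_cpow (\<Prod>k. fps_cpow (1 - fps_X ^ (2 * Suc k)) (z + 1) / (1 - fps_X ^ Suc k)) (2 * z - 1))
      self_conjugate_partitions"
\<comment> \<open>The sum is taken coefficientwise: only the finitely many self-conjugate partitions
  of m contribute to the coefficient of index m.\<close>
proof (rule conjI[OF euler_prodinf(1) has_sum_fpsI])
  define F where "F \<nu> = fps_const ((- 1) ^ durfee \<nu>) * fps_X ^ sum_list \<nu> *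
    fps_const (\<Prod>v\<in>ferrers \<nu>. 1 - 2 * z / (of_nat (hook_length \<nu> v) * of_int (hook_sign v)))" for \<nu>
  define g where "g A = (-1) ^ card A * hook_product z A" for A
  have F: "fps_nth (F \<nu>) m = (if sum_list \<nu> = m then g (frobenius \<nu>) else 0)" if "\<nu> \<in> self_conjugate_partitions" for \<nu> m
    unfolding F_def g_def hook_product_frobenius[OF that] durfee_frobenius[OF that]
    by (auto simp: fps_X_power_nth)
  have fin: "finite {\<nu> \<in> self_conjugate_partitions. sum_list \<nu> = m}" for m
    using bij_betw_finite[OF bij_betw_frobenius_weight] finite_weight_sets by blast
  show "finite {\<nu> \<in> self_conjugate_partitions. fps_nth (F \<nu>) m \<noteq> 0}" for m
    by (rule finite_subset[OF _ fin[of m]]) (auto simp: F split: if_splits)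
  fix m
  have "fps_nth (fps_cpow (\<Prod>k. fps_cpow (1 - fps_X ^ (2 * Suc k)) (z + 1) / (1 - fps_X ^ Suc k)) (2 * z - 1)) m
      = (\<Sum>A | finite A \<and> (\<Sum>a\<in>A. 2 * a + 1) = m. g A)"
    \<comment> \<open>The infinite product is itself an exponential, so the outer power merely
      scales its exponent.\<close>
    unfolding euler_prodinf(2) unfolding g_def frobenius_sum_coeff[symmetric] fps_cpow_log
    by (subst fps_log_exp) simp_all
  also have "\<dots> = (\<Sum>\<nu> | \<nu> \<in> self_conjugate_partitions \<and> sum_list \<nu> = m. g (frobenius \<nu>))"
    by (rule sum.reindex_bij_betw[OF bij_betw_frobenius_weight, symmetric])
  also have "\<dots> = (\<Sum>\<nu> | \<nu> \<in> self_conjugate_partitions \<and> fps_nth (F \<nu>) m \<noteq> 0. fps_nth (F \<nu>) m)"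
    by (rule sum.mono_neutral_cong_right[OF fin]) (auto simp: F split: if_splits)
  finally show "fps_nth (fps_cpow (\<Prod>k. fps_cpow (1 - fps_X ^ (2 * Suc k)) (z + 1) / (1 - fps_X ^ Suc k)) (2 * z - 1)) m
      = (\<Sum>\<nu> | \<nu> \<in> self_conjugate_partitions \<and> fps_nth (F \<nu>) m \<noteq> 0. fps_nth (F \<nu>) m)" .
qed

end
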